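(* Let $M$ be an $n$-dimensional differentiable manifold, $G$ a Lie subgroup of $\mathrm{GL}(n)$ with Lie algebra $\mathfrak{g}\subset\mathfrak{gl}(n)$, and assume that $M$ is endowed with a symmetric (i.e. torsion-free) connection $\nabla$ and a $G$-structure $P\subset \mathrm{FR}(TM)$. Assume that $(M,\nabla,P)$ is infinitesimally homogeneous with characteristic tensors $R_0$ and $\mathfrak{I}_0$. Then, for an arbitrary lifting $\lambda$ of $\mathfrak{I}_0$, $$R_0(u,v)-[\lambda(u),\lambda(v)]+\lambda\big(\lambda(u)v-\lambda(v)u\big)\in\mathfrak{g}$$ for all $u,v\in\mathbb{R}^n$.
   Context: Manifolds are nonempty. $\mathrm{FR}(TM)$ is the $\mathrm{GL}(n)$-principal bundle of frames of $TM$, whose fiber over $x$ is the set of linear isomorphisms $p:\mathbb{R}^n\to T_xM$. A $G$-structure on $M$ is a $G$-principal subbundle $P$ of $\mathrm{FR}(TM)$ (so each fiber $P_x$ is a single orbit of $G$ acting by right composition). A connection on $M$ means a linear connection on $TM$; its curvature and torsion are $R(X,Y)Z=\nabla_X\nabla_YZ-\nabla_Y\nabla_XZ-\nabla_{[X,Y]}Z$ and $T(X,Y)=\nabla_XY-\nabla_YX-[X,Y]$. For $p\in P_x$, $\mathrm{Ad}_p:\mathfrak{gl}(n)\to\mathfrak{gl}(T_xM)$ is conjugation, $\mathrm{Ad}_p(L)=p\circ L\circ p^{-1}$. The subspace $\mathfrak{g}_x=\mathrm{Ad}_p(\mathfrak{g})$ does not depend on $p\in P_x$, and $\overline{\mathrm{Ad}}_p:\mathfrak{gl}(n)/\mathfrak{g}\to\mathfrak{gl}(T_xM)/\mathfrak{g}_x$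 is the induced isomorphism. Inner torsion: let $s:U\to P$ be a smooth local section of $P$ with $x\in U$, let $\mathrm{d}^s$ be the connection on $TM|_U$ given by ordinary differentiation of the components of vector fields in the frame $s$, and let $\Gamma=\nabla-\mathrm{d}^s$, so that $\Gamma_x:T_xM\to\mathfrak{gl}(T_xM)$. The inner torsion of $P$ at $x$ with respect to $\nabla$ is the linear map $\mathfrak{I}^P_x:T_xM\to\mathfrak{gl}(T_xM)/\mathfrak{g}_x$, $\mathfrak{I}^P_x(v)=\Gamma_x(v)+\mathfrak{g}_x$; it does not depend on $s$. The triple $(M,\nabla,P)$ is infinitesimally homogeneous if there exist multilinear maps $R_0:\mathbb{R}^n\times\mathbb{R}^n\times\mathbb{R}^n\to\mathbb{R}^n$, $T_0:\mathbb{R}^n\times\mathbb{R}^n\to\mathbb{R}^n$ and a linear map $\mathfrak{I}_0:\mathbb{R}^n\to\mathfrak{gl}(n)/\mathfrak{g}$ such that for every $x\in M$, every $p\in P_x$ and all $u,v,w\in\mathbb{R}^n$: $R_x(pu,pv)pw=p\,R_0(u,v,w)$, $T_x(pu,pv)=p\,T_0(u,v)$ and $\overline{\mathrm{Ad}}_p\circ\mathfrak{I}_0=\mathfrak{I}^P_x\circ p$. The maps $R_0,T_0,\mathfrak{I}_0$ are called the characteristic tensors (when $\nabla$ is symmetric, $T_0=0$). We regard $R_0(u,v)$ as the element $w\mapsto R_0(u,v,w)$ of $\mathfrak{gl}(n)$. A lifting of $\mathfrak{I}_0$ is a linear map $\lambda:\mathbb{R}^n\to\mathfrak{gl}(n)$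 with $\mathfrak{I}_0(u)=\lambda(u)+\mathfrak{g}$ for all $u\in\mathbb{R}^n$. $[\cdot,\cdot]$ is the commutator in $\mathfrak{gl}(n)$. *)

theory Defs
  imports "HOL-Analysis.Analysis" "HOL-Library.Function_Algebras"
begin

section \<open>Functions into a vector space as a vector space\<close>

instantiation "fun" :: (type, real_vector) real_vector
begin

definition "scaleR_fun r f = (\<lambda>x. r *\<^sub>R f x)"

instance
  by standard (auto simp: scaleR_fun_def fun_eq_iff algebra_simps)

end


section \<open>Smooth maps and smooth manifolds\<close>

text \<open>
  \<open>Ck_on k V S f\<close>: \<open>f\<close> is of class \<open>C\<^sup>k\<close> on the relatively open subset \<open>S\<close> of the linear
  subspace \<open>V\<close>. The derivative \<open>f' x\<close> is determined on \<open>V\<close> only, hence \<open>v \<in> V\<close>.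
  For maps between open subsets of the ambient space take \<open>V = UNIV\<close>.
\<close>

primrec Ck_on ::
  "nat \<Rightarrow> 'a::real_normed_vector set \<Rightarrow> 'a set \<Rightarrow> ('a \<Rightarrow> 'b::real_normed_vector) \<Rightarrow> bool" where
  "Ck_on 0 V S f \<longleftrightarrow> continuous_on S f"
| "Ck_on (Suc k) V S f \<longleftrightarrow>
     (\<exists>f'. (\<forall>x\<in>S. (f has_derivative f' x) (at x within S)) \<and>
           (\<forall>v\<in>V. Ck_on k V S (\<lambda>x. f' x v)))"

definition smooth_on ::
  "'a::real_normed_vector set \<Rightarrow> 'a set \<Rightarrow> ('a \<Rightarrow> 'b::real_normed_vector) \<Rightarrow> bool" where
  "smooth_on V S f \<longleftrightarrow> (\<forall>k. Ck_on k V S f)"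

text \<open>A chart is a domain together with a (total) map of which only the values on the domain matter.\<close>

type_synonym ('m, 'e) chart = "'m set \<times> ('m \<Rightarrow> 'e)"

definition chart_inv :: "('m, 'e) chart \<Rightarrow> 'e \<Rightarrow> 'm" where
  "chart_inv c = inv_into (fst c) (snd c)"

definition second_countable_space :: "'m topology \<Rightarrow> bool" where
  "second_countable_space T \<longleftrightarrow>
     (\<exists>\<B>. countable \<B> \<and> (\<forall>B\<in>\<B>. openin T B) \<and>
          (\<forall>U x. openin T U \<and> x \<in> U \<longrightarrow> (\<exists>B\<in>\<B>. x \<in> B \<and> B \<subseteq> U)))"

text \<open>
  A smooth manifold modelled on the linear subspace \<open>V\<close> (so of dimension \<open>dim V\<close>), given by its
  topology \<open>T\<close> and a smooth atlas \<open>A\<close>; the underlying set is \<open>topspace T\<close>. Allowing proper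
  subspaces makes the dimension a value rather than a type, which is needed for Lie subgroups.
\<close>

definition smooth_manifold ::
  "'e::euclidean_space set \<Rightarrow> 'm topology \<Rightarrow> ('m, 'e) chart set \<Rightarrow> bool" where
  "smooth_manifold V T A \<longleftrightarrow>
     subspace V \<and> Hausdorff_space T \<and> second_countable_space T \<and>
     (\<Union>c\<in>A. fst c) = topspace T \<and>
     (\<forall>c\<in>A. openin T (fst c) \<and> openin (top_of_set V) (snd c ` fst c) \<and>
        homeomorphic_map (subtopology T (fst c)) (top_of_set (snd c ` fst c)) (snd c)) \<and>
     (\<forall>c\<in>A. \<forall>d\<in>A. smooth_on V (snd c ` (fst c \<inter> fst d)) (snd d \<circ> chart_inv c))"

definition prod_atlas ::
  "('m, 'e) chart set \<Rightarrow> ('k, 'f) chart set \<Rightarrow> ('m \<times> 'k, 'e \<times> 'f) chart set" where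
  "prod_atlas A B = (\<lambda>(c, d). (fst c \<times> fst d, map_prod (snd c) (snd d))) ` (A \<times> B)"

text \<open>Smooth maps from a manifold \<open>(T, A)\<close> modelled on \<open>V\<close> to a manifold \<open>(T', B)\<close>.\<close>

definition smooth_map ::
  "'e::real_normed_vector set \<Rightarrow> 'm topology \<Rightarrow> ('m, 'e) chart set \<Rightarrow>
   'k topology \<Rightarrow> ('k, 'f::real_normed_vector) chart set \<Rightarrow> ('m \<Rightarrow> 'k) \<Rightarrow> bool" where
  "smooth_map V T A T' B f \<longleftrightarrow>
     continuous_map T T' f \<and>
     (\<forall>c\<in>A. \<forall>d\<in>B. smooth_on V (snd c ` (fst c \<inter> f -` fst d)) (snd d \<circ> f \<circ> chart_inv c))"


section \<open>Lie subgroups of the general linear group\<close>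

text \<open>
  A Lie subgroup of \<open>GL(n)\<close> is a subgroup with its own Lie group structure (topology \<open>\<tau>\<close>, atlas \<open>B\<close>)
  for which the inclusion is a smooth immersion; \<open>\<tau>\<close> may be finer than the topology induced by
  \<open>GL(n)\<close>. Its dimension is at most \<open>n\<^sup>2\<close>, so that it can be modelled on a linear
  subspace \<open>V\<close> of the space of matrices.
\<close>

definition lie_subgroup ::
  "(real^'n^'n) set \<Rightarrow> (real^'n^'n) topology \<Rightarrow> (real^'n^'n, real^'n^'n) chart set \<Rightarrow>
   (real^'n^'n) set \<Rightarrow> bool" where
  "lie_subgroup V \<tau> B G \<longleftrightarrow>
     (\<forall>g\<in>G. invertible g) \<and> mat 1 \<in> G \<and>
     (\<forall>g\<in>G. \<forall>h\<in>G. g ** h \<in> G) \<and> (\<forall>g\<in>G. matrix_inv g \<in> G) \<and>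
     smooth_manifold V \<tau> B \<and> topspace \<tau> = G \<and>
     smooth_map (V \<times> V) (prod_topology \<tau> \<tau>) (prod_atlas B B) \<tau> B (\<lambda>(g, h). g ** h) \<and>
     smooth_map V \<tau> B \<tau> B matrix_inv \<and>
     (\<forall>c\<in>B. smooth_on V (snd c ` fst c) (chart_inv c) \<and>
        (\<forall>z \<in> snd c ` fst c. \<forall>D.
           (chart_inv c has_derivative D) (at z within snd c ` fst c) \<longrightarrow> inj_on D V))"

text \<open>The Lie algebra: the image in \<open>gl(n)\<close> of the tangent space of \<open>G\<close> at the identity.\<close>

definition lie_algebra ::
  "(real^'n^'n) set \<Rightarrow> (real^'n^'n, real^'n^'n) chart set \<Rightarrow> (real^'n^'n) set" where
  "lie_algebra V B =
     {L. \<exists>c\<in>B. mat 1 \<in> fst c \<and>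
        (\<exists>D. (chart_inv c has_derivative D) (at (snd c (mat 1)) within snd c ` fst c) \<and> L \<in> D ` V)}"


section \<open>Tangent vectors and vector fields\<close>

text \<open>
  A tangent vector at \<open>x\<close> is the family of its coordinate vectors in all charts around \<open>x\<close>
  (related by the derivatives of the chart changes), extended by \<open>0\<close> to all other charts.
\<close>

type_synonym ('m, 'n) tvec = "('m, real^'n) chart \<Rightarrow> real^'n"

definition tangent_space :: "('m, real^'n) chart set \<Rightarrow> 'm \<Rightarrow> ('m, 'n) tvec set" where
  "tangent_space A x =
     {v. (\<forall>c. c \<notin> A \<or> x \<notin> fst c \<longrightarrow> v c = 0) \<and>
         (\<forall>c\<in>A. \<forall>d\<in>A. x \<in> fst c \<and> x \<in> fst d \<longrightarrow>
            v d = frechet_derivative (snd d \<circ> chart_inv c) (at (snd c x)) (v c))}"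

text \<open>The directional derivative \<open>v(f)\<close> at \<open>x\<close>, computed in any chart around \<open>x\<close>.\<close>

definition tderiv ::
  "('m, real^'n) chart set \<Rightarrow> ('m \<Rightarrow> 'b::real_normed_vector) \<Rightarrow> 'm \<Rightarrow> ('m, 'n) tvec \<Rightarrow> 'b" where
  "tderiv A f x v =
     (let c = (SOME c. c \<in> A \<and> x \<in> fst c)
      in frechet_derivative (f \<circ> chart_inv c) (at (snd c x)) (v c))"

definition smooth_fun_on ::
  "('m, real^'n) chart set \<Rightarrow> 'm set \<Rightarrow> ('m \<Rightarrow> 'b::real_normed_vector) \<Rightarrow> bool" where
  "smooth_fun_on A U f \<longleftrightarrow> (\<forall>c\<in>A. smooth_on UNIV (snd c ` (fst c \<inter> U)) (f \<circ> chart_inv c))"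

text \<open>
  Smooth vector fields on an open set \<open>U\<close>. Fields are total functions; their values outside
  \<open>U\<close> are irrelevant.
\<close>

definition vector_field_on ::
  "('m, real^'n) chart set \<Rightarrow> 'm set \<Rightarrow> ('m \<Rightarrow> ('m, 'n) tvec) \<Rightarrow> bool" where
  "vector_field_on A U X \<longleftrightarrow>
     (\<forall>y\<in>U. X y \<in> tangent_space A y) \<and>
     (\<forall>c\<in>A. smooth_on UNIV (snd c ` (fst c \<inter> U)) (\<lambda>z. X (chart_inv c z) c))"

text \<open>
  In the coordinates of any chart, \<open>[X,Y] = DY(X) - DX(Y)\<close>.
\<close>

definition lie_bracket ::
  "('m, real^'n) chart set \<Rightarrow> ('m \<Rightarrow> ('m, 'n) tvec) \<Rightarrow> ('m \<Rightarrow> ('m, 'n) tvec) \<Rightarrow>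
   'm \<Rightarrow> ('m, 'n) tvec" where
  "lie_bracket A X Y y =
     (\<lambda>c. if c \<in> A \<and> y \<in> fst c then
            frechet_derivative (\<lambda>z. Y (chart_inv c z) c) (at (snd c y)) (X y c) -
            frechet_derivative (\<lambda>z. X (chart_inv c z) c) (at (snd c y)) (Y y c)
          else 0)"

text \<open>
  Some vector field, smooth near \<open>x\<close>, with value \<open>v\<close> at \<open>x\<close>. It is used only to evaluate tensorial
  expressions, whose value at \<open>x\<close> does not depend on the choice.
\<close>

definition field_through ::
  "'m topology \<Rightarrow> ('m, real^'n) chart set \<Rightarrow> 'm \<Rightarrow> ('m, 'n) tvec \<Rightarrow> 'm \<Rightarrow> ('m, 'n) tvec" where
  "field_through T A x v =
     (SOME X. X x = v \<and> (\<exists>U. openin T U \<and> x \<in> U \<and> vector_field_on A U X))"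


section \<open>Linear connections, curvature and torsion\<close>

text \<open>
  A linear connection on \<open>TM\<close> is a covariant derivative operator on local smooth vector fields that
  is compatible with restriction to smaller open sets. The value \<open>nabla X Y y\<close> is meaningful
  only where \<open>X\<close> and \<open>Y\<close> are smooth vector fields near \<open>y\<close>.
\<close>

definition linear_connection ::
  "'m topology \<Rightarrow> ('m, real^'n) chart set \<Rightarrow>
   (('m \<Rightarrow> ('m, 'n) tvec) \<Rightarrow> ('m \<Rightarrow> ('m, 'n) tvec) \<Rightarrow> 'm \<Rightarrow> ('m, 'n) tvec) \<Rightarrow> bool" where
  "linear_connection T A nabla \<longleftrightarrow>
     (\<forall>U X Y. openin T U \<and> vector_field_on A U X \<and> vector_field_on A U Y \<longrightarrow>
        vector_field_on A U (nabla X Y) \<and>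
        (\<forall>X' Y'. vector_field_on A U X' \<and> vector_field_on A U Y' \<longrightarrow>
           (\<forall>y\<in>U. nabla (\<lambda>z. X z + X' z) Y y = nabla X Y y + nabla X' Y y) \<and>
           (\<forall>y\<in>U. nabla X (\<lambda>z. Y z + Y' z) y = nabla X Y y + nabla X Y' y) \<and>
           ((\<forall>y\<in>U. X y = X' y \<and> Y y = Y' y) \<longrightarrow> (\<forall>y\<in>U. nabla X Y y = nabla X' Y' y))) \<and>
        (\<forall>f :: 'm \<Rightarrow> real. smooth_fun_on A U f \<longrightarrow>
           (\<forall>y\<in>U. nabla (\<lambda>z. f z *\<^sub>R X z) Y y = f y *\<^sub>R nabla X Y y) \<and>
           (\<forall>y\<in>U. nabla X (\<lambda>z. f z *\<^sub>R Y z) y =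
              tderiv A f y (X y) *\<^sub>R Y y + f y *\<^sub>R nabla X Y y)))"

definition torsion_at ::
  "'m topology \<Rightarrow> ('m, real^'n) chart set \<Rightarrow>
   (('m \<Rightarrow> ('m, 'n) tvec) \<Rightarrow> ('m \<Rightarrow> ('m, 'n) tvec) \<Rightarrow> 'm \<Rightarrow> ('m, 'n) tvec) \<Rightarrow>
   'm \<Rightarrow> ('m, 'n) tvec \<Rightarrow> ('m, 'n) tvec \<Rightarrow> ('m, 'n) tvec" where
  "torsion_at T A nabla x u v =
     (let X = field_through T A x u; Y = field_through T A x v
      in nabla X Y x - nabla Y X x - lie_bracket A X Y x)"

definition curvature_at ::
  "'m topology \<Rightarrow> ('m, real^'n) chart set \<Rightarrow>
   (('m \<Rightarrow> ('m, 'n) tvec) \<Rightarrow> ('m \<Rightarrow> ('m, 'n) tvec) \<Rightarrow> 'm \<Rightarrow> ('m, 'n) tvec) \<Rightarrow>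
   'm \<Rightarrow> ('m, 'n) tvec \<Rightarrow> ('m, 'n) tvec \<Rightarrow> ('m, 'n) tvec \<Rightarrow> ('m, 'n) tvec" where
  "curvature_at T A nabla x u v w =
     (let X = field_through T A x u; Y = field_through T A x v; Z = field_through T A x w
      in nabla X (nabla Y Z) x - nabla Y (nabla X Z) x - nabla (lie_bracket A X Y) Z x)"

definition symmetric_connection ::
  "'m topology \<Rightarrow> ('m, real^'n) chart set \<Rightarrow>
   (('m \<Rightarrow> ('m, 'n) tvec) \<Rightarrow> ('m \<Rightarrow> ('m, 'n) tvec) \<Rightarrow> 'm \<Rightarrow> ('m, 'n) tvec) \<Rightarrow> bool" where
  "symmetric_connection T A nabla \<longleftrightarrow>
     linear_connection T A nabla \<and>
     (\<forall>x\<in>topspace T. \<forall>u\<in>tangent_space A x. \<forall>v\<in>tangent_space A x. torsion_at T A nabla x u v = 0)"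


section \<open>Frames and G-structures\<close>

definition frames :: "('m, real^'n) chart set \<Rightarrow> 'm \<Rightarrow> (real^'n \<Rightarrow> ('m, 'n) tvec) set" where
  "frames A x = {p. linear p \<and> bij_betw p UNIV (tangent_space A x)}"

definition frame_section_on ::
  "('m, real^'n) chart set \<Rightarrow> 'm set \<Rightarrow> ('m \<Rightarrow> real^'n \<Rightarrow> ('m, 'n) tvec) \<Rightarrow> bool" where
  "frame_section_on A U s \<longleftrightarrow>
     (\<forall>y\<in>U. s y \<in> frames A y) \<and> (\<forall>u. vector_field_on A U (\<lambda>y. s y u))"

text \<open>Smooth local section, defined near \<open>x\<close>, of the subset \<open>P\<close> of the frame bundle with fibers \<open>P y\<close>.\<close>

definition local_section ::
  "'m topology \<Rightarrow> ('m, real^'n) chart set \<Rightarrow> ('m \<Rightarrow> (real^'n \<Rightarrow> ('m, 'n) tvec) set) \<Rightarrow>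
   'm \<Rightarrow> ('m \<Rightarrow> real^'n \<Rightarrow> ('m, 'n) tvec) \<Rightarrow> bool" where
  "local_section T A P x s \<longleftrightarrow>
     (\<exists>U. openin T U \<and> x \<in> U \<and> frame_section_on A U s \<and> (\<forall>y\<in>U. s y \<in> P y))"

text \<open>
  A principal subbundle with structure group \<open>G\<close> is a subset of the frame bundle whose fibers are
  \<open>G\<close>-orbits and that admits a smooth local section around each point.
\<close>

definition G_structure ::
  "'m topology \<Rightarrow> ('m, real^'n) chart set \<Rightarrow> (real^'n^'n) set \<Rightarrow>
   ('m \<Rightarrow> (real^'n \<Rightarrow> ('m, 'n) tvec) set) \<Rightarrow> bool" where
  "G_structure T A G P \<longleftrightarrow>
     (\<forall>x\<in>topspace T.
        (\<exists>p\<in>frames A x. P x = {p \<circ> (\<lambda>u. g *v u) | g. g \<in> G}) \<and>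
        (\<exists>s. local_section T A P x s))"


section \<open>Inner torsion\<close>

text \<open>
  Endomorphisms of \<open>T\<^sub>xM\<close> are represented by functions that vanish outside \<open>T\<^sub>xM\<close>; note that
  \<open>range p = T\<^sub>xM\<close> for a frame \<open>p\<close> at \<open>x\<close>. Elements of quotient spaces are cosets.
\<close>

definition Ad ::
  "(real^'n \<Rightarrow> ('m, 'n) tvec) \<Rightarrow> real^'n^'n \<Rightarrow> ('m, 'n) tvec \<Rightarrow> ('m, 'n) tvec" where
  "Ad p L = (\<lambda>w. if w \<in> range p then p (L *v inv p w) else 0)"

definition coset :: "'a::plus set \<Rightarrow> 'a \<Rightarrow> 'a set" where
  "coset S a = (\<lambda>b. a + b) ` S"

text \<open>The subspace \<open>\<gg>\<^sub>x = Ad\<^sub>p(\<gg>)\<close>, for any \<open>p\<close> in the fiber \<open>P x\<close>.\<close>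

definition lie_algebra_at ::
  "(real^'n^'n) set \<Rightarrow> ('m \<Rightarrow> (real^'n \<Rightarrow> ('m, 'n) tvec) set) \<Rightarrow> 'm \<Rightarrow>
   (('m, 'n) tvec \<Rightarrow> ('m, 'n) tvec) set" where
  "lie_algebra_at \<gg> P x = Ad (SOME p. p \<in> P x) ` \<gg>"

text \<open>The connection \<open>d\<^sup>s\<close>: ordinary differentiation of components in the local frame \<open>s\<close>.\<close>

definition frame_connection ::
  "('m, real^'n) chart set \<Rightarrow> ('m \<Rightarrow> real^'n \<Rightarrow> ('m, 'n) tvec) \<Rightarrow>
   ('m \<Rightarrow> ('m, 'n) tvec) \<Rightarrow> ('m \<Rightarrow> ('m, 'n) tvec) \<Rightarrow> 'm \<Rightarrow> ('m, 'n) tvec" where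
  "frame_connection A s X Y y = s y (tderiv A (\<lambda>z. inv (s z) (Y z)) y (X y))"

text \<open>\<open>\<Gamma> = \<nabla> - d\<^sup>s\<close> as a map from \<open>T\<^sub>xM\<close> to \<open>gl(T\<^sub>xM)\<close>.\<close>

definition connection_difference ::
  "'m topology \<Rightarrow> ('m, real^'n) chart set \<Rightarrow>
   (('m \<Rightarrow> ('m, 'n) tvec) \<Rightarrow> ('m \<Rightarrow> ('m, 'n) tvec) \<Rightarrow> 'm \<Rightarrow> ('m, 'n) tvec) \<Rightarrow>
   ('m \<Rightarrow> real^'n \<Rightarrow> ('m, 'n) tvec) \<Rightarrow> 'm \<Rightarrow>
   ('m, 'n) tvec \<Rightarrow> ('m, 'n) tvec \<Rightarrow> ('m, 'n) tvec" where
  "connection_difference T A nabla s x v =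
     (\<lambda>w. if w \<in> tangent_space A x then
            (let X = field_through T A x v; Y = field_through T A x w
             in nabla X Y x - frame_connection A s X Y x)
          else 0)"

text \<open>The inner torsion does not depend on the local section \<open>s\<close> of \<open>P\<close> around \<open>x\<close>.\<close>

definition inner_torsion ::
  "'m topology \<Rightarrow> ('m, real^'n) chart set \<Rightarrow>
   (('m \<Rightarrow> ('m, 'n) tvec) \<Rightarrow> ('m \<Rightarrow> ('m, 'n) tvec) \<Rightarrow> 'm \<Rightarrow> ('m, 'n) tvec) \<Rightarrow>
   (real^'n^'n) set \<Rightarrow> ('m \<Rightarrow> (real^'n \<Rightarrow> ('m, 'n) tvec) set) \<Rightarrow> 'm \<Rightarrow>
   ('m, 'n) tvec \<Rightarrow> (('m, 'n) tvec \<Rightarrow> ('m, 'n) tvec) set" where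
  "inner_torsion T A nabla \<gg> P x v =
     (let s = (SOME s. local_section T A P x s)
      in coset (lie_algebra_at \<gg> P x) (connection_difference T A nabla s x v))"


section \<open>Infinitesimal homogeneity\<close>

definition trilinear ::
  "('a::real_vector \<Rightarrow> 'a \<Rightarrow> 'a \<Rightarrow> 'b::real_vector) \<Rightarrow> bool" where
  "trilinear R \<longleftrightarrow>
     (\<forall>v w. linear (\<lambda>u. R u v w)) \<and> (\<forall>u w. linear (\<lambda>v. R u v w)) \<and> (\<forall>u v. linear (\<lambda>w. R u v w))"

text \<open>Linear maps into the quotient by the subspace \<open>S\<close>, whose elements are the cosets of \<open>S\<close>.\<close>

definition linear_to_quotient ::
  "'b::real_vector set \<Rightarrow> ('a::real_vector \<Rightarrow> 'b set) \<Rightarrow> bool" where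
  "linear_to_quotient S J \<longleftrightarrow>
     (\<forall>u. \<exists>a. J u = coset S a) \<and>
     (\<forall>u v a b. J u = coset S a \<and> J v = coset S b \<longrightarrow> J (u + v) = coset S (a + b)) \<and>
     (\<forall>r u a. J u = coset S a \<longrightarrow> J (r *\<^sub>R u) = coset S (r *\<^sub>R a))"

text \<open>
  \<open>(M, \<nabla>, P)\<close> is infinitesimally homogeneous with characteristic tensors \<open>R\<^sub>0\<close>, \<open>T\<^sub>0\<close>, \<open>J\<^sub>0\<close>.
  The isomorphism of quotients induced by \<open>Ad p\<close> maps a coset to its image under \<open>Ad p\<close>.
\<close>

definition characteristic_tensors ::
  "'m topology \<Rightarrow> ('m, real^'n) chart set \<Rightarrow>
   (('m \<Rightarrow> ('m, 'n) tvec) \<Rightarrow> ('m \<Rightarrow> ('m, 'n) tvec) \<Rightarrow> 'm \<Rightarrow> ('m, 'n) tvec) \<Rightarrow>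
   (real^'n^'n) set \<Rightarrow> ('m \<Rightarrow> (real^'n \<Rightarrow> ('m, 'n) tvec) set) \<Rightarrow>
   (real^'n \<Rightarrow> real^'n \<Rightarrow> real^'n \<Rightarrow> real^'n) \<Rightarrow> (real^'n \<Rightarrow> real^'n \<Rightarrow> real^'n) \<Rightarrow>
   (real^'n \<Rightarrow> (real^'n^'n) set) \<Rightarrow> bool" where
  "characteristic_tensors T A nabla \<gg> P R\<^sub>0 T\<^sub>0 J\<^sub>0 \<longleftrightarrow>
     trilinear R\<^sub>0 \<and> bilinear T\<^sub>0 \<and> linear_to_quotient \<gg> J\<^sub>0 \<and>
     (\<forall>x\<in>topspace T. \<forall>p\<in>P x. \<forall>u v w.
        curvature_at T A nabla x (p u) (p v) (p w) = p (R\<^sub>0 u v w) \<and>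
        torsion_at T A nabla x (p u) (p v) = p (T\<^sub>0 u v) \<and>
        Ad p ` J\<^sub>0 u = inner_torsion T A nabla \<gg> P x (p u))"

definition lifting ::
  "'b::real_vector set \<Rightarrow> ('a::real_vector \<Rightarrow> 'b set) \<Rightarrow> ('a \<Rightarrow> 'b) \<Rightarrow> bool" where
  "lifting S J l \<longleftrightarrow> linear l \<and> (\<forall>u. J u = coset S (l u))"

definition commutator :: "real^'n^'n \<Rightarrow> real^'n^'n \<Rightarrow> real^'n^'n" where
  "commutator L K = L ** K - K ** L"

end

theory Submission
  imports Defs
begin

text \<open>
  In a local section \<open>s\<close> of \<open>P\<close> the connection becomes a matrix-valued form \<open>\<theta>\<close>, and for a symmetric
  connection the curvature, read in the frame \<open>s\<close>, is
  \<open>D\<^sub>u \<theta>(v) - D\<^sub>v \<theta>(u) + [\<theta>(u), \<theta>(v)] - \<theta>(\<theta>(u)v - \<theta>(v)u)\<close>.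
  Infinitesimal homogeneity says that \<open>\<kappa> = \<theta> - \<lambda>\<close> takes values in \<open>\<gg>\<close> at every point. So do its
  derivatives, which are those of \<open>\<theta>\<close> since \<open>\<lambda>\<close> is constant. Modulo \<open>\<gg>\<close> only the cross terms
  \<open>[\<lambda>(u), L] + \<lambda>(L u)\<close> with \<open>L \<in> \<gg>\<close> remain to be controlled. They lie in \<open>\<gg>\<close> because
  \<open>\<lambda>(g u) - g \<lambda>(u) g\<^sup>-\<^sup>1 \<in> \<gg>\<close> for \<open>g \<in> G\<close>, which is differentiated along a curve in \<open>G\<close>.

  Sections of \<open>P\<close> are smooth only as maps into the frame bundle, while the topology of \<open>G\<close> may be finer
  than that of \<open>GL(n)\<close>. Comparing two sections therefore needs that a differentiable curve of matrices
  with values in \<open>G\<close> is tangent to \<open>\<gg>\<close>. In a slice chart, the transverse component of such a curve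
  takes only countably many values, since \<open>G\<close> is second countable, and so is constant.
\<close>

section \<open>Calculus of smooth maps\<close>

text \<open>Several notions are evaluated on arbitrary choices: \<open>curvature_at\<close> and
  \<open>torsion_at\<close> on fields extending given vectors, \<open>inner_torsion\<close> on a
  section and a frame picked anew at each point, \<open>tderiv\<close> in some chart. Homogeneity
  thus speaks about unrelated choices at different points, while the argument differentiates along
  one section. Much of the work is to express each notion through that section alone: torsion and
  curvature by tensoriality, inner torsion by the change of section. The Lie algebra is defined as a
  union over charts and has no evident linear structure. Describing it as the set of velocities at
  the identity of curves in \<open>G\<close> makes it an Ad-invariant subspace. A subspace of
  matrices is closed, so a differentiable curve inside it has its velocity there as well; this one
  principle yields commutators, the derivatives of the connection form and the cross terms.\<close>

lemma Ck_on_Suc_imp: "Ck_on (Suc k) V S f \<Longrightarrow> Ck_on k V S f"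
proof (induction k arbitrary: f)
  case 0
  then show ?case
    by (auto simp: continuous_on_eq_continuous_within intro: has_derivative_continuous)
next
  case (Suc k)
  then show ?case by (subst Ck_on.simps) (metis Ck_on.simps(2))
qed

lemma Ck_on_cong:
  assumes "\<And>x. x \<in> S \<Longrightarrow> f x = g x"
  shows "Ck_on k V S f \<longleftrightarrow> Ck_on k V S g"
proof (cases k)
  case 0
  then show ?thesis using assms by (auto cong: continuous_on_cong)
next
  case (Suc k')
  have "(f has_derivative D) (at x within S) \<longleftrightarrow> (g has_derivative D) (at x within S)"
    if "x \<in> S" for x D
    using assms that by (metis has_derivative_transform)
  then show ?thesis using Suc by simp
qed

lemma Ck_on_subset: "Ck_on k V S f \<Longrightarrow> T \<subseteq> S \<Longrightarrow> Ck_on k V T f"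
proof (induction k arbitrary: f)
  case 0
  then show ?case by (auto intro: continuous_on_subset)
next
  case (Suc k)
  then show ?case by simp (metis has_derivative_subset subsetD)
qed

lemma Ck_on_const: "Ck_on k V S (\<lambda>x. a)"
proof (induction k arbitrary: a)
  case (Suc k)
  then show ?case by (auto intro!: exI[of _ "\<lambda>x v. 0"] has_derivative_const)
qed simp

lemma Ck_on_bounded_linear:
  assumes "bounded_linear g"
  shows "Ck_on k V S f \<Longrightarrow> Ck_on k V S (\<lambda>x. g (f x))"
proof (induction k arbitrary: f)
  case 0
  then show ?case using assms by (auto intro: bounded_linear.continuous_on)
next
  case (Suc k)
  then obtain f' where "\<forall>x\<in>S. (f has_derivative f' x) (at x within S)"
    and "\<forall>v\<in>V. Ck_on k V S (\<lambda>x. f' x v)"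
    by auto
  then show ?case using Suc.IH
    by (auto intro!: exI[of _ "\<lambda>x v. g (f' x v)"] bounded_linear.has_derivative[OF assms])
qed

lemma Ck_on_add: "Ck_on k V S f \<Longrightarrow> Ck_on k V S g \<Longrightarrow> Ck_on k V S (\<lambda>x. f x + g x)"
proof (induction k arbitrary: f g)
  case 0
  then show ?case by (auto intro: continuous_on_add)
next
  case (Suc k)
  then obtain f' g' where "\<forall>x\<in>S. (f has_derivative f' x) (at x within S)"
    and "\<forall>v\<in>V. Ck_on k V S (\<lambda>x. f' x v)"
    and "\<forall>x\<in>S. (g has_derivative g' x) (at x within S)"
    and "\<forall>v\<in>V. Ck_on k V S (\<lambda>x. g' x v)"
    by auto
  then show ?case using Suc.IH
    by (auto intro!: exI[of _ "\<lambda>x v. f' x v + g' x v"] has_derivative_add)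
qed

lemma Ck_on_minus: "Ck_on k V S f \<Longrightarrow> Ck_on k V S (\<lambda>x. - f x)"
  by (rule Ck_on_bounded_linear[OF bounded_linear_minus[OF bounded_linear_ident]])

lemma Ck_on_sum: "(\<And>i. i \<in> I \<Longrightarrow> Ck_on k V S (f i)) \<Longrightarrow> Ck_on k V S (\<lambda>x. \<Sum>i\<in>I. f i x)"
  by (induction I rule: infinite_finite_induct) (auto intro: Ck_on_add Ck_on_const)

lemma Ck_on_scaleR:
  fixes f :: "'a::real_normed_vector \<Rightarrow> real"
  shows "Ck_on k V S f \<Longrightarrow> Ck_on k V S g \<Longrightarrow> Ck_on k V S (\<lambda>x. f x *\<^sub>R g x)"
proof (induction k arbitrary: f g)
  case 0
  then show ?case by (auto intro: continuous_on_scaleR)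
next
  case (Suc k)
  then obtain f' g' where "\<forall>x\<in>S. (f has_derivative f' x) (at x within S)"
    and "\<forall>v\<in>V. Ck_on k V S (\<lambda>x. f' x v)"
    and "\<forall>x\<in>S. (g has_derivative g' x) (at x within S)"
    and "\<forall>v\<in>V. Ck_on k V S (\<lambda>x. g' x v)"
    by auto
  moreover have "Ck_on k V S f" "Ck_on k V S g"
    using Suc.prems by (auto intro!: Ck_on_Suc_imp simp del: Ck_on.simps)
  ultimately show ?case using Suc.IH
    by (auto intro!: exI[of _ "\<lambda>x v. f x *\<^sub>R g' x v + f' x v *\<^sub>R g x"] has_derivative_scaleR
          Ck_on_add)
qed

lemma Ck_on_prod:
  fixes f :: "'i \<Rightarrow> 'a::real_normed_vector \<Rightarrow> real"
  shows "(\<And>i. i \<in> I \<Longrightarrow> Ck_on k V S (f i)) \<Longrightarrow> Ck_on k V S (\<lambda>x. \<Prod>i\<in>I. f i x)"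
proof (induction I rule: infinite_finite_induct)
  case (insert i I)
  then have "Ck_on k V S (\<lambda>x. f i x *\<^sub>R (\<Prod>i\<in>I. f i x))"
    by (intro Ck_on_scaleR) auto
  with insert show ?case by simp
qed (auto intro: Ck_on_const)

text \<open>Induction on \<open>k\<close> closes because the derivative is a product of
  \<open>f' x v\<close> and of the inverse itself, both already of class one lower.\<close>

lemma Ck_on_inverse:
  fixes f :: "'a::real_normed_vector \<Rightarrow> real"
  assumes nz: "\<And>x. x \<in> S \<Longrightarrow> f x \<noteq> 0"
  shows "Ck_on k V S f \<Longrightarrow> Ck_on k V S (\<lambda>x. inverse (f x))"
proof (induction k)
  case 0
  then show ?case using nz by (auto intro: continuous_on_inverse)
next
  case (Suc k)
  then obtain f' where f': "\<forall>x\<in>S. (f has_derivative f' x) (at x within S)"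
    and ck: "\<forall>v\<in>V. Ck_on k V S (\<lambda>x. f' x v)"
    by auto
  have inv: "Ck_on k V S (\<lambda>x. inverse (f x))"
    using Suc Ck_on_Suc_imp by blast
  have "Ck_on k V S (\<lambda>x. - (inverse (f x) *\<^sub>R (f' x v *\<^sub>R inverse (f x))))" if "v \<in> V" for v
    by (intro Ck_on_minus Ck_on_scaleR inv) (use ck that in auto)
  then have "\<forall>v\<in>V. Ck_on k V S (\<lambda>x. - (inverse (f x) * f' x v * inverse (f x)))"
    by (simp add: mult.assoc)
  with f' nz show ?case
    by (auto intro!: exI[of _ "\<lambda>x v. - (inverse (f x) * f' x v * inverse (f x))"]
          has_derivative_inverse)
qed

lemma Ck_on_vec:
  fixes f :: "'a::real_normed_vector \<Rightarrow> 'b::euclidean_space^'n"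
  assumes "\<And>i. Ck_on k V S (\<lambda>x. f x $ i)"
  shows "Ck_on k V S f"
proof -
  have "linear (axis i :: 'b \<Rightarrow> 'b^'n)" for i
    by (rule linearI) (auto simp: axis_def vec_eq_iff)
  then have bl: "bounded_linear (axis i :: 'b \<Rightarrow> 'b^'n)" for i
    by (rule linear_conv_bounded_linear[THEN iffD1])
  have "Ck_on k V S (\<lambda>x. \<Sum>i\<in>UNIV. axis i (f x $ i))"
    by (rule Ck_on_sum) (rule Ck_on_bounded_linear[OF bl assms])
  moreover have "(\<Sum>i\<in>UNIV. axis i (f x $ i)) = f x" for x
    by (simp add: axis_def vec_eq_iff)
  ultimately show ?thesis by simp
qed

lemma Ck_on_nth: "Ck_on k V S f \<Longrightarrow> Ck_on k V S (\<lambda>x. f x $ i)"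
  by (rule Ck_on_bounded_linear[OF bounded_linear_vec_nth])

lemma Ck_on_det:
  fixes M :: "'a::real_normed_vector \<Rightarrow> real^'n^'n"
  assumes "\<And>i j. Ck_on k V S (\<lambda>x. M x $ i $ j)"
  shows "Ck_on k V S (\<lambda>x. det (M x))"
proof -
  have "Ck_on k V S (\<lambda>x. \<Sum>p | p permutes (UNIV :: 'n set).
      of_int (sign p) *\<^sub>R (\<Prod>i\<in>UNIV. M x $ i $ p i))"
    by (intro Ck_on_sum Ck_on_scaleR Ck_on_const Ck_on_prod assms)
  then show ?thesis by (simp add: det_def)
qed

text \<open>Cramer's rule writes the solution as a quotient of determinants in the entries of
  \<open>M\<close> and of the right-hand side. It serves to read off components in a moving
  frame.\<close>

lemma Ck_on_linear_solve:
  fixes M :: "'a::real_normed_vector \<Rightarrow> real^'n^'n"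
  assumes M: "\<And>i j. Ck_on k V S (\<lambda>x. M x $ i $ j)"
    and b: "Ck_on k V S (\<lambda>x. M x *v b x)"
    and nz: "\<And>x. x \<in> S \<Longrightarrow> det (M x) \<noteq> 0"
  shows "Ck_on k V S b"
proof -
  define N where "N l x = (\<chi> i j. if j = l then (M x *v b x) $ i else M x $ i $ j)" for l x
  have "b x = (\<chi> l. inverse (det (M x)) *\<^sub>R det (N l x))" if "x \<in> S" for x
    using cramer[OF nz[OF that], of "b x" "M x *v b x"]
    by (simp add: N_def divide_inverse mult.commute)
  moreover have N: "Ck_on k V S (\<lambda>x. N l x $ i $ j)" for l i j
    using M Ck_on_nth[OF b] by (cases "j = l") (auto simp: N_def)
  have "Ck_on k V S (\<lambda>x. inverse (det (M x)) *\<^sub>R det (N l x))" for l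
    by (intro Ck_on_scaleR Ck_on_inverse Ck_on_det M N nz)
  then have "Ck_on k V S (\<lambda>x. (\<chi> l. inverse (det (M x)) *\<^sub>R det (N l x)) :: real^'n)"
    by (intro Ck_on_vec) simp
  ultimately show ?thesis using Ck_on_cong by (metis (no_types, lifting))
qed

section \<open>Symmetry of mixed second derivatives\<close>

lemma has_vector_derivative_along_line:
  assumes "(f has_derivative f') (at (p + t *\<^sub>R a))"
  shows "((\<lambda>\<tau>. f (p + \<tau> *\<^sub>R a)) has_vector_derivative f' a) (at t)"
proof -
  have "((\<lambda>\<tau>. f (p + \<tau> *\<^sub>R a)) has_derivative (\<lambda>x. f' (x *\<^sub>R a))) (at t)"
    by (rule has_derivative_compose[of "\<lambda>\<tau>. p + \<tau> *\<^sub>R a"])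
       (use assms in \<open>auto intro!: derivative_eq_intros\<close>)
  then show ?thesis
    by (simp add: has_vector_derivative_def linear_simps has_derivative_bounded_linear[OF assms])
qed

text \<open>The second difference over the parallelogram with sides \<open>s *\<^sub>R a\<close> and
  \<open>s *\<^sub>R b\<close> becomes a second derivative after two mean value theorems, first
  along \<open>a\<close>, then along \<open>b\<close>. The intermediate point is only known to be
  close to \<open>z\<close>.\<close>

lemma mixed_difference_mvt:
  fixes f :: "'a::real_normed_vector \<Rightarrow> real"
  assumes W: "ball z r \<subseteq> W" and s: "0 < s" "s * (norm a + norm b) < r"
    and f: "\<And>x. x \<in> W \<Longrightarrow> (f has_derivative f' x) (at x)"
    and fa: "\<And>x. x \<in> W \<Longrightarrow> ((\<lambda>x. f' x a) has_derivative g x) (at x)"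
  shows "\<exists>y. dist y z \<le> s * (norm a + norm b) \<and>
    f (z + s *\<^sub>R a + s *\<^sub>R b) - f (z + s *\<^sub>R a) - f (z + s *\<^sub>R b) + f z = s * s * g y b"
proof -
  have near: "norm (t *\<^sub>R a + t' *\<^sub>R b) \<le> s * (norm a + norm b)"
    if "0 \<le> t" "t \<le> s" "0 \<le> t'" "t' \<le> s" for t t'
  proof -
    have "norm (t *\<^sub>R a + t' *\<^sub>R b) \<le> t * norm a + t' * norm b"
      using norm_triangle_ineq[of "t *\<^sub>R a" "t' *\<^sub>R b"] that by simp
    also have "\<dots> \<le> s * norm a + s * norm b"
      using that by (intro add_mono mult_right_mono) auto
    finally show ?thesis by (simp add: algebra_simps)
  qed
  have inW: "z + t *\<^sub>R a + t' *\<^sub>R b \<in> W" if "0 \<le> t" "t \<le> s" "0 \<le> t'" "t' \<le> s" for t t'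
    using near[OF that] s W by (auto simp: dist_norm add.assoc norm_minus_commute subset_iff)
  \<comment> \<open>\<open>h s - h 0\<close> is the second difference, read as the increment along
    \<open>a\<close> of a difference along \<open>b\<close>.\<close>
  define h where "h t = f (z + s *\<^sub>R b + t *\<^sub>R a) - f (z + t *\<^sub>R a)" for t
  have "(h has_real_derivative (f' (z + s *\<^sub>R b + t *\<^sub>R a) a - f' (z + t *\<^sub>R a) a)) (at t)"
    if "0 \<le> t" "t \<le> s" for t
    unfolding h_def has_real_derivative_iff_has_vector_derivative
    by (intro has_vector_derivative_diff has_vector_derivative_along_line f)
       (use inW[of t s] inW[of t 0] that s in \<open>auto simp: algebra_simps\<close>)
  then obtain t where t: "0 < t" "t < s"
    and ht: "h s - h 0 = (s - 0) * (f' (z + s *\<^sub>R b + t *\<^sub>R a) a - f' (z + t *\<^sub>R a) a)"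
    using MVT2[of 0 s h "\<lambda>t. f' (z + s *\<^sub>R b + t *\<^sub>R a) a - f' (z + t *\<^sub>R a) a"] s by blast
  have "((\<lambda>t'. f' (z + t *\<^sub>R a + t' *\<^sub>R b) a) has_real_derivative g (z + t *\<^sub>R a + t' *\<^sub>R b) b) (at t')"
    if "0 \<le> t'" "t' \<le> s" for t'
    unfolding has_real_derivative_iff_has_vector_derivative
    using has_vector_derivative_along_line[OF fa[OF inW[of t t']]] t that by auto
  then obtain t' where t': "0 < t'" "t' < s"
    and "f' (z + t *\<^sub>R a + s *\<^sub>R b) a - f' (z + t *\<^sub>R a + 0 *\<^sub>R b) a
       = (s - 0) * g (z + t *\<^sub>R a + t' *\<^sub>R b) b"
    using MVT2[of 0 s "\<lambda>t'. f' (z + t *\<^sub>R a + t' *\<^sub>R b) a" "\<lambda>t'. g (z + t *\<^sub>R a + t' *\<^sub>R b) b"] s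
    by blast
  with ht have "h s - h 0 = s * s * g (z + t *\<^sub>R a + t' *\<^sub>R b) b"
    by (simp add: algebra_simps)
  moreover have "dist (z + t *\<^sub>R a + t' *\<^sub>R b) z \<le> s * (norm a + norm b)"
    using near[of t t'] t t' by (simp add: dist_norm add.assoc)
  ultimately show ?thesis
    by (intro exI[of _ "z + t *\<^sub>R a + t' *\<^sub>R b"]) (simp add: h_def algebra_simps)
qed

text \<open>The second difference is unchanged when \<open>a\<close> and \<open>b\<close> are
  exchanged, so the two second derivatives agree at two points arbitrarily near \<open>z\<close>,
  hence at \<open>z\<close> by continuity.\<close>

lemma symmetric_mixed_derivatives_real:
  fixes f :: "'a::real_normed_vector \<Rightarrow> real"
  assumes W: "open W" "z \<in> W"
    and f: "\<And>x. x \<in> W \<Longrightarrow> (f has_derivative f' x) (at x)"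
    and fa: "\<And>x. x \<in> W \<Longrightarrow> ((\<lambda>x. f' x a) has_derivative g x) (at x)"
    and fb: "\<And>x. x \<in> W \<Longrightarrow> ((\<lambda>x. f' x b) has_derivative h x) (at x)"
    and g: "continuous_on W (\<lambda>x. g x b)" and h: "continuous_on W (\<lambda>x. h x a)"
  shows "g z b = h z a"
proof (rule ccontr)
  assume ne: "g z b \<noteq> h z a"
  define e where "e = \<bar>g z b - h z a\<bar> / 2"
  have e: "e > 0" using ne by (simp add: e_def)
  have "isCont (\<lambda>x. g x b) z" "isCont (\<lambda>x. h x a) z"
    using W g h by (auto simp: continuous_on_eq_continuous_at)
  then obtain r1 r2 where r: "r1 > 0" "\<And>y. dist y z < r1 \<Longrightarrow> dist (g y b) (g z b) < e"
      "r2 > 0" "\<And>y. dist y z < r2 \<Longrightarrow> dist (h y a) (h z a) < e"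
    unfolding continuous_at_eps_delta using e by metis
  obtain r3 where r3: "r3 > 0" "ball z r3 \<subseteq> W"
    using W open_contains_ball by metis
  define r where "r = min r1 (min r2 r3)"
  \<comment> \<open>The parallelogram must fit into the ball of radius \<open>r\<close>; the summand
    1 keeps the denominator positive when \<open>a\<close> and \<open>b\<close> both vanish.\<close>
  define s where "s = r / (2 * (norm a + norm b + 1))"
  have "r > 0" using r r3 by (simp add: r_def)
  then have s: "s > 0" by (auto simp: s_def intro!: divide_pos_pos add_nonneg_pos)
  have "s * (norm a + norm b) < s * (2 * (norm a + norm b + 1))"
    by (rule mult_strict_left_mono[OF _ s]) (smt (verit) norm_ge_zero)
  also have "\<dots> = r"
    using add_nonneg_pos[of "norm a + norm b" 1] by (simp add: s_def)
  finally have sr: "s * (norm a + norm b) < r" "s * (norm b + norm a) < r"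
    by (simp_all add: add.commute)
  have ball: "ball z r \<subseteq> W" using r3 by (auto simp: r_def)
  obtain y where y: "dist y z \<le> s * (norm a + norm b)"
    "f (z + s *\<^sub>R a + s *\<^sub>R b) - f (z + s *\<^sub>R a) - f (z + s *\<^sub>R b) + f z = s * s * g y b"
    using mixed_difference_mvt[OF ball s sr(1) f fa] by blast
  obtain y' where y': "dist y' z \<le> s * (norm b + norm a)"
    "f (z + s *\<^sub>R b + s *\<^sub>R a) - f (z + s *\<^sub>R b) - f (z + s *\<^sub>R a) + f z = s * s * h y' a"
    using mixed_difference_mvt[OF ball s sr(2) f fb] by blast
  have "s * s * g y b = s * s * h y' a"
    using y(2) y'(2) by (simp add: algebra_simps)
  then have "g y b = h y' a" using s by simp
  moreover have "dist (g y b) (g z b) < e" "dist (h y' a) (h z a) < e"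
    using r y(1) y'(1) sr by (auto simp: r_def)
  ultimately show False
    unfolding dist_real_def e_def by (simp add: abs_real_def field_simps split: if_splits)
qed

text \<open>The mean value theorem is an equality for real functions only, so the claim is tested
  against each basis vector.\<close>

lemma symmetric_mixed_derivatives:
  fixes f :: "'a::real_normed_vector \<Rightarrow> 'b::euclidean_space"
  assumes W: "open W" "z \<in> W"
    and f: "\<And>x. x \<in> W \<Longrightarrow> (f has_derivative f' x) (at x)"
    and fa: "\<And>x. x \<in> W \<Longrightarrow> ((\<lambda>x. f' x a) has_derivative g x) (at x)"
    and fb: "\<And>x. x \<in> W \<Longrightarrow> ((\<lambda>x. f' x b) has_derivative h x) (at x)"
    and g: "continuous_on W (\<lambda>x. g x b)" and h: "continuous_on W (\<lambda>x. h x a)"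
  shows "g z b = h z a"
proof (rule euclidean_eqI)
  fix i :: 'b
  show "g z b \<bullet> i = h z a \<bullet> i"
    by (rule symmetric_mixed_derivatives_real[OF W, of "\<lambda>x. f x \<bullet> i" "\<lambda>x v. f' x v \<bullet> i" a
          "\<lambda>x v. g x v \<bullet> i" b "\<lambda>x v. h x v \<bullet> i"])
       (auto intro: has_derivative_inner_left f fa fb continuous_on_inner g h continuous_on_const)
qed

section \<open>Charts and curves in relatively open sets\<close>

lemma bounded_bilinear_matrix_mult:
  "bounded_bilinear (\<lambda>(A::real^'n^'n) (B::real^'n^'n). A ** B)"
  by (simp add: bilinear_conv_bounded_bilinear[symmetric] bilinear_def linear_iff matrix_matrix_mult_def
      vec_eq_iff algebra_simps sum.distrib sum_distrib_left)

lemma smooth_manifold_chart: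
  assumes "smooth_manifold V T A" "c \<in> A"
  shows chart_domain_open: "openin T (fst c)"
    and chart_image_open: "openin (top_of_set V) (snd c ` fst c)"
    and chart_homeomorphic: "homeomorphic_map (subtopology T (fst c)) (top_of_set (snd c ` fst c)) (snd c)"
    and chart_inj: "inj_on (snd c) (fst c)"
proof -
  show 1: "openin T (fst c)" and "openin (top_of_set V) (snd c ` fst c)"
    and 2: "homeomorphic_map (subtopology T (fst c)) (top_of_set (snd c ` fst c)) (snd c)"
    using assms by (auto simp: smooth_manifold_def)
  have "topspace (subtopology T (fst c)) = fst c"
    using openin_subset[OF 1] by (auto simp: topspace_subtopology)
  then show "inj_on (snd c) (fst c)"
    using homeomorphic_imp_injective_map[OF 2] by simp
qed

lemma chart_inv_chart [simp]:
  "smooth_manifold V T A \<Longrightarrow> c \<in> A \<Longrightarrow> x \<in> fst c \<Longrightarrow> chart_inv c (snd c x) = x"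
  by (simp add: chart_inv_def chart_inj)

lemma chart_image_openin:
  assumes M: "smooth_manifold V T A" "c \<in> A" and U: "openin T U"
  shows "openin (top_of_set V) (snd c ` (fst c \<inter> U))"
proof -
  have "openin (subtopology T (fst c)) (fst c \<inter> U)"
    using U by (metis Int_commute openin_subtopology)
  then have "openin (top_of_set (snd c ` fst c)) (snd c ` (fst c \<inter> U))"
    using homeomorphic_imp_open_map[OF chart_homeomorphic[OF M]] by (simp add: open_map_def)
  then show ?thesis using chart_image_open[OF M] openin_trans by blast
qed

lemma chart_inv_image_openin:
  assumes M: "smooth_manifold V T A" "c \<in> A" and Q: "openin (top_of_set V) Q" "Q \<subseteq> snd c ` fst c"
  shows "openin T (chart_inv c ` Q)"
proof -
  have sub: "topspace (subtopology T (fst c)) = fst c"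
    using openin_subset[OF chart_domain_open[OF M]] by (auto simp: topspace_subtopology)
  have "openin (top_of_set (snd c ` fst c)) Q"
    using Q chart_image_open[OF M] by (meson openin_imp_subset openin_subset_trans)
  then have "openin (subtopology T (fst c)) {x \<in> fst c. snd c x \<in> Q}"
    using openin_continuous_map_preimage[OF homeomorphic_imp_continuous_map[OF chart_homeomorphic[OF M]]]
    unfolding sub by blast
  moreover have "chart_inv c ` Q = {x \<in> fst c. snd c x \<in> Q}"
  proof (intro equalityI subsetI)
    fix x assume "x \<in> chart_inv c ` Q"
    then obtain y where "y \<in> fst c" "snd c y \<in> Q" "x = chart_inv c (snd c y)"
      using Q(2) by blast
    then show "x \<in> {x \<in> fst c. snd c x \<in> Q}" using M by simp
  next
    fix x assume "x \<in> {x \<in> fst c. snd c x \<in> Q}"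
    then show "x \<in> chart_inv c ` Q" using chart_inv_chart[OF M, of x] by (metis image_eqI mem_Collect_eq)
  qed
  ultimately show ?thesis
    using openin_trans_full[OF _ chart_domain_open[OF M]] by simp
qed

text \<open>Each member contains a nonempty basis set, and disjointness makes the choice of that set
  injective into a countable base.\<close>

lemma second_countable_disjoint_open:
  assumes T: "second_countable_space T" and dis: "disjoint_family_on Q I"
    and Q: "\<And>i. i \<in> I \<Longrightarrow> openin T (Q i)" "\<And>i. i \<in> I \<Longrightarrow> Q i \<noteq> {}"
  shows "countable I"
proof -
  obtain \<B> where "countable \<B>"
    and \<B>: "\<And>U x. openin T U \<Longrightarrow> x \<in> U \<Longrightarrow> \<exists>B\<in>\<B>. x \<in> B \<and> B \<subseteq> U"
    using T unfolding second_countable_space_def by metis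
  have "\<exists>B\<in>\<B>. B \<noteq> {} \<and> B \<subseteq> Q i" if "i \<in> I" for i
    using \<B>[OF Q(1)[OF that]] Q(2)[OF that] by (metis ex_in_conv)
  then obtain f where f: "\<And>i. i \<in> I \<Longrightarrow> f i \<in> \<B> \<and> f i \<noteq> {} \<and> f i \<subseteq> Q i"
    by metis
  have "inj_on f I"
  proof (rule inj_onI)
    fix i j assume "i \<in> I" "j \<in> I" "f i = f j"
    then show "i = j" using f[of i] f[of j] disjoint_family_onD[OF dis, of i j] by blast
  qed
  moreover have "f ` I \<subseteq> \<B>" using f by blast
  ultimately show ?thesis
    using countable_image_inj_on[OF countable_subset[OF _ \<open>countable \<B>\<close>]] by blast
qed

lemma openin_subspace_line:
  fixes z v :: "'a::real_normed_vector"
  assumes V: "subspace V" and \<Omega>: "openin (top_of_set V) \<Omega>" and z: "z \<in> \<Omega>" and v: "v \<in> V"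
  shows "\<exists>e>0. \<forall>t. \<bar>t\<bar> < e \<longrightarrow> z + t *\<^sub>R v \<in> \<Omega>"
proof -
  obtain Q where Q: "open Q" "\<Omega> = V \<inter> Q"
    using \<Omega> by (auto simp: openin_open)
  have "((\<lambda>t. z + t *\<^sub>R v) \<longlongrightarrow> z + 0 *\<^sub>R v) (at 0)"
    by (intro tendsto_intros)
  then have "\<forall>\<^sub>F t in at 0. z + t *\<^sub>R v \<in> Q"
    using Q z by (auto dest!: topological_tendstoD)
  then obtain e where "e > 0" "\<And>t. t \<noteq> 0 \<Longrightarrow> \<bar>t\<bar> < e \<Longrightarrow> z + t *\<^sub>R v \<in> Q"
    by (auto simp: eventually_at)
  moreover have "z + t *\<^sub>R v \<in> V" for t
    using V v z Q by (auto intro: subspace_add subspace_scale)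
  ultimately show ?thesis
    using Q z by (intro exI[of _ e]) (metis IntD2 IntI add.right_neutral scaleR_zero_left)
qed

text \<open>For small \<open>t\<close> the line stays in \<open>\<Omega>\<close>, so the derivative
  within the possibly thin set \<open>\<Omega>\<close> becomes an ordinary two-sided derivative in
  \<open>t\<close>.\<close>

lemma has_vector_derivative_along_line_within:
  assumes V: "subspace V" and \<Omega>: "openin (top_of_set V) \<Omega>" and z: "z \<in> \<Omega>" and v: "v \<in> V"
    and f: "(f has_derivative f') (at z within \<Omega>)"
  shows "((\<lambda>t. f (z + t *\<^sub>R v)) has_vector_derivative f' v) (at 0)"
proof -
  obtain e where e: "e > 0" "\<And>t. \<bar>t\<bar> < e \<Longrightarrow> z + t *\<^sub>R v \<in> \<Omega>"
    using openin_subspace_line[OF V \<Omega> z v] by blast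
  have "((\<lambda>t. f (z + t *\<^sub>R v)) has_derivative (\<lambda>t. f' (t *\<^sub>R v))) (at 0 within {-e<..<e})"
  proof (rule has_derivative_in_compose[of "\<lambda>t. z + t *\<^sub>R v"])
    show "((\<lambda>t. z + t *\<^sub>R v) has_derivative (\<lambda>t. t *\<^sub>R v)) (at 0 within {-e<..<e})"
      by (auto intro!: derivative_eq_intros)
    show "(f has_derivative f') (at (z + 0 *\<^sub>R v) within (\<lambda>t. z + t *\<^sub>R v) ` {-e<..<e})"
      using has_derivative_subset[OF f, of "(\<lambda>t. z + t *\<^sub>R v) ` {-e<..<e}"] e(2)
      by (simp add: image_subset_iff abs_less_iff)
  qed
  then show ?thesis
    using e(1) by (simp add: has_vector_derivative_def at_within_open[of 0 "{-e<..<e}"] linear_simps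
        has_derivative_bounded_linear[OF f])
qed

text \<open>For a proper subspace \<open>V\<close> the derivative within \<open>\<Omega>\<close> is
  not unique as a map on the whole space. Directions in \<open>V\<close> are seen by lines inside
  \<open>\<Omega>\<close>, which fixes its values there.\<close>

lemma has_derivative_within_unique_on_subspace:
  assumes "subspace V" "openin (top_of_set V) \<Omega>" "z \<in> \<Omega>" "v \<in> V"
    and "(f has_derivative f') (at z within \<Omega>)" "(f has_derivative f'') (at z within \<Omega>)"
  shows "f' v = f'' v"
  using has_vector_derivative_along_line_within assms vector_derivative_unique_at by metis

lemma matrix_inv_cancel:
  assumes "invertible (A::real^'n^'n)"
  shows matrix_inv_right: "A ** matrix_inv A = mat 1"
    and matrix_inv_left: "matrix_inv A ** A = mat 1"
  using someI_ex[OF assms[unfolded invertible_def]] by (simp_all add: matrix_inv_def)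

section \<open>Curves in a Lie subgroup\<close>

lemma smooth_on_imp_C1:
  assumes "smooth_on V S f"
  obtains f' where "\<And>x. x \<in> S \<Longrightarrow> (f has_derivative f' x) (at x within S)"
    and "\<And>v. v \<in> V \<Longrightarrow> continuous_on S (\<lambda>x. f' x v)"
proof -
  have "Ck_on (Suc 0) V S f" using assms by (simp add: smooth_on_def)
  then show thesis using that by auto
qed

context
  fixes V :: "(real^'n^'n) set" and \<tau> :: "(real^'n^'n) topology"
    and B :: "(real^'n^'n, real^'n^'n) chart set" and G :: "(real^'n^'n) set"
  assumes lie: "lie_subgroup V \<tau> B G"
begin

lemma lie_subgroup_facts:
  shows lie_invertible: "g \<in> G \<Longrightarrow> invertible g"
    and lie_one: "mat 1 \<in> G"
    and lie_mult: "g \<in> G \<Longrightarrow> h \<in> G \<Longrightarrow> g ** h \<in> G"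
    and lie_inv: "g \<in> G \<Longrightarrow> matrix_inv g \<in> G"
    and lie_manifold: "smooth_manifold V \<tau> B"
    and lie_topspace: "topspace \<tau> = G"
    and lie_subspace: "subspace V"
    and lie_second_countable: "second_countable_space \<tau>"
  using lie by (auto simp: lie_subgroup_def smooth_manifold_def)

text \<open>The image is the preimage of \<open>U\<close> under right multiplication by
  \<open>matrix_inv g\<close>, which is continuous for \<open>\<tau>\<close>. This carries an open
  slice through the identity to the other slices.\<close>

lemma lie_right_mult_openin:
  assumes U: "openin \<tau> U" and g: "g \<in> G"
  shows "openin \<tau> ((\<lambda>x. x ** g) ` U)"
proof -
  have "continuous_map (prod_topology \<tau> \<tau>) \<tau> (\<lambda>(g, h). g ** h)"
    using lie by (simp add: lie_subgroup_def smooth_map_def)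
  then have "continuous_map \<tau> \<tau> ((\<lambda>(g, h). g ** h) \<circ> (\<lambda>x. (x, matrix_inv g)))"
    by (intro continuous_map_compose)
       (auto intro!: continuous_map_pairedI simp: continuous_map_const lie_topspace lie_inv g)
  then have "openin \<tau> {x \<in> topspace \<tau>. ((\<lambda>(g, h). g ** h) \<circ> (\<lambda>x. (x, matrix_inv g))) x \<in> U}"
    using U by (rule openin_continuous_map_preimage)
  also have "{x \<in> topspace \<tau>. ((\<lambda>(g, h). g ** h) \<circ> (\<lambda>x. (x, matrix_inv g))) x \<in> U} = (\<lambda>x. x ** g) ` U"
  proof (intro equalityI subsetI)
    fix x assume x: "x \<in> {x \<in> topspace \<tau>. ((\<lambda>(g, h). g ** h) \<circ> (\<lambda>x. (x, matrix_inv g))) x \<in> U}"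
    then have "x = (x ** matrix_inv g) ** g"
      using matrix_inv_left[OF lie_invertible[OF g]] by (simp add: matrix_mul_assoc[symmetric])
    then show "x \<in> (\<lambda>x. x ** g) ` U" using x by auto
  next
    fix x assume "x \<in> (\<lambda>x. x ** g) ` U"
    then obtain y where y: "y \<in> U" "x = y ** g" by auto
    then have "y \<in> G" using openin_subset[OF U] by (auto simp: lie_topspace)
    then show "x \<in> {x \<in> topspace \<tau>. ((\<lambda>(g, h). g ** h) \<circ> (\<lambda>x. (x, matrix_inv g))) x \<in> U}"
      using y g matrix_inv_right[OF lie_invertible[OF g]]
      by (simp add: lie_topspace lie_mult matrix_mul_assoc[symmetric])
  qed
  finally show ?thesis .
qed

text \<open>
  The map \<open>A\<close> inverts \<open>D\<close> on \<open>V\<close>, so that \<open>D \<circ> A\<close> is a projection onto the Lie algebra and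
  \<open>e - D (A e)\<close> is the coordinate of \<open>e\<close> transverse to \<open>G\<close>.
\<close>

lemma lie_slice_coordinates:
  fixes c :: "(real^'n^'n, real^'n^'n) chart"
  assumes c: "c \<in> B" "mat 1 \<in> fst c"
    and D: "(chart_inv c has_derivative D) (at (snd c (mat 1)) within snd c ` fst c)"
  obtains A U N g where "linear A" "range A \<subseteq> V" "\<forall>v\<in>V. A (D v) = v"
    and "open U" "0 \<in> U" "\<forall>e\<in>U. snd c (mat 1) + A e \<in> snd c ` fst c"
    and "open N" "mat 1 \<in> N"
    and "homeomorphism U N (\<lambda>e. chart_inv c (snd c (mat 1) + A e) ** (mat 1 + e - D (A e))) g"
    and "(g has_derivative (\<lambda>h. h)) (at (mat 1))"
proof -
  define z0 where "z0 = snd c (mat 1)"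
  define \<Omega> where "\<Omega> = snd c ` fst c"
  note V = lie_subspace and M = lie_manifold
  have D0: "(chart_inv c has_derivative D) (at z0 within \<Omega>)"
    using D by (simp add: z0_def \<Omega>_def)
  have linD: "linear D" using D0 by (rule has_derivative_linear)
  have z0: "z0 \<in> \<Omega>" using c by (simp add: z0_def \<Omega>_def)
  have \<Omega>: "openin (top_of_set V) \<Omega>" unfolding \<Omega>_def by (rule chart_image_open[OF M c(1)])
  have sm: "smooth_on V \<Omega> (chart_inv c)" and inj: "inj_on D V"
    using lie c D z0 by (auto simp: lie_subgroup_def \<Omega>_def z0_def)
  obtain A where A: "linear A" "range A \<subseteq> V" "\<forall>v\<in>V. A (D v) = v"
    using linear_exists_left_inverse_on[OF linD V inj] by blast
  then have blA: "bounded_linear A" by (simp add: linear_conv_bounded_linear)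
  have blD: "bounded_linear D" using linD by (simp add: linear_conv_bounded_linear)
  obtain \<phi>' where \<phi>': "\<And>x. x \<in> \<Omega> \<Longrightarrow> (chart_inv c has_derivative \<phi>' x) (at x within \<Omega>)"
    and cont\<phi>': "\<And>v. v \<in> V \<Longrightarrow> continuous_on \<Omega> (\<lambda>x. \<phi>' x v)"
    using smooth_on_imp_C1[OF sm] by blast
  have \<phi>'z0: "\<phi>' z0 v = D v" if "v \<in> V" for v
    using has_derivative_within_unique_on_subspace[OF V \<Omega> z0 that \<phi>'[OF z0] D0] .
  obtain Q where Q: "open Q" "\<Omega> = V \<inter> Q"
    using \<Omega> by (auto simp: openin_open)
  \<comment> \<open>\<open>chart_inv c\<close> is controlled only on a relatively open subset of
    \<open>V\<close>; precomposing with \<open>A\<close> extends it to an open set of matrices,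
    where the inverse function theorem applies.\<close>
  define O' where "O' = {e. z0 + A e \<in> Q}"
  have zV: "z0 + A e \<in> V" for e
    using z0 Q A(2) V by (auto intro!: subspace_add)
  have contA: "continuous_on S (\<lambda>e. z0 + A e)" for S
    by (intro continuous_intros bounded_linear.continuous_on[OF blA])
  have O': "open O'"
    using open_vimage[OF Q(1) contA] by (simp add: O'_def vimage_def)
  have O'\<Omega>: "z0 + A e \<in> \<Omega>" if "e \<in> O'" for e
    using that zV Q by (auto simp: O'_def)
  define \<Phi> where "\<Phi> e = chart_inv c (z0 + A e) ** (mat 1 + e - D (A e))" for e
  define \<Phi>' where "\<Phi>' e h = chart_inv c (z0 + A e) ** (h - D (A h)) + \<phi>' (z0 + A e) (A h) ** (mat 1 + e - D (A e))" for e h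
  have der1: "((\<lambda>e. chart_inv c (z0 + A e)) has_derivative (\<lambda>h. \<phi>' (z0 + A e) (A h))) (at e)" if "e \<in> O'" for e
  proof -
    have "((\<lambda>e. chart_inv c (z0 + A e)) has_derivative (\<lambda>h. \<phi>' (z0 + A e) (A h))) (at e within O')"
    proof (rule has_derivative_in_compose2[OF \<phi>' _ that])
      show "(\<lambda>e. z0 + A e) ` O' \<subseteq> \<Omega>" using O'\<Omega> by auto
      show "((\<lambda>e. z0 + A e) has_derivative A) (at e within O')"
        using has_derivative_add[OF has_derivative_const bounded_linear.has_derivative[OF blA has_derivative_ident]]
        by simp
    qed auto
    then show ?thesis by (simp only: at_within_open[OF that O'])
  qed
  have der2: "((\<lambda>e. mat 1 + e - D (A e)) has_derivative (\<lambda>h. h - D (A h))) (at e)" for e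
    using has_derivative_diff[OF has_derivative_add[OF has_derivative_const has_derivative_ident]
        bounded_linear.has_derivative[OF blD bounded_linear.has_derivative[OF blA has_derivative_ident]],
        of "mat 1" "at e"]
    by simp
  have der: "(\<Phi> has_derivative \<Phi>' e) (at e)" if "e \<in> O'" for e
    unfolding \<Phi>_def[abs_def] \<Phi>'_def[abs_def]
    by (rule bounded_bilinear.FDERIV[OF bounded_bilinear_matrix_mult der1[OF that] der2])
  \<comment> \<open>The inverse function theorem asks for a derivative that is continuous in
    operator norm; in finite dimension this may be checked on basis vectors.\<close>
  define f' where "f' e = Blinfun (\<Phi>' e)" for e
  have f': "blinfun_apply (f' e) = \<Phi>' e" if "e \<in> O'" for e
    unfolding f'_def using der[OF that] by (intro bounded_linear_Blinfun_apply has_derivative_bounded_linear)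
  have "continuous_on O' f'"
  proof (rule continuous_on_blinfun_componentwise)
    fix i :: "real^'n^'n"
    have "A i \<in> V" using A by auto
    have "continuous_on O' (\<lambda>e. \<phi>' (z0 + A e) (A i))"
      using O'\<Omega> by (intro continuous_on_compose2[OF cont\<phi>'[OF \<open>A i \<in> V\<close>] contA]) auto
    moreover have "continuous_on O' (\<lambda>e. chart_inv c (z0 + A e))" "continuous_on O' (\<lambda>e. mat 1 + e - D (A e))"
      using der1 der2 by (auto simp: O' continuous_on_eq_continuous_at intro!: has_derivative_continuous)
    ultimately have "continuous_on O' (\<lambda>e. \<Phi>' e i)"
      unfolding \<Phi>'_def
      by (intro continuous_on_add bounded_bilinear.continuous_on[OF bounded_bilinear_matrix_mult] continuous_on_const)
    then show "continuous_on O' (\<lambda>e. blinfun_apply (f' e) i)"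
      by (simp add: f' cong: continuous_on_cong)
  qed
  moreover have A0: "A 0 = 0" "D 0 = 0" using A(1) linD by (simp_all add: linear_0)
  have \<phi>0: "chart_inv c z0 = mat 1" using c M by (simp add: z0_def)
  have "0 \<in> O'" using z0 A0 Q by (simp add: O'_def)
  \<comment> \<open>The two parts of the derivative are \<open>h - D (A h)\<close> across
    \<open>G\<close> and \<open>D (A h)\<close> along \<open>G\<close>; they add up to
    \<open>h\<close>.\<close>
  have \<Phi>'0: "\<Phi>' 0 = (\<lambda>h. h)"
    using A(2) by (auto simp: fun_eq_iff \<Phi>'_def A0 \<phi>0 \<phi>'z0 image_subset_iff)
  have "id_blinfun o\<^sub>L f' 0 = id_blinfun"
    using \<Phi>'0 f'[OF \<open>0 \<in> O'\<close>] by (intro blinfun_eqI) simp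
  ultimately obtain U N g g' where U: "open U" "U \<subseteq> O'" "0 \<in> U" and N: "open N" "\<Phi> 0 \<in> N"
    and hom: "homeomorphism U N \<Phi> g"
    and g: "\<And>y. y \<in> N \<Longrightarrow> (g has_derivative (g' y)) (at y)"
    and g': "\<And>y. y \<in> N \<Longrightarrow> g' y = inv (blinfun_apply (f'(g y)))"
    using inverse_function_theorem[of O' \<Phi> f' 0 id_blinfun] O' der f' \<open>0 \<in> O'\<close> by metis
  have \<Phi>0: "\<Phi> 0 = mat 1" by (simp add: \<Phi>_def A0 \<phi>0)
  have "g (mat 1) = 0" using hom U(3) \<Phi>0 unfolding homeomorphism_def by metis
  then have "g' (mat 1) = (\<lambda>h. h)"
    using g'[of "mat 1"] N f'[OF \<open>0 \<in> O'\<close>] by (simp add: \<Phi>0 \<Phi>'0 inv_equality fun_eq_iff)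
  then have gder: "(g has_derivative (\<lambda>h. h)) (at (mat 1))"
    using g[of "mat 1"] N \<Phi>0 by simp
  show thesis
    using that[OF A U(1,3) _ N(1) _ hom[unfolded \<Phi>_def[abs_def] z0_def] gder] U O'\<Omega> N \<Phi>0
    by (auto simp: z0_def \<Omega>_def)
qed

text \<open>\<open>\<gamma>\<close> is continuous only as a curve of matrices, so it cannot be read
  directly in a chart of \<open>G\<close>. Slice coordinates split it into a point of the chart
  times a transverse factor \<open>mat 1 + b t\<close>. Once \<open>b\<close> is known to vanish
  near 0, \<open>e t = D (A (e t))\<close> there, and differentiating gives
  \<open>L = D (A L)\<close>.\<close>

lemma curve_in_lie_subgroup_derivative:
  fixes c :: "(real^'n^'n, real^'n^'n) chart" and \<gamma> :: "real \<Rightarrow> real^'n^'n"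
  assumes c: "c \<in> B" "mat 1 \<in> fst c"
    and D: "(chart_inv c has_derivative D) (at (snd c (mat 1)) within snd c ` fst c)"
    and \<epsilon>: "\<epsilon> > 0" and \<gamma>G: "\<And>t. \<bar>t\<bar> < \<epsilon> \<Longrightarrow> \<gamma> t \<in> G"
    and cont: "continuous_on {-\<epsilon><..<\<epsilon>} \<gamma>"
    and \<gamma>0: "\<gamma> 0 = mat 1" and \<gamma>': "(\<gamma> has_vector_derivative L) (at 0)"
  shows "L \<in> D ` V"
proof -
  obtain A U N g where A: "linear A" "range A \<subseteq> V" "\<forall>v\<in>V. A (D v) = v"
    and U: "open U" "0 \<in> U" "\<forall>e\<in>U. snd c (mat 1) + A e \<in> snd c ` fst c"
    and N: "open N" "mat 1 \<in> N"
    and hom: "homeomorphism U N (\<lambda>e. chart_inv c (snd c (mat 1) + A e) ** (mat 1 + e - D (A e))) g"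
    and gder: "(g has_derivative (\<lambda>h. h)) (at (mat 1))"
    by (rule lie_slice_coordinates[OF c D]) (rule that)
  define z0 where "z0 = snd c (mat 1)"
  define \<Phi> where "\<Phi> e = chart_inv c (z0 + A e) ** (mat 1 + e - D (A e))" for e
  have hom: "homeomorphism U N \<Phi> g"
    using hom by (simp add: \<Phi>_def[abs_def] z0_def)
  note M = lie_manifold
  have linD: "linear D" using D by (rule has_derivative_linear)
  have blA: "bounded_linear A" and blD: "bounded_linear D"
    using A(1) linD by (simp_all add: linear_conv_bounded_linear)
  have AV: "A h \<in> V" for h using A(2) by auto
  have ADA: "A (D (A h)) = A h" for h using A(3) AV by auto
  have A0: "A 0 = 0" "D 0 = 0" using A(1) linD by (simp_all add: linear_0)
  have \<Phi>0: "\<Phi> 0 = mat 1" using M c by (simp add: \<Phi>_def A0 z0_def)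
  have g1: "g (mat 1) = 0" using hom U(2) \<Phi>0 unfolding homeomorphism_def by metis
  obtain r where r: "r > 0" "ball 0 r \<subseteq> U" using U open_contains_ball by blast
  \<comment> \<open>The part along \<open>G\<close> and the transverse part are each kept below
    \<open>r / 2\<close>, so that such parts, even taken from different points, recombine to a
    matrix in \<open>ball 0 r\<close>, where \<open>\<Phi>\<close> is injective.\<close>
  define K where "K = {e. norm (D (A e)) < r / 2} \<inter> {e. norm (e - D (A e)) < r / 2}"
  have contDA: "continuous_on S (\<lambda>e. D (A e))" for S
    by (intro bounded_linear.continuous_on[OF blD] bounded_linear.continuous_on[OF blA] continuous_intros)
  have "open K"
    unfolding K_def by (intro open_Int open_Collect_less continuous_intros contDA)
  have "0 \<in> K" using r by (simp add: K_def A0)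
  have N1: "open (N \<inter> g -` K)"
    using continuous_on_open_vimage[OF N(1), of g] hom \<open>open K\<close> unfolding homeomorphism_def
    by (metis Int_commute)
  have N1': "mat 1 \<in> N \<inter> g -` K" using N g1 \<open>0 \<in> K\<close> by simp
  have "open ({-\<epsilon><..<\<epsilon>} \<inter> \<gamma> -` (N \<inter> g -` K))"
    using continuous_on_open_vimage[of "{-\<epsilon><..<\<epsilon>}" \<gamma>] cont N1 by (metis Int_commute open_greaterThanLessThan)
  moreover have "0 \<in> {-\<epsilon><..<\<epsilon>} \<inter> \<gamma> -` (N \<inter> g -` K)"
    using \<epsilon> \<gamma>0 N1' by simp
  ultimately obtain d where d: "d > 0" "ball 0 d \<subseteq> {-\<epsilon><..<\<epsilon>} \<inter> \<gamma> -` (N \<inter> g -` K)"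
    using open_contains_ball by blast
  define I where "I = ball (0::real) d"
  have I: "\<gamma> t \<in> G" "\<gamma> t \<in> N" "g (\<gamma> t) \<in> K" if "t \<in> I" for t
    using d that \<gamma>G[of t] by (auto simp: I_def abs_less_iff)
  define e where "e t = g (\<gamma> t)" for t
  define b where "b t = e t - D (A (e t))" for t
  have gN: "continuous_on N g" using hom by (simp add: homeomorphism_def)
  have conte: "continuous_on I e"
    unfolding e_def using d I
    by (intro continuous_on_compose2[OF gN] continuous_on_subset[OF cont]) (auto simp: I_def)
  have contb: "continuous_on I b"
    unfolding b_def by (intro continuous_intros conte continuous_on_compose2[OF contDA conte]) auto
  have eU: "e t \<in> U" and \<Phi>e: "\<Phi> (e t) = \<gamma> t" if "t \<in> I" for t
    using hom I(2)[OF that] unfolding homeomorphism_def e_def by auto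
  \<comment> \<open>The chart factor of \<open>\<gamma> t\<close> lies in \<open>G\<close>, hence so
    does the other factor. The slices below are therefore right translates by elements of
    \<open>G\<close>.\<close>
  have bG: "mat 1 + b t \<in> G" if t: "t \<in> I" for t
  proof -
    define x where "x = chart_inv c (z0 + A (e t))"
    have "x \<in> fst c" using U(3)[rule_format, OF eU[OF t]] M c by (auto simp: x_def z0_def)
    then have x: "x \<in> G" using openin_subset[OF chart_domain_open[OF M c(1)]] by (auto simp: lie_topspace)
    have "\<gamma> t = x ** (mat 1 + b t)"
      using \<Phi>e[OF t] by (simp add: \<Phi>_def x_def b_def algebra_simps)
    then have "matrix_inv x ** \<gamma> t = mat 1 + b t"
      using matrix_inv_left[OF lie_invertible[OF x]] by (simp add: matrix_mul_assoc)
    then show ?thesis using lie_mult[OF lie_inv[OF x] I(1)[OF t]] by simp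
  qed
  have Ab: "A (b t) = 0" for t
    using linear_diff[OF A(1)] ADA by (simp add: b_def)
  have nb: "norm (b t) < r / 2" if "t \<in> I" for t
    using I(3)[OF that] by (simp add: K_def b_def e_def)
  \<comment> \<open>The slices \<open>Q b\<close> of different transverse coordinates \<open>b\<close> are disjoint and open in \<open>\<tau>\<close>.\<close>
  define P where "P = {z \<in> V. norm (D (z - z0)) < r / 2}"
  define Q where "Q b = (\<lambda>x. x ** (mat 1 + b)) ` chart_inv c ` P" for b
  have z0V: "z0 \<in> V"
    using openin_imp_subset[OF chart_image_open[OF M c(1)]] c(2) by (auto simp: z0_def)
  \<comment> \<open>Every point of a slice is a value of \<open>\<Phi>\<close> on \<open>U\<close>,
    and \<open>D \<circ> A\<close> recovers its part along \<open>G\<close>; injectivity of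
    \<open>\<Phi>\<close> then makes the transverse coordinate unique.\<close>
  have P\<Phi>: "D (z - z0) + b \<in> U \<and> chart_inv c z ** (mat 1 + b) = \<Phi> (D (z - z0) + b) \<and> z \<in> snd c ` fst c
      \<and> D (A (D (z - z0) + b)) = D (z - z0)"
    if "z \<in> P" "A b = 0" "norm b < r / 2" for z b
  proof -
    have AD: "A (D (z - z0)) = z - z0" using that z0V lie_subspace by (intro A(3)[rule_format]) (auto simp: P_def subspace_diff)
    then have 1: "A (D (z - z0) + b) = z - z0" using that(2) linear_add[OF A(1)] by simp
    have "norm (D (z - z0) + b) < r"
      using that norm_triangle_ineq[of "D (z - z0)" b] by (simp add: P_def)
    then have 2: "D (z - z0) + b \<in> U" using r by auto
    show ?thesis
      using U(3)[rule_format, OF 2] 1 2 by (simp add: \<Phi>_def flip: z0_def)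
  qed
  have "openin (top_of_set V) (V \<inter> {z. norm (D (z - z0)) < r / 2})"
    by (intro openin_open_Int open_Collect_less continuous_intros bounded_linear.continuous_on[OF blD])
  moreover have "V \<inter> {z. norm (D (z - z0)) < r / 2} = P" by (auto simp: P_def)
  ultimately have P: "openin (top_of_set V) P" by simp
  have "P \<subseteq> snd c ` fst c" using P\<Phi>[of _ 0] r by (auto simp: A0)
  then have Popen: "openin \<tau> (chart_inv c ` P)" by (rule chart_inv_image_openin[OF M c(1) P])
  have "z0 \<in> P" using z0V r by (simp add: P_def A0)
  have "countable (b ` I)"
  proof (rule second_countable_disjoint_open[OF lie_second_countable])
    show "openin \<tau> (Q x)" if "x \<in> b ` I" for x
      using that bG unfolding Q_def by (intro lie_right_mult_openin Popen) auto
    show "Q x \<noteq> {}" if "x \<in> b ` I" for x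
      using \<open>z0 \<in> P\<close> by (auto simp: Q_def)
    show "disjoint_family_on Q (b ` I)"
    unfolding disjoint_family_on_def
    proof (intro ballI impI, rule ccontr)
      fix x y assume xy: "x \<in> b ` I" "y \<in> b ` I" "x \<noteq> y" "Q x \<inter> Q y \<noteq> {}"
      then obtain z z' where z: "z \<in> P" "z' \<in> P"
        and eq: "chart_inv c z ** (mat 1 + x) = chart_inv c z' ** (mat 1 + y)"
        unfolding Q_def by blast
      have x: "A x = 0" "norm x < r / 2" and y: "A y = 0" "norm y < r / 2"
        using xy Ab nb by auto
      note px = P\<Phi>[OF z(1) x] and py = P\<Phi>[OF z(2) y]
      have "\<Phi> (D (z - z0) + x) = \<Phi> (D (z' - z0) + y)" using px py eq by simp
      then have "D (z - z0) + x = D (z' - z0) + y"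
        using px py hom unfolding homeomorphism_def by metis
      moreover from this have "D (z - z0) = D (z' - z0)" using px py by metis
      ultimately show False using xy(3) by simp
    qed
  qed
  moreover have "connected (b ` I)"
    using contb by (intro connected_continuous_image) (simp_all add: I_def)
  moreover have "0 \<in> I" using d by (simp add: I_def)
  moreover have "b 0 = 0" by (simp add: b_def e_def \<gamma>0 g1 A0)
  \<comment> \<open>A connected set with two distinct points is uncountable, so \<open>b\<close>
    keeps its value at 0.\<close>
  ultimately have b0: "b t = 0" if "t \<in> I" for t
    using connected_uncountable[of "b ` I" "b t" "b 0"] that by (metis image_eqI)
  \<comment> \<open>\<open>g\<close> has the identity as its derivative at \<open>mat 1\<close>, so
    passing to slice coordinates preserves the velocity.\<close>
  have "(e has_vector_derivative L) (at 0)"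
    using has_derivative_compose[of \<gamma> "\<lambda>t. t *\<^sub>R L" 0 UNIV g "\<lambda>h. h"] gder \<gamma>0 \<gamma>'
    by (simp add: e_def[abs_def] has_vector_derivative_def)
  moreover from this have "((\<lambda>t. D (A (e t))) has_vector_derivative D (A L)) (at 0)"
    by (intro bounded_linear.has_vector_derivative[OF blD] bounded_linear.has_vector_derivative[OF blA])
  moreover have "((\<lambda>t. D (A (e t))) has_vector_derivative D (A L)) (at 0) \<longleftrightarrow> (e has_vector_derivative D (A L)) (at 0)"
  proof (rule has_vector_derivative_cong_ev)
    show "\<forall>\<^sub>F x in nhds 0. x \<in> UNIV \<longrightarrow> D (A (e x)) = e x"
      using b0 eventually_nhds_in_open[of I 0] \<open>0 \<in> I\<close>
      by (auto simp: b_def I_def elim!: eventually_mono)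
    show "D (A (e 0)) = e 0" using b0[OF \<open>0 \<in> I\<close>] by (simp add: b_def)
  qed
  ultimately have "L = D (A L)" using vector_derivative_unique_at by blast
  then show ?thesis using AV by blast
qed

end

text \<open>Continuity refers to the norm topology, not to that of the Lie subgroup: a transition
  between two smooth sections is known to be continuous only in this weaker sense.\<close>

definition curve_in :: "'a::real_normed_vector set \<Rightarrow> real \<Rightarrow> (real \<Rightarrow> 'a) \<Rightarrow> 'a \<Rightarrow> bool" where
  "curve_in G \<epsilon> \<gamma> L \<longleftrightarrow> \<epsilon> > 0 \<and> (\<forall>t. \<bar>t\<bar> < \<epsilon> \<longrightarrow> \<gamma> t \<in> G) \<and> continuous_on {-\<epsilon><..<\<epsilon>} \<gamma> \<and>
     (\<gamma> has_vector_derivative L) (at 0)"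

section \<open>The Lie algebra as the set of velocities of curves\<close>

context
  fixes V :: "(real^'n^'n) set" and \<tau> :: "(real^'n^'n) topology"
    and B :: "(real^'n^'n, real^'n^'n) chart set" and G :: "(real^'n^'n) set"
  assumes lie: "lie_subgroup V \<tau> B G"
begin

lemma lie_chart_at_one:
  obtains c D where "c \<in> B" "mat 1 \<in> fst c"
    and "(chart_inv c has_derivative D) (at (snd c (mat 1)) within snd c ` fst c)"
proof -
  obtain c where c: "c \<in> B" "mat 1 \<in> fst c"
    using lie_manifold[OF lie] lie_one[OF lie] lie_topspace[OF lie] unfolding smooth_manifold_def by blast
  have "smooth_on V (snd c ` fst c) (chart_inv c)"
    using lie c by (simp add: lie_subgroup_def)
  then have "Ck_on (Suc 0) V (snd c ` fst c) (chart_inv c)"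
    by (simp add: smooth_on_def)
  then show thesis using that[OF c] c by auto
qed

lemma lie_algebra_curve:
  assumes "L \<in> lie_algebra V B"
  obtains \<epsilon> \<gamma> where "curve_in G \<epsilon> \<gamma> L" "\<gamma> 0 = mat 1"
proof -
  obtain c D v where c: "c \<in> B" "mat 1 \<in> fst c"
    and D: "(chart_inv c has_derivative D) (at (snd c (mat 1)) within snd c ` fst c)"
    and v: "v \<in> V" "L = D v"
    using assms by (auto simp: lie_algebra_def)
  note M = lie_manifold[OF lie] and V = lie_subspace[OF lie]
  note \<Omega> = chart_image_open[OF M c(1)]
  have z: "snd c (mat 1) \<in> snd c ` fst c" using c by simp
  obtain e where e: "e > 0" "\<And>t. \<bar>t\<bar> < e \<Longrightarrow> snd c (mat 1) + t *\<^sub>R v \<in> snd c ` fst c"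
    using openin_subspace_line[OF V \<Omega> z v(1)] by blast
  have "smooth_on V (snd c ` fst c) (chart_inv c)"
    using lie c by (simp add: lie_subgroup_def)
  then have "Ck_on 0 V (snd c ` fst c) (chart_inv c)"
    unfolding smooth_on_def by blast
  then have cont: "continuous_on (snd c ` fst c) (chart_inv c)" by simp
  have "chart_inv c z \<in> G" if "z \<in> snd c ` fst c" for z
    using that M c openin_subset[OF chart_domain_open[OF M c(1)]] by (auto simp: lie_topspace[OF lie])
  then have "curve_in G e (\<lambda>t. chart_inv c (snd c (mat 1) + t *\<^sub>R v)) L"
    using has_vector_derivative_along_line_within[OF V \<Omega> z v(1) D] e v(2)
    by (auto simp: curve_in_def abs_less_iff intro!: continuous_on_compose2[OF cont] continuous_intros)
  moreover have "chart_inv c (snd c (mat 1) + 0 *\<^sub>R v) = mat 1" using c M by simp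
  ultimately show thesis using that[of e "\<lambda>t. chart_inv c (snd c (mat 1) + t *\<^sub>R v)"] by simp
qed

text \<open>An element seen in some chart is the velocity of a curve in \<open>G\<close>, and the
  velocity of such a curve lies in the image for every chart around the identity. This replaces a
  comparison of charts by chart changes.\<close>

lemma lie_algebra_eq_image:
  assumes c: "c \<in> B" "mat 1 \<in> fst c"
    and D: "(chart_inv c has_derivative D) (at (snd c (mat 1)) within snd c ` fst c)"
  shows "lie_algebra V B = D ` V"
proof
  show "D ` V \<subseteq> lie_algebra V B" using assms by (auto simp: lie_algebra_def)
  show "lie_algebra V B \<subseteq> D ` V"
  proof
    fix L assume "L \<in> lie_algebra V B"
    then obtain \<epsilon> \<gamma> where "curve_in G \<epsilon> \<gamma> L" "\<gamma> 0 = mat 1" by (rule lie_algebra_curve)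
    then show "L \<in> D ` V"
      using curve_in_lie_subgroup_derivative[OF lie c D, of \<epsilon> \<gamma> L] by (auto simp: curve_in_def)
  qed
qed

lemma curve_in_lie_algebra:
  assumes \<gamma>: "curve_in G \<epsilon> \<gamma> L" "\<gamma> 0 = mat 1"
  shows "L \<in> lie_algebra V B"
proof -
  obtain c D where c: "c \<in> B" "mat 1 \<in> fst c"
    and D: "(chart_inv c has_derivative D) (at (snd c (mat 1)) within snd c ` fst c)"
    by (rule lie_chart_at_one)
  show ?thesis
    using curve_in_lie_subgroup_derivative[OF lie c D, of \<epsilon> \<gamma> L] lie_algebra_eq_image[OF c D] \<gamma>
    by (auto simp: curve_in_def)
qed

lemma subspace_lie_algebra: "subspace (lie_algebra V B)"
proof -
  obtain c D where c: "c \<in> B" "mat 1 \<in> fst c"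
    and D: "(chart_inv c has_derivative D) (at (snd c (mat 1)) within snd c ` fst c)"
    by (rule lie_chart_at_one)
  show ?thesis
    unfolding lie_algebra_eq_image[OF c D]
    by (rule linear_subspace_image[OF has_derivative_linear[OF D] lie_subspace[OF lie]])
qed

text \<open>Conjugation by \<open>g\<close> carries a curve in \<open>G\<close> through the identity
  to another one and acts linearly on velocities.\<close>

lemma lie_algebra_Ad:
  assumes L: "L \<in> lie_algebra V B" and g: "g \<in> G"
  shows "g ** L ** matrix_inv g \<in> lie_algebra V B"
proof -
  obtain \<epsilon> \<gamma> where \<gamma>: "curve_in G \<epsilon> \<gamma> L" "\<gamma> 0 = mat 1" using L by (rule lie_algebra_curve)
  have bl: "bounded_linear (\<lambda>X. g ** X ** matrix_inv g)"
    by (intro bounded_linear_compose[OF bounded_bilinear.bounded_linear_left[OF bounded_bilinear_matrix_mult]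
          bounded_bilinear.bounded_linear_right[OF bounded_bilinear_matrix_mult]])
  have "curve_in G \<epsilon> (\<lambda>t. g ** \<gamma> t ** matrix_inv g) (g ** L ** matrix_inv g)"
    using \<gamma>(1) lie_mult[OF lie] lie_inv[OF lie] g
    by (auto simp: curve_in_def intro: bounded_linear.continuous_on[OF bl] bounded_linear.has_vector_derivative[OF bl])
  then show ?thesis
    by (rule curve_in_lie_algebra) (simp add: \<gamma>(2) matrix_inv_right[OF lie_invertible[OF lie g]])
qed

end

lemma has_vector_derivative_at_0_iff:
  "(f has_vector_derivative L) (at 0) \<longleftrightarrow> ((\<lambda>t. (f t - f 0) /\<^sub>R t) \<longlongrightarrow> L) (at 0)"
proof -
  have eq: "norm (f t - f 0 - t *\<^sub>R L) / norm t = norm ((f t - f 0) /\<^sub>R t - L)" if "t \<noteq> 0" for t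
  proof -
    have "(f t - f 0) /\<^sub>R t - L = (f t - f 0 - t *\<^sub>R L) /\<^sub>R t"
      using that by (simp add: scaleR_diff_right)
    then show ?thesis by (simp add: divide_inverse_commute)
  qed
  have "(f has_vector_derivative L) (at 0) \<longleftrightarrow> ((\<lambda>t. norm (f t - f 0 - t *\<^sub>R L) / norm t) \<longlongrightarrow> 0) (at 0)"
    by (simp add: has_vector_derivative_def has_derivative_iff_norm bounded_linear_scaleR_left)
  also have "\<dots> \<longleftrightarrow> ((\<lambda>t. norm ((f t - f 0) /\<^sub>R t - L)) \<longlongrightarrow> 0) (at 0)"
    by (rule Lim_cong_within) (use eq in auto)
  also have "\<dots> \<longleftrightarrow> ((\<lambda>t. (f t - f 0) /\<^sub>R t) \<longlongrightarrow> L) (at 0)"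
    by (simp add: tendsto_norm_zero_iff LIM_zero_iff)
  finally show ?thesis .
qed

text \<open>The difference quotients at 0 lie in \<open>S\<close>, and a subspace of a
  finite-dimensional space is closed.\<close>

lemma vector_derivative_in_subspace:
  fixes f :: "real \<Rightarrow> 'a::euclidean_space"
  assumes S: "subspace S" and \<epsilon>: "\<epsilon> > 0" "\<And>t. \<bar>t\<bar> < \<epsilon> \<Longrightarrow> f t \<in> S"
    and f: "(f has_vector_derivative L) (at 0)"
  shows "L \<in> S"
proof -
  have "((\<lambda>t. (f t - f 0) /\<^sub>R t) \<longlongrightarrow> L) (at 0)"
    using f by (simp add: has_vector_derivative_at_0_iff)
  moreover have "\<forall>\<^sub>F t in at 0. (f t - f 0) /\<^sub>R t \<in> S"
    unfolding eventually_at using \<epsilon> S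
    by (intro exI[of _ \<epsilon>]) (auto intro!: subspace_scale subspace_diff)
  ultimately show ?thesis
    using closed_subspace[OF S] by (intro Lim_in_closed_set) auto
qed

text \<open>By Cramer's rule, applied to the columns of the inverse, its entries are quotients of
  determinants.\<close>

lemma continuous_on_matrix_inv:
  fixes f :: "'a::topological_space \<Rightarrow> real^'n^'n"
  assumes f: "continuous_on S f" and inv: "\<And>x. x \<in> S \<Longrightarrow> invertible (f x)"
  shows "continuous_on S (\<lambda>x. matrix_inv (f x))"
proof -
  have nth: "continuous_on S (\<lambda>x. f x $ i $ j)" for i j
    by (intro continuous_intros f)
  have eq: "matrix_inv (f x) $ i $ j = det (\<chi> k l. if l = i then (axis j 1 :: real^'n) $ k else f x $ k $ l) / det (f x)"
    if "x \<in> S" for x i j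
  proof -
    have "f x *v (matrix_inv (f x) *v axis j 1) = axis j 1"
      using matrix_inv_right[OF inv[OF that]] by (simp add: matrix_vector_mul_assoc)
    then have "(matrix_inv (f x) *v axis j 1) $ i = det (\<chi> k l. if l = i then (axis j 1 :: real^'n) $ k else f x $ k $ l) / det (f x)"
      using inv[OF that] by (subst (asm) cramer) (auto simp: invertible_det_nz)
    moreover have "(matrix_inv (f x) *v axis j 1) $ i = matrix_inv (f x) $ i $ j"
      by (simp add: matrix_vector_mult_basis column_def)
    ultimately show ?thesis by simp
  qed
  have cdet: "continuous_on S (\<lambda>x. det (M x))" if "\<And>i j. continuous_on S (\<lambda>x. M x $ i $ j)" for M :: "'a \<Rightarrow> real^'n^'n"
    unfolding det_def by (intro continuous_intros that)
  have "continuous_on S (\<lambda>x. matrix_inv (f x) $ i $ j)" for i j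
  proof (rule continuous_on_eq)
    show "continuous_on S (\<lambda>x. det (\<chi> k l. if l = i then (axis j 1 :: real^'n) $ k else f x $ k $ l) / det (f x))"
    proof (intro continuous_on_divide cdet)
      fix k l
      show "continuous_on S (\<lambda>x. (\<chi> k l. if l = i then (axis j 1 :: real^'n) $ k else f x $ k $ l) $ k $ l)"
        using nth by (cases "l = i") auto
    qed (use inv nth in \<open>auto simp: invertible_det_nz\<close>)
  qed (simp add: eq)
  then have "continuous_on S (\<lambda>x. \<chi> i j. matrix_inv (f x) $ i $ j)"
    by (intro continuous_on_vec_lambda)
  then show ?thesis by simp
qed

context
  fixes V :: "(real^'n^'n) set" and \<tau> :: "(real^'n^'n) topology"
    and B :: "(real^'n^'n, real^'n^'n) chart set" and G :: "(real^'n^'n) set"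
  assumes lie: "lie_subgroup V \<tau> B G"
begin

text \<open>Near 0 the difference quotient equals that of
  \<open>\<gamma> t ** K - K ** \<gamma> t\<close>, multiplied on the right by
  \<open>matrix_inv (\<gamma> t)\<close>. Continuity of the inverse along the curve therefore
  suffices.\<close>

lemma conjugation_curve_derivative:
  fixes K :: "real^'n^'n"
  assumes \<gamma>: "curve_in G \<epsilon> \<gamma> L" "\<gamma> 0 = mat 1"
  shows "((\<lambda>t. \<gamma> t ** K ** matrix_inv (\<gamma> t)) has_vector_derivative L ** K - K ** L) (at 0)"
proof -
  note bil = bounded_bilinear_matrix_mult
  have \<epsilon>: "\<epsilon> > 0" and G: "\<And>t. \<bar>t\<bar> < \<epsilon> \<Longrightarrow> \<gamma> t \<in> G" and cont: "continuous_on {-\<epsilon><..<\<epsilon>} \<gamma>"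
    and der: "(\<gamma> has_vector_derivative L) (at 0)"
    using \<gamma> by (auto simp: curve_in_def)
  have one: "matrix_inv (mat 1 :: real^'n^'n) = mat 1"
    using matrix_inv_right[of "mat 1 :: real^'n^'n"] by (simp add: lie_invertible[OF lie lie_one[OF lie]])
  define f where "f t = \<gamma> t ** K - K ** \<gamma> t" for t
  have f0: "f 0 = 0" by (simp add: f_def \<gamma>(2))
  have "(f has_vector_derivative (L ** K - K ** L)) (at 0)"
    unfolding f_def
    by (intro has_vector_derivative_diff der
        bounded_linear.has_vector_derivative[OF bounded_bilinear.bounded_linear_left[OF bil]]
        bounded_linear.has_vector_derivative[OF bounded_bilinear.bounded_linear_right[OF bil]])
  then have 1: "((\<lambda>t. f t /\<^sub>R t) \<longlongrightarrow> L ** K - K ** L) (at 0)"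
    by (simp add: has_vector_derivative_at_0_iff f0)
  have "continuous_on {-\<epsilon><..<\<epsilon>} (\<lambda>t. matrix_inv (\<gamma> t))"
    using G lie_invertible[OF lie] by (intro continuous_on_matrix_inv cont) (auto simp: abs_less_iff)
  then have "isCont (\<lambda>t. matrix_inv (\<gamma> t)) 0"
    using \<epsilon> by (simp add: continuous_on_eq_continuous_at)
  then have 2: "((\<lambda>t. matrix_inv (\<gamma> t)) \<longlongrightarrow> mat 1) (at 0)"
    by (simp add: isCont_def \<gamma>(2) one)
  have lim: "((\<lambda>t. (f t /\<^sub>R t) ** matrix_inv (\<gamma> t)) \<longlongrightarrow> L ** K - K ** L) (at 0)"
    using bounded_bilinear.tendsto[OF bil 1 2] by simp
  have ev: "\<forall>\<^sub>F t in at 0. (f t /\<^sub>R t) ** matrix_inv (\<gamma> t)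
      = (\<gamma> t ** K ** matrix_inv (\<gamma> t) - \<gamma> 0 ** K ** matrix_inv (\<gamma> 0)) /\<^sub>R t"
    unfolding eventually_at
  proof (intro exI[of _ \<epsilon>] conjI \<epsilon> ballI impI)
    fix t :: real assume t: "t \<noteq> 0 \<and> dist t 0 < \<epsilon>"
    then have "\<gamma> t ** matrix_inv (\<gamma> t) = mat 1"
      using matrix_inv_right[OF lie_invertible[OF lie G[of t]]] by simp
    then have "f t ** matrix_inv (\<gamma> t) = \<gamma> t ** K ** matrix_inv (\<gamma> t) - K"
      by (simp add: f_def matrix_mul_assoc[symmetric] bounded_bilinear.diff_left[OF bil])
    then show "(f t /\<^sub>R t) ** matrix_inv (\<gamma> t)
        = (\<gamma> t ** K ** matrix_inv (\<gamma> t) - \<gamma> 0 ** K ** matrix_inv (\<gamma> 0)) /\<^sub>R t"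
      by (simp add: bounded_bilinear.scaleR_left[OF bil] \<gamma>(2) one)
  qed
  show ?thesis
    unfolding has_vector_derivative_at_0_iff using Lim_transform_eventually[OF lim ev] .
qed

text \<open>For \<open>\<gamma>\<close> of velocity \<open>L\<close> the curve
  \<open>\<gamma> t ** K ** matrix_inv (\<gamma> t)\<close> stays in the Lie algebra, and its
  velocity is the commutator.\<close>

lemma lie_algebra_commutator:
  assumes L: "L \<in> lie_algebra V B" and K: "K \<in> lie_algebra V B"
  shows "commutator L K \<in> lie_algebra V B"
proof -
  obtain \<epsilon> \<gamma> where \<gamma>: "curve_in G \<epsilon> \<gamma> L" "\<gamma> 0 = mat 1" by (rule lie_algebra_curve[OF lie L])
  show ?thesis
    unfolding commutator_def
    by (rule vector_derivative_in_subspace[OF subspace_lie_algebra[OF lie] _ _ conjugation_curve_derivative[OF \<gamma>]])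
       (use \<gamma> lie_algebra_Ad[OF lie K] in \<open>auto simp: curve_in_def\<close>)
qed

lemma lie_algebra_infinitesimal_equivariance:
  fixes lam :: "real^'n \<Rightarrow> real^'n^'n"
  assumes lam: "linear lam"
    and equiv: "\<And>g. g \<in> G \<Longrightarrow> lam (g *v u) - g ** lam u ** matrix_inv g \<in> lie_algebra V B"
    and L: "L \<in> lie_algebra V B"
  shows "lam (L *v u) - commutator L (lam u) \<in> lie_algebra V B"
proof -
  obtain \<epsilon> \<gamma> where \<gamma>: "curve_in G \<epsilon> \<gamma> L" "\<gamma> 0 = mat 1" by (rule lie_algebra_curve[OF lie L])
  have "linear (\<lambda>X. lam (X *v u))"
    by (rule linear_compose[OF _ lam, unfolded o_def])
       (simp add: linear_iff matrix_vector_mult_add_rdistrib scaleR_matrix_vector_assoc)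
  then have "((\<lambda>t. lam (\<gamma> t *v u)) has_vector_derivative lam (L *v u)) (at 0)"
    using \<gamma>(1) by (intro bounded_linear.has_vector_derivative[where f = "\<lambda>X. lam (X *v u)"])
      (simp_all add: linear_conv_bounded_linear curve_in_def)
  then have der: "((\<lambda>t. lam (\<gamma> t *v u) - \<gamma> t ** lam u ** matrix_inv (\<gamma> t)) has_vector_derivative
      lam (L *v u) - commutator L (lam u)) (at 0)"
    unfolding commutator_def by (intro has_vector_derivative_diff conjugation_curve_derivative[OF \<gamma>])
  show ?thesis
    by (rule vector_derivative_in_subspace[OF subspace_lie_algebra[OF lie] _ _ der])
       (use \<gamma> equiv in \<open>auto simp: curve_in_def\<close>)
qed

end

section \<open>Vector fields and frames\<close>

lemma linear_expand_axis:
  fixes f :: "real^'n \<Rightarrow> 'b::real_vector"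
  assumes "linear f"
  shows "f u = (\<Sum>i\<in>UNIV. u $ i *\<^sub>R f (axis i 1))"
proof -
  have "u = (\<Sum>i\<in>UNIV. u $ i *\<^sub>R axis i 1)"
    using basis_expansion[of u] by (simp add: scalar_mult_eq_scaleR)
  then show ?thesis
    using linear_sum[OF assms, of "\<lambda>i. u $ i *\<^sub>R axis i 1" UNIV] by (simp only: linear_scale[OF assms])
qed

lemma smooth_on_const: "smooth_on V S (\<lambda>x. a)"
  by (simp add: smooth_on_def Ck_on_const)

lemma smooth_on_add: "smooth_on V S f \<Longrightarrow> smooth_on V S g \<Longrightarrow> smooth_on V S (\<lambda>x. f x + g x)"
  by (simp add: smooth_on_def Ck_on_add)

lemma smooth_on_scaleR:
  fixes f :: "'a::real_normed_vector \<Rightarrow> real"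
  shows "smooth_on V S f \<Longrightarrow> smooth_on V S g \<Longrightarrow> smooth_on V S (\<lambda>x. f x *\<^sub>R g x)"
  by (simp add: smooth_on_def Ck_on_scaleR)

lemma smooth_on_bounded_linear:
  "bounded_linear g \<Longrightarrow> smooth_on V S f \<Longrightarrow> smooth_on V S (\<lambda>x. g (f x))"
  by (simp add: smooth_on_def Ck_on_bounded_linear)

lemma smooth_on_cong:
  "(\<And>x. x \<in> S \<Longrightarrow> f x = g x) \<Longrightarrow> smooth_on V S f \<longleftrightarrow> smooth_on V S g"
  unfolding smooth_on_def using Ck_on_cong by blast

lemma smooth_on_subset: "smooth_on V S f \<Longrightarrow> S' \<subseteq> S \<Longrightarrow> smooth_on V S' f"
  unfolding smooth_on_def using Ck_on_subset by blast

lemma smooth_on_differentiable: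
  assumes "smooth_on V S f" "open S" "z \<in> S"
  shows "f differentiable (at z)"
proof -
  have "Ck_on (Suc 0) V S f" using assms by (simp add: smooth_on_def)
  then obtain f' where "(f has_derivative f') (at z within S)" using assms by auto
  then show ?thesis
    unfolding differentiable_def at_within_open[OF assms(3,2)] by blast
qed

lemma smooth_on_frechet:
  assumes "smooth_on V S f" "open S" "z \<in> S"
  shows "(f has_derivative frechet_derivative f (at z)) (at z)"
  using smooth_on_differentiable[OF assms] by (simp add: frechet_derivative_works)

lemma vector_field_on_subset: "vector_field_on A U X \<Longrightarrow> U' \<subseteq> U \<Longrightarrow> vector_field_on A U' X"
  unfolding vector_field_on_def by (meson Int_mono image_mono smooth_on_subset subset_refl subsetD)

lemma frame_section_on_subset: "frame_section_on A U s \<Longrightarrow> U' \<subseteq> U \<Longrightarrow> frame_section_on A U' s"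
  unfolding frame_section_on_def by (meson vector_field_on_subset subsetD)

lemma smooth_fun_on_const: "smooth_fun_on A U (\<lambda>x. a)"
  by (simp add: smooth_fun_on_def comp_def smooth_on_const)

section \<open>Tangent vectors and vector fields in charts\<close>

locale smooth_mfd =
  fixes T :: "'m topology" and A :: "('m, real^'n) chart set"
  assumes M: "smooth_manifold UNIV T A"
begin

lemma chart_inv [simp]: "c \<in> A \<Longrightarrow> x \<in> fst c \<Longrightarrow> chart_inv c (snd c x) = x"
  using M by simp

lemma chart_at: "x \<in> topspace T \<Longrightarrow> \<exists>c\<in>A. x \<in> fst c"
  using M unfolding smooth_manifold_def by blast

lemma open_chart_image: "c \<in> A \<Longrightarrow> openin T U \<Longrightarrow> open (snd c ` (fst c \<inter> U))"
  using chart_image_openin[OF M] by (simp flip: open_openin)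

lemma transition_has_derivative:
  assumes "c \<in> A" "d \<in> A" "x \<in> fst c" "x \<in> fst d"
  shows "((snd d \<circ> chart_inv c) has_derivative frechet_derivative (snd d \<circ> chart_inv c) (at (snd c x))) (at (snd c x))"
  using M assms open_chart_image chart_domain_open[OF M]
  by (intro smooth_on_frechet[of UNIV "snd c ` (fst c \<inter> fst d)"]) (auto simp: smooth_manifold_def)

lemma linear_transition:
  assumes "c \<in> A" "d \<in> A" "x \<in> fst c" "x \<in> fst d"
  shows "linear (frechet_derivative (snd d \<circ> chart_inv c) (at (snd c x)))"
  using transition_has_derivative[OF assms] by (rule has_derivative_linear)

lemma tangent_space_outside: "v \<in> tangent_space A x \<Longrightarrow> c \<notin> A \<or> x \<notin> fst c \<Longrightarrow> v c = 0"
  unfolding tangent_space_def by blast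

lemma tangent_space_transition:
  assumes "v \<in> tangent_space A x" "c \<in> A" "d \<in> A" "x \<in> fst c" "x \<in> fst d"
  shows "v d = frechet_derivative (snd d \<circ> chart_inv c) (at (snd c x)) (v c)"
  using assms unfolding tangent_space_def by blast

lemma tangent_spaceI:
  assumes "\<And>c. c \<notin> A \<or> x \<notin> fst c \<Longrightarrow> v c = 0"
    and "\<And>c d. c \<in> A \<Longrightarrow> d \<in> A \<Longrightarrow> x \<in> fst c \<Longrightarrow> x \<in> fst d \<Longrightarrow>
      v d = frechet_derivative (snd d \<circ> chart_inv c) (at (snd c x)) (v c)"
  shows "v \<in> tangent_space A x"
  using assms unfolding tangent_space_def by blast

lemma subspace_tangent_space: "subspace (tangent_space A x)"
proof (rule subspaceI)
  show "0 \<in> tangent_space A x"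
    by (rule tangent_spaceI) (simp_all add: linear_0[OF linear_transition])
next
  fix v w assume vw: "v \<in> tangent_space A x" "w \<in> tangent_space A x"
  show "v + w \<in> tangent_space A x"
  proof (rule tangent_spaceI)
    fix c d assume "c \<in> A" "d \<in> A" "x \<in> fst c" "x \<in> fst d"
    note cd = this
    show "(v + w) d = frechet_derivative (snd d \<circ> chart_inv c) (at (snd c x)) ((v + w) c)"
      unfolding plus_fun_apply linear_add[OF linear_transition[OF cd(1-4)]]
      by (simp only: tangent_space_transition[OF vw(1) cd] tangent_space_transition[OF vw(2) cd])
  qed (simp add: tangent_space_outside[OF vw(1)] tangent_space_outside[OF vw(2)])
next
  fix r :: real and v assume v: "v \<in> tangent_space A x"
  show "r *\<^sub>R v \<in> tangent_space A x"
  proof (rule tangent_spaceI)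
    fix c d assume "c \<in> A" "d \<in> A" "x \<in> fst c" "x \<in> fst d"
    note cd = this
    show "(r *\<^sub>R v) d = frechet_derivative (snd d \<circ> chart_inv c) (at (snd c x)) ((r *\<^sub>R v) c)"
      unfolding scaleR_fun_def linear_scale[OF linear_transition[OF cd(1-4)]]
      by (simp only: tangent_space_transition[OF v cd])
  qed (simp add: tangent_space_outside[OF v] scaleR_fun_def)
qed

lemma tangent_eqI:
  assumes v: "v \<in> tangent_space A x" and w: "w \<in> tangent_space A x"
    and c: "c \<in> A" "x \<in> fst c" and eq: "v c = w c"
  shows "v = w"
proof
  fix d
  show "v d = w d"
  proof (cases "d \<in> A \<and> x \<in> fst d")
    case True
    then have "v d = frechet_derivative (snd d \<circ> chart_inv c) (at (snd c x)) (v c)"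
      and "w d = frechet_derivative (snd d \<circ> chart_inv c) (at (snd c x)) (w c)"
      using tangent_space_transition c v w by blast+
    with eq show ?thesis by simp
  next
    case False
    then show ?thesis using tangent_space_outside v w by metis
  qed
qed

lemma vector_field_on_add:
  "vector_field_on A U X \<Longrightarrow> vector_field_on A U Y \<Longrightarrow> vector_field_on A U (\<lambda>z. X z + Y z)"
  using subspace_add[OF subspace_tangent_space] by (auto simp: vector_field_on_def intro: smooth_on_add)

lemma vector_field_on_scaleR:
  fixes f :: "'m \<Rightarrow> real"
  shows "smooth_fun_on A U f \<Longrightarrow> vector_field_on A U X \<Longrightarrow> vector_field_on A U (\<lambda>z. f z *\<^sub>R X z)"
  using subspace_scale[OF subspace_tangent_space]
  by (auto simp: vector_field_on_def smooth_fun_on_def scaleR_fun_def comp_def intro: smooth_on_scaleR)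

lemma vector_field_on_zero: "vector_field_on A U (\<lambda>z. 0)"
  using subspace_0[OF subspace_tangent_space] by (auto simp: vector_field_on_def intro: smooth_on_const)

lemma vector_field_on_sum:
  "(\<And>i. i \<in> I \<Longrightarrow> vector_field_on A U (X i)) \<Longrightarrow> vector_field_on A U (\<lambda>z. \<Sum>i\<in>I. X i z)"
  by (induction I rule: infinite_finite_induct) (auto intro: vector_field_on_add vector_field_on_zero)

lemma vector_field_on_minus: "vector_field_on A U X \<Longrightarrow> vector_field_on A U (\<lambda>z. - X z)"
  using vector_field_on_scaleR[OF smooth_fun_on_const[of A U "-1"]] by simp

lemma vector_field_on_cong:
  assumes "\<And>y. y \<in> U \<Longrightarrow> X y = Y y" "vector_field_on A U X"
  shows "vector_field_on A U Y"
proof -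
  have "smooth_on UNIV (snd c ` (fst c \<inter> U)) (\<lambda>z. X (chart_inv c z) c) \<longleftrightarrow>
      smooth_on UNIV (snd c ` (fst c \<inter> U)) (\<lambda>z. Y (chart_inv c z) c)" if "c \<in> A" for c
    using that assms by (intro smooth_on_cong) auto
  with assms show ?thesis by (auto simp: vector_field_on_def)
qed

lemma vector_field_local_derivative:
  assumes "vector_field_on A U X" "openin T U" "c \<in> A" "z \<in> snd c ` (fst c \<inter> U)"
  shows "((\<lambda>z. X (chart_inv c z) c) has_derivative frechet_derivative (\<lambda>z. X (chart_inv c z) c) (at z)) (at z)"
  using assms open_chart_image
  by (intro smooth_on_frechet[of UNIV "snd c ` (fst c \<inter> U)"]) (auto simp: vector_field_on_def)

lemma smooth_fun_local_derivative:
  assumes "smooth_fun_on A U f" "openin T U" "c \<in> A" "z \<in> snd c ` (fst c \<inter> U)"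
  shows "((\<lambda>z. f (chart_inv c z)) has_derivative frechet_derivative (\<lambda>z. f (chart_inv c z)) (at z)) (at z)"
  using assms open_chart_image
  by (intro smooth_on_frechet[of UNIV "snd c ` (fst c \<inter> U)"]) (auto simp: smooth_fun_on_def comp_def)

text \<open>\<open>tderiv\<close> uses some chosen chart; the chain rule for the chart change and
  the transformation law of tangent vectors make every chart around \<open>y\<close> give the same
  value.\<close>

lemma tderiv_chart:
  assumes f: "smooth_fun_on A U f" and U: "openin T U" "y \<in> U" and c: "c \<in> A" "y \<in> fst c"
    and v: "v \<in> tangent_space A y"
    and D: "((\<lambda>z. f (chart_inv c z)) has_derivative D) (at (snd c y))"
  shows "tderiv A f y v = D (v c)"
proof -
  define d where "d = (SOME d. d \<in> A \<and> y \<in> fst d)"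
  have "d \<in> A \<and> y \<in> fst d"
    unfolding d_def by (rule someI[of _ c]) (use c in simp)
  then have d: "d \<in> A" "y \<in> fst d" by simp_all
  define F where "F = frechet_derivative (snd c \<circ> chart_inv d) (at (snd d y))"
  have F: "((snd c \<circ> chart_inv d) has_derivative F) (at (snd d y))"
    unfolding F_def by (rule transition_has_derivative[OF d(1) c(1) d(2) c(2)])
  have vc: "v c = F (v d)" using tangent_space_transition v c d unfolding F_def by blast
  have "((\<lambda>z. f (chart_inv c ((snd c \<circ> chart_inv d) z))) has_derivative (\<lambda>h. D (F h))) (at (snd d y))"
    by (rule has_derivative_compose[OF F]) (use D d in simp)
  moreover have "open (snd d ` (fst d \<inter> fst c))" "snd d y \<in> snd d ` (fst d \<inter> fst c)"
    using open_chart_image[OF d(1) chart_domain_open[OF M c(1)]] c d by auto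
  ultimately have "((f \<circ> chart_inv d) has_derivative (\<lambda>h. D (F h))) (at (snd d y))"
    by (rule has_derivative_transform_within_open) (use c d in auto)
  then have "frechet_derivative (f \<circ> chart_inv d) (at (snd d y)) = (\<lambda>h. D (F h))"
    by (rule frechet_derivative_at[symmetric])
  then show ?thesis by (simp add: tderiv_def vc Let_def flip: d_def)
qed

end

section \<open>Components of vector fields in a local frame\<close>

locale framed_mfd = smooth_mfd T A for T :: "'m topology" and A :: "('m, real^'n) chart set" +
  fixes U :: "'m set" and s :: "'m \<Rightarrow> real^'n \<Rightarrow> ('m, 'n) tvec"
  assumes U: "openin T U" and s: "frame_section_on A U s"
begin

definition comps :: "('m \<Rightarrow> ('m, 'n) tvec) \<Rightarrow> 'm \<Rightarrow> real^'n" where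
  "comps X y = inv (s y) (X y)"

lemma linear_frame: "y \<in> U \<Longrightarrow> linear (s y)"
  and inj_frame: "y \<in> U \<Longrightarrow> inj (s y)"
  and range_frame: "y \<in> U \<Longrightarrow> range (s y) = tangent_space A y"
  using s by (auto simp: frame_section_on_def frames_def bij_betw_def)

lemma frame_tangent: "y \<in> U \<Longrightarrow> s y u \<in> tangent_space A y"
  using range_frame by blast

lemma frame_inv [simp]: "y \<in> U \<Longrightarrow> inv (s y) (s y u) = u"
  by (simp add: inj_frame)

lemma inv_frame: "y \<in> U \<Longrightarrow> v \<in> tangent_space A y \<Longrightarrow> s y (inv (s y) v) = v"
  using range_frame by (metis f_inv_into_f)

lemma frame_eq_iff: "y \<in> U \<Longrightarrow> s y u = s y v \<longleftrightarrow> u = v"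
  using inj_frame by (auto dest: injD)

lemma frame_field: "vector_field_on A U (\<lambda>z. s z u)"
  using s by (simp add: frame_section_on_def)

lemma frame_comps: "vector_field_on A U X \<Longrightarrow> y \<in> U \<Longrightarrow> s y (comps X y) = X y"
  by (simp add: comps_def inv_frame vector_field_on_def)

lemma frame_expand: "y \<in> U \<Longrightarrow> s y u = (\<Sum>i\<in>UNIV. (u $ i) *\<^sub>R s y (axis i 1))"
  by (rule linear_expand_axis[OF linear_frame])

lemma linear_frame_chart:
  assumes "y \<in> U" shows "linear (\<lambda>u. s y u c)"
  using linear_add[OF linear_frame[OF assms]] linear_scale[OF linear_frame[OF assms]]
  by (simp add: linear_iff scaleR_fun_def)

text \<open>In a chart the components solve a linear system whose matrix has the frame vectors as
  columns, so \<open>Ck_on_linear_solve\<close> applies. The matrix is invertible because a tangent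
  vector is determined by its coordinates in one chart.\<close>

lemma smooth_comps:
  assumes X: "vector_field_on A U X"
  shows "smooth_fun_on A U (comps X)"
  unfolding smooth_fun_on_def
proof
  fix c assume c: "c \<in> A"
  define S where "S = snd c ` (fst c \<inter> U)"
  define F where "F z = matrix (\<lambda>u. s (chart_inv c z) u c)" for z
  have S: "chart_inv c z \<in> U" "chart_inv c z \<in> fst c" if "z \<in> S" for z
  proof -
    obtain x where "x \<in> fst c" "x \<in> U" "z = snd c x" using \<open>z \<in> S\<close> unfolding S_def by blast
    then show "chart_inv c z \<in> U" "chart_inv c z \<in> fst c" using c by simp_all
  qed
  have F: "F z *v u = s (chart_inv c z) u c" if "z \<in> S" for z u
    using fun_cong[OF matrix_vector_mul(2)[OF linear_frame_chart[OF S(1)[OF that]]]] by (simp add: F_def)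
  have "Ck_on k UNIV S (comps X \<circ> chart_inv c)" for k
  proof (rule Ck_on_linear_solve[where M = F])
    show "Ck_on k UNIV S (\<lambda>z. F z $ i $ j)" for i j
      using frame_field[of "axis j 1"] c Ck_on_nth[of k UNIV S "\<lambda>z. s (chart_inv c z) (axis j 1) c" i]
      by (simp add: vector_field_on_def smooth_on_def S_def F_def matrix_def)
    have "Ck_on k UNIV S (\<lambda>z. X (chart_inv c z) c)"
      using X c by (simp add: vector_field_on_def smooth_on_def S_def)
    moreover have "F z *v (comps X \<circ> chart_inv c) z = X (chart_inv c z) c" if "z \<in> S" for z
      using F[OF that] frame_comps[OF X S(1)[OF that]] by simp
    ultimately show "Ck_on k UNIV S (\<lambda>z. F z *v (comps X \<circ> chart_inv c) z)"
      using Ck_on_cong[of S "\<lambda>z. F z *v (comps X \<circ> chart_inv c) z" "\<lambda>z. X (chart_inv c z) c" k UNIV]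
      by simp
    show "det (F z) \<noteq> 0" if "z \<in> S" for z
    proof -
      have "inj ((*v) (F z))"
      proof (rule injI)
        fix u v assume "F z *v u = F z *v v"
        then have "s (chart_inv c z) u = s (chart_inv c z) v"
          using F[OF that] S[OF that] c by (intro tangent_eqI[of _ "chart_inv c z" _ c] frame_tangent) auto
        then show "u = v" using frame_eq_iff[OF S(1)[OF that]] by simp
      qed
      then show ?thesis by (metis invertible_det_nz invertible_left_inverse
            matrix_left_invertible_injective)
    qed
  qed
  then show "smooth_on UNIV (snd c ` (fst c \<inter> U)) (comps X \<circ> chart_inv c)"
    by (simp add: smooth_on_def S_def)
qed

lemma smooth_comps_nth:
  "vector_field_on A U X \<Longrightarrow> smooth_fun_on A U (\<lambda>y. comps X y $ i)"
  using smooth_comps[of X] smooth_on_bounded_linear[OF bounded_linear_vec_nth[of i]]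
  by (auto simp: smooth_fun_on_def comp_def)

lemma vector_field_expand:
  "vector_field_on A U X \<Longrightarrow> y \<in> U \<Longrightarrow> X y = (\<Sum>i\<in>UNIV. (comps X y $ i) *\<^sub>R s y (axis i 1))"
  using frame_comps[of X y] frame_expand[of y "comps X y"] by simp

text \<open>Extending \<open>v\<close> with constant components in the frame shows that there is
  something to choose. The domain of the chosen field stays unknown, which is why later arguments
  shrink \<open>U\<close>.\<close>

lemma field_through:
  assumes y: "y \<in> U" "v \<in> tangent_space A y"
  shows "field_through T A y v y = v"
    and "\<exists>U'. openin T U' \<and> y \<in> U' \<and> vector_field_on A U' (field_through T A y v)"
proof -
  have "(\<lambda>z. s z (inv (s y) v)) y = v \<and>
      (\<exists>U'. openin T U' \<and> y \<in> U' \<and> vector_field_on A U' (\<lambda>z. s z (inv (s y) v)))"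
    using frame_field inv_frame[OF y] U y(1) by auto
  then have "field_through T A y v y = v \<and>
      (\<exists>U'. openin T U' \<and> y \<in> U' \<and> vector_field_on A U' (field_through T A y v))"
    unfolding field_through_def
    by (rule someI[of "\<lambda>X. X y = v \<and> (\<exists>U. openin T U \<and> y \<in> U \<and> vector_field_on A U X)"])
  then show "field_through T A y v y = v"
    and "\<exists>U'. openin T U' \<and> y \<in> U' \<and> vector_field_on A U' (field_through T A y v)"
    by blast+
qed

end

section \<open>Connection forms\<close>

context smooth_mfd
begin

context
  fixes nabla :: "('m \<Rightarrow> ('m, 'n) tvec) \<Rightarrow> ('m \<Rightarrow> ('m, 'n) tvec) \<Rightarrow> 'm \<Rightarrow> ('m, 'n) tvec"
  assumes nabla: "linear_connection T A nabla"
begin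

lemma connection_field:
  "openin T U \<Longrightarrow> vector_field_on A U X \<Longrightarrow> vector_field_on A U Y \<Longrightarrow> vector_field_on A U (nabla X Y)"
  using nabla unfolding linear_connection_def by blast

lemma connection_add_left:
  "openin T U \<Longrightarrow> vector_field_on A U X \<Longrightarrow> vector_field_on A U X' \<Longrightarrow> vector_field_on A U Y \<Longrightarrow> y \<in> U \<Longrightarrow>
    nabla (\<lambda>z. X z + X' z) Y y = nabla X Y y + nabla X' Y y"
  using nabla unfolding linear_connection_def by blast

lemma connection_add_right:
  "openin T U \<Longrightarrow> vector_field_on A U X \<Longrightarrow> vector_field_on A U Y \<Longrightarrow> vector_field_on A U Y' \<Longrightarrow> y \<in> U \<Longrightarrow>
    nabla X (\<lambda>z. Y z + Y' z) y = nabla X Y y + nabla X Y' y"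
  using nabla unfolding linear_connection_def by blast

lemma connection_cong:
  assumes "openin T U" "vector_field_on A U X" "vector_field_on A U Y"
    and eq: "\<And>y. y \<in> U \<Longrightarrow> X y = X' y" "\<And>y. y \<in> U \<Longrightarrow> Y y = Y' y" and "y \<in> U"
  shows "nabla X Y y = nabla X' Y' y"
proof -
  have X': "vector_field_on A U X'" by (rule vector_field_on_cong[OF eq(1) assms(2)])
  have Y': "vector_field_on A U Y'" by (rule vector_field_on_cong[OF eq(2) assms(3)])
  have "\<forall>X' Y'. vector_field_on A U X' \<and> vector_field_on A U Y' \<longrightarrow>
      (\<forall>y\<in>U. X y = X' y \<and> Y y = Y' y) \<longrightarrow> (\<forall>y\<in>U. nabla X Y y = nabla X' Y' y)"
    using nabla[unfolded linear_connection_def, THEN spec[of _ U], THEN spec[of _ X], THEN spec[of _ Y], THEN mp]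
      assms(1-3) by blast
  then show ?thesis using X' Y' eq \<open>y \<in> U\<close> by simp
qed

lemma connection_scaleR:
  fixes f :: "'m \<Rightarrow> real"
  assumes "openin T U" "vector_field_on A U X" "vector_field_on A U Y" "smooth_fun_on A U f" "y \<in> U"
  shows connection_scaleR_left: "nabla (\<lambda>z. f z *\<^sub>R X z) Y y = f y *\<^sub>R nabla X Y y"
    and connection_scaleR_right:
      "nabla X (\<lambda>z. f z *\<^sub>R Y z) y = tderiv A f y (X y) *\<^sub>R Y y + f y *\<^sub>R nabla X Y y"
  using nabla[unfolded linear_connection_def, THEN spec[of _ U], THEN spec[of _ X], THEN spec[of _ Y],
      THEN mp, THEN conjunct2, THEN conjunct2, THEN spec[of _ f]] assms
  by blast+

lemma connection_sum_left:
  fixes f :: "'i \<Rightarrow> 'm \<Rightarrow> real"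
  assumes U: "openin T U" "y \<in> U" and Y: "vector_field_on A U Y"
    and X: "\<And>i. i \<in> I \<Longrightarrow> vector_field_on A U (X i)" "\<And>i. i \<in> I \<Longrightarrow> smooth_fun_on A U (f i)"
    and I: "finite I"
  shows "nabla (\<lambda>z. \<Sum>i\<in>I. f i z *\<^sub>R X i z) Y y = (\<Sum>i\<in>I. f i y *\<^sub>R nabla (X i) Y y)"
  using I X
proof (induction I)
  case empty
  \<comment> \<open>Writing the zero field as a sum of two zero fields gives
    \<open>x = x + x\<close>.\<close>
  have "nabla (\<lambda>z. 0) Y y = nabla (\<lambda>z. 0) Y y + nabla (\<lambda>z. 0) Y y"
    using connection_add_left[OF U(1) vector_field_on_zero vector_field_on_zero Y U(2)]
    unfolding add_0_left .
  then show ?case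
    unfolding sum.empty by (simp only: add_cancel_right_right)
next
  case (insert i I)
  have "nabla (\<lambda>z. f i z *\<^sub>R X i z + (\<Sum>i\<in>I. f i z *\<^sub>R X i z)) Y y
      = nabla (\<lambda>z. f i z *\<^sub>R X i z) Y y + nabla (\<lambda>z. \<Sum>i\<in>I. f i z *\<^sub>R X i z) Y y"
    using insert.prems by (intro connection_add_left[OF U(1) _ _ Y U(2)] vector_field_on_sum vector_field_on_scaleR) auto
  also have "nabla (\<lambda>z. f i z *\<^sub>R X i z) Y y = f i y *\<^sub>R nabla (X i) Y y"
    using insert.prems by (intro connection_scaleR_left[OF U(1) _ Y _ U(2)]) auto
  also have "nabla (\<lambda>z. \<Sum>i\<in>I. f i z *\<^sub>R X i z) Y y = (\<Sum>i\<in>I. f i y *\<^sub>R nabla (X i) Y y)"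
    using insert.prems by (intro insert.IH) auto
  finally show ?case
    unfolding sum.insert[OF insert.hyps] .
qed

lemma connection_sum_right:
  fixes f :: "'i \<Rightarrow> 'm \<Rightarrow> real"
  assumes U: "openin T U" "y \<in> U" and X: "vector_field_on A U X"
    and Y: "\<And>i. i \<in> I \<Longrightarrow> vector_field_on A U (Y i)" "\<And>i. i \<in> I \<Longrightarrow> smooth_fun_on A U (f i)"
    and I: "finite I"
  shows "nabla X (\<lambda>z. \<Sum>i\<in>I. f i z *\<^sub>R Y i z) y
    = (\<Sum>i\<in>I. tderiv A (f i) y (X y) *\<^sub>R Y i y + f i y *\<^sub>R nabla X (Y i) y)"
  using I Y
proof (induction I)
  case empty
  have "nabla X (\<lambda>z. 0) y = nabla X (\<lambda>z. 0) y + nabla X (\<lambda>z. 0) y"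
    using connection_add_right[OF U(1) X vector_field_on_zero vector_field_on_zero U(2)]
    unfolding add_0_left .
  then show ?case
    unfolding sum.empty by (simp only: add_cancel_right_right)
next
  case (insert i I)
  have "nabla X (\<lambda>z. f i z *\<^sub>R Y i z + (\<Sum>i\<in>I. f i z *\<^sub>R Y i z)) y
      = nabla X (\<lambda>z. f i z *\<^sub>R Y i z) y + nabla X (\<lambda>z. \<Sum>i\<in>I. f i z *\<^sub>R Y i z) y"
    using insert.prems by (intro connection_add_right[OF U(1) X _ _ U(2)] vector_field_on_sum vector_field_on_scaleR) auto
  also have "nabla X (\<lambda>z. f i z *\<^sub>R Y i z) y = tderiv A (f i) y (X y) *\<^sub>R Y i y + f i y *\<^sub>R nabla X (Y i) y"
    using insert.prems by (intro connection_scaleR_right[OF U(1) X _ _ U(2)]) auto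
  also have "nabla X (\<lambda>z. \<Sum>i\<in>I. f i z *\<^sub>R Y i z) y
      = (\<Sum>i\<in>I. tderiv A (f i) y (X y) *\<^sub>R Y i y + f i y *\<^sub>R nabla X (Y i) y)"
    using insert.prems by (intro insert.IH) auto
  finally show ?case
    unfolding sum.insert[OF insert.hyps] .
qed

end

end

locale framed_connection = framed_mfd T A U s
  for T :: "'m topology" and A :: "('m, real^'n) chart set"
    and U :: "'m set" and s :: "'m \<Rightarrow> real^'n \<Rightarrow> ('m, 'n) tvec" +
  fixes nabla :: "('m \<Rightarrow> ('m, 'n) tvec) \<Rightarrow> ('m \<Rightarrow> ('m, 'n) tvec) \<Rightarrow> 'm \<Rightarrow> ('m, 'n) tvec"
  assumes nabla: "linear_connection T A nabla"
begin

definition frame_nabla :: "'n \<Rightarrow> 'n \<Rightarrow> 'm \<Rightarrow> ('m, 'n) tvec" where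
  "frame_nabla i j = nabla (\<lambda>z. s z (axis i 1)) (\<lambda>z. s z (axis j 1))"

text \<open>These are the Christoffel symbols of the frame contracted with \<open>u\<close>: for the
  \<open>i\<close>-th axis vector, column \<open>j\<close> holds the components of the derivative of
  the \<open>j\<close>-th frame field along the \<open>i\<close>-th. Arguments and values are in
  frame components, so that forms at different points can be compared and differentiated.\<close>

definition conn_form :: "'m \<Rightarrow> real^'n \<Rightarrow> real^'n^'n" where
  "conn_form y u = (\<Sum>i\<in>UNIV. u $ i *\<^sub>R (\<chi> k j. comps (frame_nabla i j) y $ k))"

lemma linear_conn_form: "linear (conn_form y)"
  by (rule linearI) (simp_all add: conn_form_def scaleR_add_left sum.distrib scaleR_sum_right)

lemma frame_nabla_field: "vector_field_on A U (frame_nabla i j)"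
  unfolding frame_nabla_def by (rule connection_field[OF nabla U frame_field frame_field])

lemma conn_form_apply:
  "conn_form y u *v w = (\<Sum>i\<in>UNIV. \<Sum>j\<in>UNIV. (u $ i * w $ j) *\<^sub>R comps (frame_nabla i j) y)"
proof (rule iffD2[OF vec_eq_iff], rule allI)
  fix k
  have "(conn_form y u *v w) $ k = (\<Sum>j\<in>UNIV. \<Sum>i\<in>UNIV. u $ i * w $ j * comps (frame_nabla i j) y $ k)"
    by (simp add: conn_form_def matrix_vector_mult_def sum_distrib_left mult_ac)
  also have "\<dots> = (\<Sum>i\<in>UNIV. \<Sum>j\<in>UNIV. u $ i * w $ j * comps (frame_nabla i j) y $ k)"
    by (rule sum.swap)
  finally show "(conn_form y u *v w) $ k
      = (\<Sum>i\<in>UNIV. \<Sum>j\<in>UNIV. (u $ i * w $ j) *\<^sub>R comps (frame_nabla i j) y) $ k"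
    by simp
qed

lemma tderiv_comps_nth:
  assumes Y: "vector_field_on A U Y" and y: "y \<in> U" and v: "v \<in> tangent_space A y"
  shows "tderiv A (\<lambda>z. comps Y z $ j) y v = tderiv A (comps Y) y v $ j"
proof -
  have "y \<in> topspace T" using y U openin_subset by blast
  then obtain c where c: "c \<in> A" "y \<in> fst c" using chart_at by blast
  have z: "snd c y \<in> snd c ` (fst c \<inter> U)" using c y by blast
  note D = smooth_fun_local_derivative[OF smooth_comps[OF Y] U c(1) z]
  show ?thesis
    unfolding tderiv_chart[OF smooth_comps[OF Y] U y c v D]
    by (rule tderiv_chart[OF smooth_comps_nth[OF Y] U y c v])
       (rule bounded_linear.has_derivative[OF bounded_linear_vec_nth D])
qed

text \<open>Both fields are expanded in the frame; linearity over functions in \<open>X\<close> and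
  the Leibniz rule in \<open>Y\<close> then reduce everything to derivatives of frame fields along
  frame fields.\<close>

lemma connection_comps:
  assumes X: "vector_field_on A U X" and Y: "vector_field_on A U Y" and y: "y \<in> U"
  shows "nabla X Y y = s y (tderiv A (comps Y) y (X y) + conn_form y (comps X y) *v comps Y y)"
proof -
  define e where "e i = (axis i 1 :: real^'n)" for i
  have Xy: "X y \<in> tangent_space A y" using X y by (simp add: vector_field_on_def)
  note lin = linear_frame[OF y]
  have 1: "nabla X (\<lambda>z. s z (e j)) y = (\<Sum>i\<in>UNIV. (comps X y $ i) *\<^sub>R frame_nabla i j y)" for j
  proof -
    have "nabla X (\<lambda>z. s z (e j)) y = nabla (\<lambda>z. \<Sum>i\<in>UNIV. (comps X z $ i) *\<^sub>R s z (e i)) (\<lambda>z. s z (e j)) y"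
      using vector_field_expand[OF X]
      by (intro connection_cong[OF nabla U X frame_field _ _ y]) (simp_all add: e_def)
    also have "\<dots> = (\<Sum>i\<in>UNIV. (comps X y $ i) *\<^sub>R nabla (\<lambda>z. s z (e i)) (\<lambda>z. s z (e j)) y)"
      by (intro connection_sum_left[OF nabla U y frame_field]) (auto intro: frame_field smooth_comps_nth[OF X])
    finally show ?thesis by (simp add: e_def frame_nabla_def)
  qed
  have "nabla X Y y = nabla X (\<lambda>z. \<Sum>j\<in>UNIV. (comps Y z $ j) *\<^sub>R s z (e j)) y"
    unfolding e_def using vector_field_expand[OF Y]
    by (intro connection_cong[OF nabla U X Y _ _ y]) simp_all
  also have "\<dots> = (\<Sum>j\<in>UNIV. tderiv A (\<lambda>z. comps Y z $ j) y (X y) *\<^sub>R s y (e j)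
      + (comps Y y $ j) *\<^sub>R nabla X (\<lambda>z. s z (e j)) y)"
    by (intro connection_sum_right[OF nabla U y X]) (auto intro: frame_field smooth_comps_nth[OF Y])
  also have "\<dots> = (\<Sum>j\<in>UNIV. (tderiv A (comps Y) y (X y) $ j) *\<^sub>R s y (e j))
      + (\<Sum>j\<in>UNIV. (comps Y y $ j) *\<^sub>R (\<Sum>i\<in>UNIV. (comps X y $ i) *\<^sub>R frame_nabla i j y))"
    by (simp add: sum.distrib tderiv_comps_nth[OF Y y Xy] 1)
  also have "(\<Sum>j\<in>UNIV. (tderiv A (comps Y) y (X y) $ j) *\<^sub>R s y (e j)) = s y (tderiv A (comps Y) y (X y))"
    unfolding e_def by (rule frame_expand[OF y, symmetric])
  also have "(\<Sum>j\<in>UNIV. (comps Y y $ j) *\<^sub>R (\<Sum>i\<in>UNIV. (comps X y $ i) *\<^sub>R frame_nabla i j y))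
      = (\<Sum>i\<in>UNIV. \<Sum>j\<in>UNIV. (comps X y $ i * comps Y y $ j) *\<^sub>R s y (comps (frame_nabla i j) y))"
    by (subst sum.swap) (simp add: scaleR_sum_right mult.commute frame_comps[OF frame_nabla_field y])
  also have "\<dots> = s y (conn_form y (comps X y) *v comps Y y)"
    by (simp add: conn_form_apply linear_sum[OF lin] linear_scale[OF lin])
  finally show ?thesis unfolding linear_add[OF lin] .
qed

lemma comps_connection:
  assumes "vector_field_on A U X" "vector_field_on A U Y" "y \<in> U"
  shows "comps (nabla X Y) y = tderiv A (comps Y) y (X y) + conn_form y (comps X y) *v comps Y y"
  using assms by (simp add: comps_def[of "nabla X Y"] connection_comps)

text \<open>The derivative of the components is common to both connections and cancels. What is left
  depends on the chosen fields only through their values at \<open>y\<close>.\<close>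

lemma connection_difference_conn_form:
  assumes y: "y \<in> U" and v: "v \<in> tangent_space A y"
  shows "connection_difference T A nabla s y v = Ad (s y) (conn_form y (inv (s y) v))"
proof
  fix w
  show "connection_difference T A nabla s y v w = Ad (s y) (conn_form y (inv (s y) v)) w"
  proof (cases "w \<in> tangent_space A y")
    case True
    define X Y where "X = field_through T A y v" and "Y = field_through T A y w"
    obtain U1 U2 where U1: "openin T U1" "y \<in> U1" "vector_field_on A U1 X"
      and U2: "openin T U2" "y \<in> U2" "vector_field_on A U2 Y"
      using field_through(2)[OF y v] field_through(2)[OF y True] X_def Y_def by blast
    define U' where "U' = U \<inter> (U1 \<inter> U2)"
    have U': "openin T U'" "y \<in> U'" "U' \<subseteq> U" using U U1 U2 y by (auto simp: U'_def)
    \<comment> \<open>The chosen fields are smooth only near \<open>y\<close>, hence the smaller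
      set. \<open>comps\<close> and \<open>conn_form\<close> are built from the frame and the
      connection alone and are the same there.\<close>
    interpret U': framed_connection T A U' s nabla
      by unfold_locales (use U' frame_section_on_subset[OF s] nabla in auto)
    have XY: "vector_field_on A U' X" "vector_field_on A U' Y"
      using U1 U2 by (auto simp: U'_def intro: vector_field_on_subset)
    have "X y = v" "Y y = w"
      using field_through(1)[OF y] v True by (simp_all add: X_def Y_def)
    have "nabla X Y y - frame_connection A s X Y y = s y (conn_form y (comps X y) *v comps Y y)"
      unfolding U'.connection_comps[OF XY U'(2)] frame_connection_def linear_add[OF linear_frame[OF y]]
        comps_def[abs_def] by (rule add_diff_cancel_left')
    then have "connection_difference T A nabla s y v w = s y (conn_form y (comps X y) *v comps Y y)"
      using True by (simp only: connection_difference_def Let_def X_def Y_def if_True)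
    then show ?thesis
      using True \<open>X y = v\<close> \<open>Y y = w\<close> range_frame[OF y] by (simp add: Ad_def comps_def)
  next
    case False
    then show ?thesis using range_frame[OF y] by (simp add: connection_difference_def Ad_def)
  qed
qed

end

section \<open>Torsion and curvature in a frame\<close>

lemma bounded_bilinear_matrix_vector_mult:
  "bounded_bilinear (\<lambda>(A::real^'n^'m) (x::real^'n). A *v x)"
  by (simp add: bilinear_conv_bounded_bilinear[symmetric] bilinear_def linear_iff matrix_vector_right_distrib
      matrix_vector_mult_add_rdistrib matrix_vector_mult_scaleR scaleR_matrix_vector_assoc[symmetric])

text \<open>A product rule that asks for derivatives of \<open>L\<close> only on the fixed vectors
  \<open>axis i 1\<close>: frames and connection forms are known to be smooth one vector at a
  time.\<close>

lemma has_derivative_apply_linear: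
  fixes L :: "'a::real_normed_vector \<Rightarrow> real^'n \<Rightarrow> 'b::real_normed_vector"
  assumes lin: "\<And>z. z \<in> W \<Longrightarrow> linear (L z)" and W: "open W" "z0 \<in> W"
    and L: "\<And>i. ((\<lambda>z. L z (axis i 1)) has_derivative L' i) (at z0)"
    and Y: "(Y has_derivative Y') (at z0)"
  shows "((\<lambda>z. L z (Y z)) has_derivative (\<lambda>h. L z0 (Y' h) + (\<Sum>i\<in>UNIV. Y z0 $ i *\<^sub>R L' i h))) (at z0)"
proof -
  have "((\<lambda>z. \<Sum>i\<in>UNIV. Y z $ i *\<^sub>R L z (axis i 1)) has_derivative
      (\<lambda>h. \<Sum>i\<in>UNIV. Y z0 $ i *\<^sub>R L' i h + Y' h $ i *\<^sub>R L z0 (axis i 1))) (at z0)"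
    by (intro has_derivative_sum has_derivative_scaleR L bounded_linear.has_derivative[OF bounded_linear_vec_nth Y])
  then have "((\<lambda>z. L z (Y z)) has_derivative
      (\<lambda>h. \<Sum>i\<in>UNIV. Y z0 $ i *\<^sub>R L' i h + Y' h $ i *\<^sub>R L z0 (axis i 1))) (at z0)"
    by (rule has_derivative_transform_within_open[OF _ W]) (rule linear_expand_axis[OF lin, symmetric])
  then show ?thesis
    by (simp add: sum.distrib linear_expand_axis[OF lin[OF W(2)], of "Y' _"] add.commute)
qed

text \<open>\<open>Ck_on\<close> supplies second derivatives one fixed direction at a time. Here
  they are gathered in one symmetric \<open>g\<close>, so that the first derivative can be
  differentiated along a direction \<open>Y z\<close> that moves with the point.\<close>

lemma smooth_on_second_derivative:
  fixes \<zeta> :: "real^'n \<Rightarrow> 'b::euclidean_space"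
  assumes \<zeta>: "smooth_on UNIV W \<zeta>" and W: "open W" "z0 \<in> W"
  obtains g where "\<forall>a b. g a b = g b a"
    and "\<forall>(Y :: real^'n \<Rightarrow> real^'n) Y'. (Y has_derivative Y') (at z0) \<longrightarrow>
      ((\<lambda>z. frechet_derivative \<zeta> (at z) (Y z)) has_derivative
        (\<lambda>h. frechet_derivative \<zeta> (at z0) (Y' h) + g (Y z0) h)) (at z0)"
proof -
  have "Ck_on (Suc (Suc 0)) UNIV W \<zeta>" using \<zeta> by (simp add: smooth_on_def)
  then obtain f' where f'W: "\<forall>z\<in>W. (\<zeta> has_derivative f' z) (at z within W)"
    and ck: "\<forall>v. Ck_on (Suc 0) UNIV W (\<lambda>z. f' z v)"
    by auto
  have f': "(\<zeta> has_derivative f' z) (at z)" if "z \<in> W" for z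
    using bspec[OF f'W that] by (simp only: at_within_open[OF that W(1)])
  have "\<forall>v. \<exists>g. (\<forall>z\<in>W. ((\<lambda>z. f' z v) has_derivative g z) (at z within W)) \<and> (\<forall>w. continuous_on W (\<lambda>z. g z w))"
    using ck by simp
  then obtain g where g: "\<And>v z. z \<in> W \<Longrightarrow> ((\<lambda>z. f' z v) has_derivative g v z) (at z within W)"
    and cont: "\<And>v w. continuous_on W (\<lambda>z. g v z w)"
    by metis
  have g': "((\<lambda>z. f' z v) has_derivative g v z) (at z)" if "z \<in> W" for z v
    using g[OF that, of v] by (simp only: at_within_open[OF that W(1)])
  have sym: "g a z0 b = g b z0 a" for a b
    by (rule symmetric_mixed_derivatives[OF W f' g' g' cont cont])
  have fd: "frechet_derivative \<zeta> (at z) = f' z" if "z \<in> W" for z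
    using frechet_derivative_at[OF f'[OF that]] by simp
  show thesis
  proof (rule that[of "\<lambda>a b. g a z0 b"]; intro allI impI)
    show "g a z0 b = g b z0 a" for a b by (rule sym)
    fix Y Y' :: "real^'n \<Rightarrow> real^'n" assume Y: "(Y has_derivative Y') (at z0)"
    have "((\<lambda>z. f' z (Y z)) has_derivative
        (\<lambda>h. f' z0 (Y' h) + (\<Sum>i\<in>UNIV. Y z0 $ i *\<^sub>R g (axis i 1) z0 h))) (at z0)"
      by (rule has_derivative_apply_linear[OF _ W g'[OF W(2)] Y]) (rule has_derivative_linear[OF f'])
    \<comment> \<open>Symmetry moves \<open>Y z0\<close> into the slot where linearity is known, the
      argument of a derivative.\<close>
    moreover have "(\<Sum>i\<in>UNIV. Y z0 $ i *\<^sub>R g (axis i 1) z0 h) = g (Y z0) z0 h" for h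
      using linear_expand_axis[OF has_derivative_linear[OF g'[OF W(2), of h]], of "Y z0"] by (simp add: sym)
    ultimately have "((\<lambda>z. f' z (Y z)) has_derivative (\<lambda>h. f' z0 (Y' h) + g (Y z0) z0 h)) (at z0)"
      by simp
    then show "((\<lambda>z. frechet_derivative \<zeta> (at z) (Y z)) has_derivative
        (\<lambda>h. frechet_derivative \<zeta> (at z0) (Y' h) + g (Y z0) z0 h)) (at z0)"
      unfolding fd[OF W(2)]
      by (rule has_derivative_transform_within_open[OF _ W]) (simp add: fd)
  qed
qed

text \<open>The curvature computation in one chart: \<open>X\<close>, \<open>Y\<close> are the chart
  coordinates of two fields, \<open>x\<close>, \<open>y\<close> their frame components,
  \<open>\<zeta>\<close> those of a third field, \<open>th\<close> the connection form. In the third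
  term, the vector inside \<open>th\<close> is the bracket in frame components for a symmetric
  connection. Second derivatives of \<open>\<zeta>\<close> cancel by symmetry, first derivatives of
  \<open>\<zeta>\<close>, \<open>x\<close> and \<open>y\<close> cancel in pairs, and only a matrix
  acting on \<open>\<zeta> z0\<close> remains.\<close>

lemma covariant_derivative_commutator:
  fixes X Y x y \<zeta> :: "real^'n \<Rightarrow> real^'n" and th :: "real^'n \<Rightarrow> real^'n \<Rightarrow> real^'n^'n"
  assumes \<zeta>: "smooth_on UNIV W \<zeta>" and W: "open W" "z0 \<in> W"
    and th: "\<And>z. linear (th z)" "\<And>i. ((\<lambda>z. th z (axis i 1)) has_derivative th' i) (at z0)"
    and X: "(X has_derivative X') (at z0)" and Y: "(Y has_derivative Y') (at z0)"
    and x: "(x has_derivative x') (at z0)" and y: "(y has_derivative y') (at z0)"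
    and D1: "((\<lambda>z. frechet_derivative \<zeta> (at z) (Y z) + th z (y z) *v \<zeta> z) has_derivative D1) (at z0)"
    and D2: "((\<lambda>z. frechet_derivative \<zeta> (at z) (X z) + th z (x z) *v \<zeta> z) has_derivative D2) (at z0)"
  shows "(D1 (X z0) + th z0 (x z0) *v (frechet_derivative \<zeta> (at z0) (Y z0) + th z0 (y z0) *v \<zeta> z0))
      - (D2 (Y z0) + th z0 (y z0) *v (frechet_derivative \<zeta> (at z0) (X z0) + th z0 (x z0) *v \<zeta> z0))
      - (frechet_derivative \<zeta> (at z0) (Y' (X z0) - X' (Y z0))
         + th z0 (y' (X z0) + th z0 (x z0) *v y z0 - (x' (Y z0) + th z0 (y z0) *v x z0)) *v \<zeta> z0)
    = ((\<Sum>i\<in>UNIV. y z0 $ i *\<^sub>R th' i (X z0)) - (\<Sum>i\<in>UNIV. x z0 $ i *\<^sub>R th' i (Y z0))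
        + commutator (th z0 (x z0)) (th z0 (y z0))
        - th z0 (th z0 (x z0) *v y z0 - th z0 (y z0) *v x z0)) *v \<zeta> z0"
proof -
  define d where "d = frechet_derivative \<zeta> (at z0)"
  have d\<zeta>: "(\<zeta> has_derivative d) (at z0)"
    unfolding d_def by (rule smooth_on_frechet[OF \<zeta> W])
  have lind: "linear d" by (rule has_derivative_linear[OF d\<zeta>])
  obtain g where sym: "\<forall>a b. g a b = g b a"
    and g: "\<forall>(Y :: real^'n \<Rightarrow> real^'n) Y'. (Y has_derivative Y') (at z0) \<longrightarrow>
      ((\<lambda>z. frechet_derivative \<zeta> (at z) (Y z)) has_derivative (\<lambda>h. d (Y' h) + g (Y z0) h)) (at z0)"
    by (rule smooth_on_second_derivative[OF \<zeta> W]) (rule that, assumption, unfold d_def)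
  define Dth where "Dth h u = (\<Sum>i\<in>UNIV. u $ i *\<^sub>R th' i h)" for h and u :: "real^'n"
  have th_y: "((\<lambda>z. th z (y z)) has_derivative (\<lambda>h. th z0 (y' h) + Dth h (y z0))) (at z0)"
    if "(y has_derivative y') (at z0)" for y y'
    unfolding Dth_def by (rule has_derivative_apply_linear[OF th(1) W th(2) that])
  have der: "((\<lambda>z. frechet_derivative \<zeta> (at z) (Y z) + th z (y z) *v \<zeta> z) has_derivative
      (\<lambda>h. d (Y' h) + g (Y z0) h + (th z0 (y z0) *v d h + (th z0 (y' h) + Dth h (y z0)) *v \<zeta> z0))) (at z0)"
    if "(Y has_derivative Y') (at z0)" "(y has_derivative y') (at z0)" for Y Y' y y'
    by (intro has_derivative_add g[rule_format] that
        bounded_bilinear.FDERIV[OF bounded_bilinear_matrix_vector_mult th_y d\<zeta>])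
  have D1': "D1 = (\<lambda>h. d (Y' h) + g (Y z0) h + (th z0 (y z0) *v d h + (th z0 (y' h) + Dth h (y z0)) *v \<zeta> z0))"
    by (rule has_derivative_unique[OF D1 der[OF Y y]])
  have D2': "D2 = (\<lambda>h. d (X' h) + g (X z0) h + (th z0 (x z0) *v d h + (th z0 (x' h) + Dth h (x z0)) *v \<zeta> z0))"
    by (rule has_derivative_unique[OF D2 der[OF X x]])
  have "g (X z0) (Y z0) = g (Y z0) (X z0)" using sym by blast
  then show ?thesis
    unfolding D1' D2' commutator_def d_def[symmetric] Dth_def[symmetric]
    by (simp add: matrix_vector_right_distrib matrix_vector_mult_diff_distrib matrix_vector_mult_add_rdistrib
        matrix_vector_mult_diff_rdistrib matrix_vector_mul_assoc linear_add[OF th(1)] linear_diff[OF th(1)]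
        linear_add[OF lind] linear_diff[OF lind])
qed

context framed_connection
begin

lemma comps_has_derivative:
  assumes "vector_field_on A U X" "y \<in> U" "c \<in> A" "y \<in> fst c"
  shows "((\<lambda>z. comps X (chart_inv c z)) has_derivative
    frechet_derivative (\<lambda>z. comps X (chart_inv c z)) (at (snd c y))) (at (snd c y))"
  by (rule smooth_fun_local_derivative[OF smooth_comps[OF assms(1)] U assms(3)]) (use assms in blast)

lemma tderiv_comps:
  assumes "vector_field_on A U X" "y \<in> U" "c \<in> A" "y \<in> fst c" "v \<in> tangent_space A y"
  shows "tderiv A (comps X) y v = frechet_derivative (\<lambda>z. comps X (chart_inv c z)) (at (snd c y)) (v c)"
  by (rule tderiv_chart[OF smooth_comps[OF assms(1)] U assms(2-5) comps_has_derivative[OF assms(1-4)]])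

text \<open>The derivative of the frame with frozen components \<open>w\<close>: what the product
  rule for a field leaves once the derivative of its components is split off.\<close>

definition frame_deriv :: "('m, real^'n) chart \<Rightarrow> 'm \<Rightarrow> real^'n \<Rightarrow> real^'n \<Rightarrow> real^'n" where
  "frame_deriv c y h w =
    (\<Sum>j\<in>UNIV. w $ j *\<^sub>R frechet_derivative (\<lambda>z. s (chart_inv c z) (axis j 1) c) (at (snd c y)) h)"

lemma field_chart_derivative:
  assumes X: "vector_field_on A U X" and y: "y \<in> U" and c: "c \<in> A" "y \<in> fst c"
  shows "frechet_derivative (\<lambda>z. X (chart_inv c z) c) (at (snd c y)) h =
    s y (frechet_derivative (\<lambda>z. comps X (chart_inv c z)) (at (snd c y)) h) c + frame_deriv c y h (comps X y)"
proof -
  define W where "W = snd c ` (fst c \<inter> U)"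
  have W: "open W" "snd c y \<in> W" using open_chart_image[OF c(1) U] c y by (auto simp: W_def)
  have WU: "chart_inv c z \<in> U" if "z \<in> W" for z
  proof -
    obtain x where "x \<in> fst c" "x \<in> U" "z = snd c x" using \<open>z \<in> W\<close> unfolding W_def by blast
    then show ?thesis using c by simp
  qed
  have "((\<lambda>z. s (chart_inv c z) (comps X (chart_inv c z)) c) has_derivative
      (\<lambda>h. s (chart_inv c (snd c y)) (frechet_derivative (\<lambda>z. comps X (chart_inv c z)) (at (snd c y)) h) c +
        (\<Sum>j\<in>UNIV. comps X (chart_inv c (snd c y)) $ j *\<^sub>R
           frechet_derivative (\<lambda>z. s (chart_inv c z) (axis j 1) c) (at (snd c y)) h))) (at (snd c y))"
    by (rule has_derivative_apply_linear[OF _ W _ comps_has_derivative[OF X y c]])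
       (use linear_frame_chart WU vector_field_local_derivative[OF frame_field U c(1) W(2)[unfolded W_def]] in auto)
  then have "((\<lambda>z. X (chart_inv c z) c) has_derivative
      (\<lambda>h. s y (frechet_derivative (\<lambda>z. comps X (chart_inv c z)) (at (snd c y)) h) c +
        frame_deriv c y h (comps X y))) (at (snd c y))"
    unfolding frame_deriv_def chart_inv[OF c]
    by (rule has_derivative_transform_within_open[OF _ W]) (simp add: frame_comps[OF X WU])
  from frechet_derivative_at[OF this] show ?thesis by (metis (no_types, lifting))
qed

text \<open>The derivatives of the components cancel between the covariant derivatives and the
  bracket. The remaining expression involves only \<open>X y\<close> and \<open>Y y\<close>, which
  is the tensoriality of the torsion.\<close>

lemma torsion_chart:
  assumes X: "vector_field_on A U X" and Y: "vector_field_on A U Y" and y: "y \<in> U" and c: "c \<in> A" "y \<in> fst c"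
  shows "(nabla X Y y - nabla Y X y - lie_bracket A X Y y) c =
    s y (conn_form y (comps X y) *v comps Y y) c - s y (conn_form y (comps Y y) *v comps X y) c
    - frame_deriv c y (X y c) (comps Y y) + frame_deriv c y (Y y c) (comps X y)"
proof -
  have t: "X y \<in> tangent_space A y" "Y y \<in> tangent_space A y"
    using X Y y by (auto simp: vector_field_on_def)
  have "lie_bracket A X Y y c = frechet_derivative (\<lambda>z. Y (chart_inv c z) c) (at (snd c y)) (X y c) -
            frechet_derivative (\<lambda>z. X (chart_inv c z) c) (at (snd c y)) (Y y c)"
    using c by (simp add: lie_bracket_def)
  then show ?thesis
    by (simp add: connection_comps[OF X Y y] connection_comps[OF Y X y] tderiv_comps[OF X y c t(2)]
        tderiv_comps[OF Y y c t(1)] field_chart_derivative[OF X y c] field_chart_derivative[OF Y y c]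
        linear_add[OF linear_frame[OF y]])
qed

end

section \<open>Bracket and curvature of a symmetric connection\<close>

locale framed_symmetric_connection = framed_connection T A U s nabla
  for T :: "'m topology" and A :: "('m, real^'n) chart set"
    and U :: "'m set" and s :: "'m \<Rightarrow> real^'n \<Rightarrow> ('m, 'n) tvec"
    and nabla :: "('m \<Rightarrow> ('m, 'n) tvec) \<Rightarrow> ('m \<Rightarrow> ('m, 'n) tvec) \<Rightarrow> 'm \<Rightarrow> ('m, 'n) tvec" +
  assumes torsion_free: "x \<in> topspace T \<Longrightarrow> u \<in> tangent_space A x \<Longrightarrow> v \<in> tangent_space A x \<Longrightarrow>
    torsion_at T A nabla x u v = 0"
begin

lemma restrict_frame:
  assumes "openin T U'" "U' \<subseteq> U"
  shows "framed_symmetric_connection T A U' s nabla"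
  by unfold_locales (use assms frame_section_on_subset[OF s] torsion_free nabla in auto)

text \<open>Torsion-freeness is given only for the fields picked by \<open>field_through\<close>. By
  \<open>torsion_chart\<close> their torsion at \<open>y\<close> agrees with that of
  \<open>X\<close> and \<open>Y\<close> in every chart around \<open>y\<close>; on all other charts
  every term vanishes.\<close>

lemma lie_bracket_eq:
  assumes X: "vector_field_on A U X" and Y: "vector_field_on A U Y" and y: "y \<in> U"
  shows "lie_bracket A X Y y = nabla X Y y - nabla Y X y"
proof
  fix c
  have t: "X y \<in> tangent_space A y" "Y y \<in> tangent_space A y"
    "nabla X Y y \<in> tangent_space A y" "nabla Y X y \<in> tangent_space A y"
    using X Y y connection_field[OF nabla U] by (auto simp: vector_field_on_def)
  show "lie_bracket A X Y y c = (nabla X Y y - nabla Y X y) c"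
  proof (cases "c \<in> A \<and> y \<in> fst c")
    case True
    then have c: "c \<in> A" "y \<in> fst c" by simp_all
    define X' Y' where "X' = field_through T A y (X y)" and "Y' = field_through T A y (Y y)"
    obtain U1 U2 where U1: "openin T U1" "y \<in> U1" "vector_field_on A U1 X'"
      and U2: "openin T U2" "y \<in> U2" "vector_field_on A U2 Y'"
      using field_through(2)[OF y t(1)] field_through(2)[OF y t(2)] X'_def Y'_def by blast
    define U' where "U' = U \<inter> (U1 \<inter> U2)"
    have U': "openin T U'" "y \<in> U'" "U' \<subseteq> U" using U U1 U2 y by (auto simp: U'_def)
    interpret U': framed_symmetric_connection T A U' s nabla
      by (rule restrict_frame) (use U' in auto)
    have XY: "vector_field_on A U' X'" "vector_field_on A U' Y'"
      using U1 U2 by (auto simp: U'_def intro: vector_field_on_subset)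
    have eq: "X' y = X y" "Y' y = Y y"
      using field_through(1)[OF y] t by (simp_all add: X'_def Y'_def)
    have cmp: "comps X' y = comps X y" "comps Y' y = comps Y y" by (simp_all add: comps_def eq)
    have "y \<in> topspace T" using openin_subset[OF U] y by blast
    from torsion_free[OF this t(1,2)] have "nabla X' Y' y - nabla Y' X' y - lie_bracket A X' Y' y = 0"
      by (simp only: torsion_at_def Let_def X'_def Y'_def)
    then have "(nabla X Y y - nabla Y X y - lie_bracket A X Y y) c = 0"
      unfolding torsion_chart[OF X Y y c]
      using U'.torsion_chart[OF XY U'(2) c] by (simp add: eq cmp)
    then show ?thesis by simp
  next
    case False
    then have "lie_bracket A X Y y c = 0"
      unfolding lie_bracket_def by (simp only: if_False)
    moreover have "nabla X Y y c = 0" "nabla Y X y c = 0"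
      using tangent_space_outside[OF t(3)] tangent_space_outside[OF t(4)] False by blast+
    ultimately show ?thesis by simp
  qed
qed

definition conn_form_deriv :: "('m, real^'n) chart \<Rightarrow> 'm \<Rightarrow> real^'n \<Rightarrow> real^'n \<Rightarrow> real^'n^'n" where
  "conn_form_deriv c y h u =
    (\<Sum>i\<in>UNIV. u $ i *\<^sub>R frechet_derivative (\<lambda>z. conn_form (chart_inv c z) (axis i 1)) (at (snd c y)) h)"

lemma smooth_conn_form: "smooth_fun_on A U (\<lambda>y. conn_form y (axis i 1))"
  unfolding smooth_fun_on_def smooth_on_def
proof (intro ballI allI)
  fix c k assume c: "c \<in> A"
  have "conn_form y (axis i 1) $ l $ j = comps (frame_nabla i j) y $ l" for y l j
    by (simp add: conn_form_def axis_def if_distrib[of "\<lambda>r. r *\<^sub>R _"] sum.delta cong: if_cong)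
  moreover have "Ck_on k UNIV (snd c ` (fst c \<inter> U)) (\<lambda>z. comps (frame_nabla i j) (chart_inv c z) $ l)" for l j
    using smooth_comps_nth[OF frame_nabla_field] c by (simp add: smooth_fun_on_def smooth_on_def comp_def)
  ultimately show "Ck_on k UNIV (snd c ` (fst c \<inter> U)) ((\<lambda>y. conn_form y (axis i 1)) \<circ> chart_inv c)"
    by (intro Ck_on_vec) (simp add: comp_def)
qed

lemma conn_form_line_derivative:
  assumes y: "y \<in> U" and c: "c \<in> A" "y \<in> fst c"
  shows "((\<lambda>t. conn_form (chart_inv c (snd c y + t *\<^sub>R h)) u) has_vector_derivative conn_form_deriv c y h u) (at 0)"
proof -
  have "snd c y + 0 *\<^sub>R h \<in> snd c ` (fst c \<inter> U)" using y c by simp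
  note D = smooth_fun_local_derivative[OF smooth_conn_form U c(1) this]
  have "((\<lambda>t. \<Sum>i\<in>UNIV. u $ i *\<^sub>R conn_form (chart_inv c (snd c y + t *\<^sub>R h)) (axis i 1))
      has_vector_derivative conn_form_deriv c y h u) (at 0)"
    unfolding conn_form_deriv_def
    using has_vector_derivative_along_line[OF D]
    by (intro has_vector_derivative_sum bounded_linear.has_vector_derivative[OF bounded_linear_scaleR_right]) simp
  then show ?thesis
    by (simp flip: linear_expand_axis[OF linear_conn_form])
qed

text \<open>The right-hand side depends on the three fields only through their values at
  \<open>y\<close>; this tensoriality lets the formula be applied to the arbitrary fields inside
  \<open>curvature_at\<close>.\<close>

lemma curvature_conn_form:
  assumes X: "vector_field_on A U X" and Y: "vector_field_on A U Y" and Z: "vector_field_on A U Z"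
    and y: "y \<in> U" and c: "c \<in> A" "y \<in> fst c"
  shows "nabla X (nabla Y Z) y - nabla Y (nabla X Z) y - nabla (lie_bracket A X Y) Z y =
    s y ((conn_form_deriv c y (X y c) (comps Y y) - conn_form_deriv c y (Y y c) (comps X y)
      + commutator (conn_form y (comps X y)) (conn_form y (comps Y y))
      - conn_form y (conn_form y (comps X y) *v comps Y y - conn_form y (comps Y y) *v comps X y)) *v comps Z y)"
proof -
  define W where "W = snd c ` (fst c \<inter> U)"
  have W: "open W" "snd c y \<in> W" using open_chart_image[OF c(1) U] c y by (auto simp: W_def)
  have Wc: "chart_inv c z \<in> U \<and> chart_inv c z \<in> fst c \<and> snd c (chart_inv c z) = z" if "z \<in> W" for z
  proof -
    obtain x where "x \<in> fst c" "x \<in> U" "z = snd c x" using \<open>z \<in> W\<close> unfolding W_def by blast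
    then show ?thesis using c by simp
  qed
  define \<zeta> where "\<zeta> z = comps Z (chart_inv c z)" for z
  define th where "th z u = conn_form (chart_inv c z) u" for z u
  note YZ = connection_field[OF nabla U Y Z] and XZ = connection_field[OF nabla U X Z]
    and XY = connection_field[OF nabla U X Y] and YX = connection_field[OF nabla U Y X]
  have \<zeta>: "smooth_on UNIV W \<zeta>"
    using smooth_comps[OF Z] c(1) by (simp add: smooth_fun_on_def W_def \<zeta>_def[abs_def] comp_def)
  have tangent: "V y' \<in> tangent_space A y'" if "vector_field_on A U V" "y' \<in> U" for V y'
    using that by (simp add: vector_field_on_def)
  have nab: "comps (nabla V Z) (chart_inv c z) = frechet_derivative \<zeta> (at z) (V (chart_inv c z) c)
      + th z (comps V (chart_inv c z)) *v \<zeta> z" if V: "vector_field_on A U V" and z: "z \<in> W" for V z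
    using Wc[OF z] comps_connection[OF V Z] tderiv_comps[OF Z _ c(1) _ tangent[OF V]]
    by (simp add: th_def \<zeta>_def[abs_def])
  have D: "((\<lambda>z. frechet_derivative \<zeta> (at z) (V (chart_inv c z) c) + th z (comps V (chart_inv c z)) *v \<zeta> z)
      has_derivative frechet_derivative (\<lambda>z. comps (nabla V Z) (chart_inv c z)) (at (snd c y))) (at (snd c y))"
    if V: "vector_field_on A U V" for V
    by (rule has_derivative_transform_within_open[OF comps_has_derivative[OF connection_field[OF nabla U V Z] y c] W])
       (rule nab[OF V])
  have V0: "nabla V (nabla V' Z) y = s y (frechet_derivative (\<lambda>z. comps (nabla V' Z) (chart_inv c z)) (at (snd c y)) (V y c)
      + conn_form y (comps V y) *v (frechet_derivative \<zeta> (at (snd c y)) (V' y c) + conn_form y (comps V' y) *v comps Z y))"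
    if V: "vector_field_on A U V" and V': "vector_field_on A U V'" for V V'
    unfolding connection_comps[OF V connection_field[OF nabla U V' Z] y]
      tderiv_comps[OF connection_field[OF nabla U V' Z] y c tangent[OF V y]]
    using nab[OF V' W(2)] by (simp add: chart_inv[OF c] th_def \<zeta>_def)
  \<comment> \<open>Smoothness and the transformation law of the bracket are inherited from the
    covariant derivatives whose difference it is.\<close>
  have br: "vector_field_on A U (lie_bracket A X Y)"
    by (rule vector_field_on_cong[of U "\<lambda>z. nabla X Y z + - nabla Y X z"])
       (simp add: lie_bracket_eq[OF X Y], intro vector_field_on_add vector_field_on_minus XY YX)
  have br_chart: "lie_bracket A X Y y c = frechet_derivative (\<lambda>z. Y (chart_inv c z) c) (at (snd c y)) (X y c)
      - frechet_derivative (\<lambda>z. X (chart_inv c z) c) (at (snd c y)) (Y y c)"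
    using c by (simp add: lie_bracket_def)
  \<comment> \<open>Here symmetry brings \<open>conn_form\<close> into the components of the
    bracket; this is the source of the nested \<open>conn_form\<close> term in the
    curvature.\<close>
  have "s y (comps (lie_bracket A X Y) y) = s y (comps (nabla X Y) y - comps (nabla Y X) y)"
    unfolding linear_diff[OF linear_frame[OF y]] frame_comps[OF br y] frame_comps[OF XY y] frame_comps[OF YX y]
    by (rule lie_bracket_eq[OF X Y y])
  then have br_comps: "comps (lie_bracket A X Y) y =
      frechet_derivative (\<lambda>z. comps Y (chart_inv c z)) (at (snd c y)) (X y c) + conn_form y (comps X y) *v comps Y y
      - (frechet_derivative (\<lambda>z. comps X (chart_inv c z)) (at (snd c y)) (Y y c) + conn_form y (comps Y y) *v comps X y)"
    unfolding frame_eq_iff[OF y] comps_connection[OF X Y y] comps_connection[OF Y X y]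
      tderiv_comps[OF Y y c tangent[OF X y]] tderiv_comps[OF X y c tangent[OF Y y]] .
  have B: "nabla (lie_bracket A X Y) Z y = s y (frechet_derivative \<zeta> (at (snd c y)) (lie_bracket A X Y y c)
      + conn_form y (comps (lie_bracket A X Y) y) *v comps Z y)"
    unfolding connection_comps[OF br Z y] tderiv_comps[OF Z y c tangent[OF br y]] \<zeta>_def[abs_def] ..
  have thl: "linear (th z)" for z
    unfolding th_def[abs_def] by (rule linear_conn_form)
  have thd: "((\<lambda>z. th z (axis i 1)) has_derivative
      frechet_derivative (\<lambda>z. conn_form (chart_inv c z) (axis i 1)) (at (snd c y))) (at (snd c y))" for i
    unfolding th_def by (rule smooth_fun_local_derivative[OF smooth_conn_form U c(1)]) (use c y in blast)
  have loc: "((\<lambda>z. V (chart_inv c z) c) has_derivative frechet_derivative (\<lambda>z. V (chart_inv c z) c) (at (snd c y))) (at (snd c y))"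
    if "vector_field_on A U V" for V
    by (rule vector_field_local_derivative[OF that U c(1)]) (use c y in blast)
  have th0: "th (snd c y) = conn_form y" and \<zeta>0: "\<zeta> (snd c y) = comps Z y"
    using c by (simp_all add: th_def[abs_def] \<zeta>_def)
  note main = covariant_derivative_commutator[OF \<zeta> W thl thd loc[OF X] loc[OF Y] comps_has_derivative[OF X y c]
      comps_has_derivative[OF Y y c] D[OF Y] D[OF X], unfolded chart_inv[OF c] th0 \<zeta>0]
  show ?thesis
    unfolding V0[OF X Y] V0[OF Y X] B linear_diff[OF linear_frame[OF y], symmetric] br_chart br_comps
      conn_form_deriv_def
    by (rule arg_cong[where f = "s y"]) (rule main)
qed

lemma curvature_at_frame:
  assumes y: "y \<in> U" and c: "c \<in> A" "y \<in> fst c"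
  shows "curvature_at T A nabla y (s y u) (s y v) (s y w) =
    s y ((conn_form_deriv c y (s y u c) v - conn_form_deriv c y (s y v c) u
      + commutator (conn_form y u) (conn_form y v)
      - conn_form y (conn_form y u *v v - conn_form y v *v u)) *v w)"
proof -
  define X Y Z where "X = field_through T A y (s y u)" and "Y = field_through T A y (s y v)"
    and "Z = field_through T A y (s y w)"
  note ft = field_through[OF y frame_tangent[OF y]]
  obtain U1 U2 U3 where U1: "openin T U1" "y \<in> U1" "vector_field_on A U1 X"
    and U2: "openin T U2" "y \<in> U2" "vector_field_on A U2 Y"
    and U3: "openin T U3" "y \<in> U3" "vector_field_on A U3 Z"
    using ft(2)[of u] ft(2)[of v] ft(2)[of w] X_def Y_def Z_def by blast
  define U' where "U' = U \<inter> (U1 \<inter> (U2 \<inter> U3))"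
  have U': "openin T U'" "y \<in> U'" "U' \<subseteq> U" using U U1 U2 U3 y by (auto simp: U'_def)
  interpret U': framed_symmetric_connection T A U' s nabla
    by (rule restrict_frame) (use U' in auto)
  have XYZ: "vector_field_on A U' X" "vector_field_on A U' Y" "vector_field_on A U' Z"
    using U1 U2 U3 by (auto simp: U'_def intro: vector_field_on_subset)
  have eq: "X y = s y u" "Y y = s y v" "Z y = s y w"
    using ft(1) by (simp_all add: X_def Y_def Z_def)
  have cmp: "comps X y = u" "comps Y y = v" "comps Z y = w"
    using y by (simp_all add: comps_def eq)
  show ?thesis
    using U'.curvature_conn_form[OF XYZ U'(2) c]
    unfolding eq cmp by (simp only: curvature_at_def Let_def X_def Y_def Z_def)
qed

end

section \<open>Inner torsion and infinitesimal homogeneity\<close>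

context
  fixes V :: "(real^'n^'n) set" and \<tau> :: "(real^'n^'n) topology"
    and B :: "(real^'n^'n, real^'n^'n) chart set" and G :: "(real^'n^'n) set"
    and T :: "'m topology" and A :: "('m, real^'n) chart set"
    and P :: "'m \<Rightarrow> (real^'n \<Rightarrow> ('m, 'n) tvec) set"
  assumes lie: "lie_subgroup V \<tau> B G" and struct: "G_structure T A G P"
begin

lemma G_structure_orbit:
  assumes x: "x \<in> topspace T" and p: "p \<in> P x" and q: "q \<in> P x"
  obtains h where "h \<in> G" "\<forall>u. q u = p (h *v u)"
proof -
  obtain p0 where P: "P x = {p0 \<circ> (\<lambda>u. g *v u) | g. g \<in> G}"
    using struct x unfolding G_structure_def by blast
  obtain g g' where g: "g \<in> G" "p = p0 \<circ> (\<lambda>u. g *v u)" and g': "g' \<in> G" "q = p0 \<circ> (\<lambda>u. g' *v u)"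
    using p q unfolding P by blast
  show thesis
  proof
    show "matrix_inv g ** g' \<in> G" using lie_mult[OF lie] lie_inv[OF lie] g(1) g'(1) by blast
    have "g ** (matrix_inv g ** g') = g'"
      by (simp add: matrix_mul_assoc matrix_inv_right[OF lie_invertible[OF lie g(1)]])
    then show "\<forall>u. q u = p ((matrix_inv g ** g') *v u)"
      by (simp add: g(2) g'(2) matrix_vector_mul_assoc)
  qed
qed

lemma G_structure_right_action:
  assumes x: "x \<in> topspace T" and p: "p \<in> P x" and g: "g \<in> G"
  shows "(\<lambda>u. p (g *v u)) \<in> P x"
proof -
  obtain p0 where P: "P x = {p0 \<circ> (\<lambda>u. g *v u) | g. g \<in> G}"
    using struct x unfolding G_structure_def by blast
  obtain g' where g': "g' \<in> G" "p = p0 \<circ> (\<lambda>u. g' *v u)"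
    using p unfolding P by blast
  have "(\<lambda>u. p (g *v u)) = p0 \<circ> (\<lambda>u. (g' ** g) *v u)"
    by (simp add: g'(2) fun_eq_iff matrix_vector_mul_assoc)
  then show ?thesis using lie_mult[OF lie g'(1) g] unfolding P by blast
qed

lemma G_structure_frame:
  assumes x: "x \<in> topspace T" and p: "p \<in> P x"
  shows "p \<in> frames A x"
proof -
  obtain p0 where p0: "p0 \<in> frames A x" and P: "P x = {p0 \<circ> (\<lambda>u. g *v u) | g. g \<in> G}"
    using struct x unfolding G_structure_def by blast
  obtain g where g: "g \<in> G" "p = p0 \<circ> (\<lambda>u. g *v u)"
    using p unfolding P by blast
  have "bij ((*v) g)"
  proof (rule bijI')
    show "(g *v u = g *v v) = (u = v)" for u v
      using matrix_inv_left[OF lie_invertible[OF lie g(1)]]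
      by (metis matrix_vector_mul_assoc matrix_vector_mul_lid)
    show "\<exists>u. v = g *v u" for v
      using matrix_inv_right[OF lie_invertible[OF lie g(1)]]
      by (metis matrix_vector_mul_assoc matrix_vector_mul_lid)
  qed
  then show ?thesis
    using p0 unfolding frames_def g(2)
    by (auto intro: linear_compose matrix_vector_mul_linear bij_betw_trans[of _ UNIV UNIV])
qed

lemma Ad_frame:
  assumes "x \<in> topspace T" "p \<in> P x"
  shows "Ad p L (p w) = p (L *v w)"
proof -
  have "inj p" using G_structure_frame[OF assms] by (simp add: frames_def bij_betw_def)
  then show ?thesis by (simp add: Ad_def)
qed

lemma G_structure_frame_eq:
  assumes "x \<in> topspace T" "p \<in> P x"
  shows "p u = p v \<longleftrightarrow> u = v"
  using G_structure_frame[OF assms] by (auto simp: frames_def bij_betw_def dest: injD)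

lemma Ad_right_translate:
  assumes x: "x \<in> topspace T" and p: "p \<in> P x" and h: "h \<in> G" and q: "q \<in> P x" "\<forall>u. q u = p (h *v u)"
  shows "Ad q L (p w) = p ((h ** L ** matrix_inv h) *v w)"
proof -
  have "p w = q (matrix_inv h *v w)"
    using q(2) by (simp add: matrix_vector_mul_assoc matrix_inv_right[OF lie_invertible[OF lie h]])
  then have "Ad q L (p w) = q (L *v (matrix_inv h *v w))"
    using Ad_frame[OF x q(1)] by simp
  then show ?thesis using q(2) by (simp add: matrix_vector_mul_assoc matrix_mul_assoc)
qed

text \<open>The inner torsion at \<open>x\<close> in direction \<open>p (g *v u)\<close> does not
  refer to a frame. Homogeneity expresses it through \<open>p\<close> with argument
  \<open>g *v u\<close>, and through \<open>\<lambda>u. p (g *v u)\<close> with argument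
  \<open>u\<close>; the two cosets are compared.\<close>

lemma inner_torsion_equivariant_lifting:
  assumes ct: "characteristic_tensors T A nabla (lie_algebra V B) P R\<^sub>0 T\<^sub>0 J\<^sub>0"
    and lam: "lifting (lie_algebra V B) J\<^sub>0 lam"
    and x: "x \<in> topspace T" and p: "p \<in> P x" and g: "g \<in> G"
  shows "lam (g *v u) - g ** lam u ** matrix_inv g \<in> lie_algebra V B"
proof -
  note pg = G_structure_right_action[OF x p g]
  have J: "J\<^sub>0 u = coset (lie_algebra V B) (lam u)" for u using lam by (simp add: lifting_def)
  have "Ad p ` J\<^sub>0 (g *v u) = Ad (\<lambda>u. p (g *v u)) ` J\<^sub>0 u"
    using ct x p pg unfolding characteristic_tensors_def by metis
  moreover have "lam (g *v u) \<in> J\<^sub>0 (g *v u)"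
    using subspace_0[OF subspace_lie_algebra[OF lie]] by (force simp: J coset_def)
  ultimately obtain L where L: "L \<in> lie_algebra V B"
    and eq: "Ad p (lam (g *v u)) = Ad (\<lambda>u. p (g *v u)) (lam u + L)"
    unfolding J[of u] coset_def by blast
  have "p (lam (g *v u) *v w) = p ((g ** (lam u + L) ** matrix_inv g) *v w)" for w
    using fun_cong[OF eq, of "p w"] unfolding Ad_frame[OF x p] Ad_right_translate[OF x p g pg allI[OF refl]] .
  then have "lam (g *v u) = g ** (lam u + L) ** matrix_inv g"
    unfolding G_structure_frame_eq[OF x p] by (simp add: matrix_eq)
  then have "lam (g *v u) - g ** lam u ** matrix_inv g = g ** L ** matrix_inv g"
    by (simp add: bounded_bilinear.add_right[OF bounded_bilinear_matrix_mult]
        bounded_bilinear.add_left[OF bounded_bilinear_matrix_mult])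
  then show ?thesis using lie_algebra_Ad[OF lie L g] by simp
qed

text \<open>
  The inner torsion at \<open>y\<close> is computed with a section \<open>s'\<close> chosen separately for each \<open>y\<close>. The
  transition \<open>k\<close> from \<open>s\<close> to \<open>s'\<close> is \<open>G\<close>-valued, and \<open>k\<^sup>-\<^sup>1 dk\<close> is the difference of the two
  connection forms up to conjugation by \<open>k\<close>.
\<close>

lemma conn_form_minus_lifting:
  assumes M: "smooth_manifold UNIV T A" and nabla: "linear_connection T A nabla"
    and ct: "characteristic_tensors T A nabla (lie_algebra V B) P R\<^sub>0 T\<^sub>0 J\<^sub>0"
    and lam: "lifting (lie_algebra V B) J\<^sub>0 lam"
    and U: "openin T U" and s: "frame_section_on A U s" "\<forall>y\<in>U. s y \<in> P y" and y: "y \<in> U"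
  shows "framed_connection.conn_form s nabla y u - lam u \<in> lie_algebra V B"
proof -
  have top: "x \<in> topspace T" if "x \<in> U" for x using that openin_subset[OF U] by blast
  \<comment> \<open>This is the very choice made inside \<open>inner_torsion\<close>, so that
    definition can be folded to \<open>s'\<close>.\<close>
  define s' where "s' = (SOME s. local_section T A P y s)"
  have "\<exists>s. local_section T A P y s"
    using struct top[OF y] unfolding G_structure_def by blast
  then have "local_section T A P y s'" unfolding s'_def by (rule someI_ex)
  then obtain U2 where U2: "openin T U2" "y \<in> U2" "frame_section_on A U2 s'" "\<forall>y\<in>U2. s' y \<in> P y"
    unfolding local_section_def by blast
  define U' where "U' = U \<inter> U2"
  have U': "openin T U'" "y \<in> U'" "U' \<subseteq> U" "U' \<subseteq> U2" using U U2 y by (auto simp: U'_def)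
  interpret F: framed_connection T A U' s nabla
    by unfold_locales (use M U' nabla frame_section_on_subset[OF s(1)] in auto)
  interpret F': framed_connection T A U' s' nabla
    by unfold_locales (use U' nabla frame_section_on_subset[OF U2(3)] in auto)
  have top: "x \<in> topspace T" if "x \<in> U'" for x using that U' top by blast
  have sP: "s z \<in> P z" "s' z \<in> P z" if "z \<in> U'" for z using that U' s(2) U2(4) by auto
  obtain c where c: "c \<in> A" "y \<in> fst c" using F.chart_at[OF top[OF U'(2)]] by blast
  define k where "k z = matrix (\<lambda>w. inv (s' z) (s z w))" for z
  have k: "k z \<in> G" "s z w = s' z (k z *v w)" if z: "z \<in> U'" for z w
  proof -
    obtain h where h: "h \<in> G" "\<forall>u. s z u = s' z (h *v u)"
      using G_structure_orbit[OF top[OF z] sP(2,1)[OF z]] by blast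
    then have "k z = h" using F'.frame_inv[OF z] by (simp add: k_def matrix_of_matrix_vector_mul)
    then show "k z \<in> G" "s z w = s' z (k z *v w)" using h by simp_all
  qed
  have compsE: "F'.comps (\<lambda>z. s z w) z = k z *v w" if "z \<in> U'" for z w
    using k(2)[OF that] F'.frame_inv[OF that] by (simp add: F'.comps_def)
  define W where "W = snd c ` (fst c \<inter> U')"
  have W: "open W" "snd c y \<in> W" using F.open_chart_image[OF c(1) U'(1)] c U'(2) by (auto simp: W_def)
  have WU: "chart_inv c z \<in> U'" if "z \<in> W" for z
  proof -
    obtain x where "x \<in> fst c" "x \<in> U'" "z = snd c x" using \<open>z \<in> W\<close> unfolding W_def by blast
    then show ?thesis using c by simp
  qed
  \<comment> \<open>The columns of \<open>k\<close> are the components, in the frame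
    \<open>s'\<close>, of the fields of the frame \<open>s\<close>.\<close>
  have "Ck_on n UNIV W (\<lambda>z. k (chart_inv c z))" for n
  proof (intro Ck_on_vec)
    fix l j
    have "Ck_on n UNIV W (\<lambda>z. F'.comps (\<lambda>z. s z (axis j 1)) (chart_inv c z) $ l)"
      using F'.smooth_comps_nth[OF F.frame_field[of "axis j 1"], of l] c(1)
      by (simp add: smooth_fun_on_def smooth_on_def comp_def W_def)
    moreover have "F'.comps (\<lambda>z. s z (axis j 1)) (chart_inv c z) $ l = k (chart_inv c z) $ l $ j" if "z \<in> W" for z
      using compsE[OF WU[OF that]] by (simp add: matrix_vector_mult_basis column_def)
    ultimately show "Ck_on n UNIV W (\<lambda>z. k (chart_inv c z) $ l $ j)"
      using Ck_on_cong[of W "\<lambda>z. F'.comps (\<lambda>z. s z (axis j 1)) (chart_inv c z) $ l"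
          "\<lambda>z. k (chart_inv c z) $ l $ j" n UNIV]
      by simp
  qed
  then have ksm: "smooth_on UNIV W (\<lambda>z. k (chart_inv c z))" by (simp add: smooth_on_def)
  define D where "D = frechet_derivative (\<lambda>z. k (chart_inv c z)) (at (snd c y))"
  have D: "((\<lambda>z. k (chart_inv c z)) has_derivative D) (at (snd c y))"
    unfolding D_def by (rule smooth_on_frechet[OF ksm W])
  define h where "h = s y u c"
  define \<Theta> where "\<Theta> = F.conn_form y u"
  define \<Theta>' where "\<Theta>' = F'.conn_form y (k y *v u)"
  note iy = matrix_inv_left[OF lie_invertible[OF lie k(1)[OF U'(2)]]]
  \<comment> \<open>The field \<open>\<lambda>z. s z w\<close> is differentiated in both frames: its
    components are constant in \<open>s\<close> and equal to \<open>k z *v w\<close> in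
    \<open>s'\<close>.\<close>
  have "k y ** \<Theta> = D h + \<Theta>' ** k y"
  proof (rule iffD2[OF matrix_eq], rule allI)
    fix w
    define E where "E w z = s z w" for w z
    have E: "vector_field_on A U' (E w)" for w unfolding E_def[abs_def] by (rule F.frame_field)
    have Et: "E u y \<in> tangent_space A y" using F.frame_tangent[OF U'(2)] by (simp add: E_def)
    have FE: "F.comps (E w) z = w" if "z \<in> U'" for w z
      using F.frame_inv[OF that] by (simp add: F.comps_def E_def)
    have F'E: "F'.comps (E w) z = k z *v w" if "z \<in> U'" for w z
      using compsE[OF that] by (simp add: E_def[abs_def])
    have "((\<lambda>z. F.comps (E w) (chart_inv c z)) has_derivative (\<lambda>h. 0)) (at (snd c y))"
      by (rule has_derivative_transform_within_open[OF has_derivative_const W]) (simp add: FE[OF WU])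
    from F.tderiv_chart[OF F.smooth_comps[OF E] U'(1,2) c Et this]
    have 1: "nabla (E u) (E w) y = s y (\<Theta> *v w)"
      using F.connection_comps[OF E E U'(2), of u w] FE[OF U'(2)] by (simp add: \<Theta>_def)
    have "((\<lambda>z. k (chart_inv c z) *v w) has_derivative (\<lambda>h. D h *v w)) (at (snd c y))"
      by (rule bounded_linear.has_derivative[OF bounded_bilinear.bounded_linear_left[OF
              bounded_bilinear_matrix_vector_mult] D])
    then have "((\<lambda>z. F'.comps (E w) (chart_inv c z)) has_derivative (\<lambda>h. D h *v w)) (at (snd c y))"
      by (rule has_derivative_transform_within_open[OF _ W]) (simp add: F'E[OF WU])
    from F.tderiv_chart[OF F'.smooth_comps[OF E] U'(1,2) c Et this]
    have 2: "nabla (E u) (E w) y = s' y (D h *v w + \<Theta>' *v (k y *v w))"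
      using F'.connection_comps[OF E E U'(2), of u w] F'E[OF U'(2)] by (simp add: \<Theta>'_def h_def E_def[of u y])
    have "s' y (k y *v (\<Theta> *v w)) = s' y (D h *v w + \<Theta>' *v (k y *v w))"
      using 1 2 k(2)[OF U'(2)] by simp
    then show "(k y ** \<Theta>) *v w = (D h + \<Theta>' ** k y) *v w"
      unfolding F'.frame_eq_iff[OF U'(2)]
      by (simp add: matrix_vector_mul_assoc matrix_vector_mult_add_rdistrib)
  qed
  then have "matrix_inv (k y) ** (k y ** \<Theta>) = matrix_inv (k y) ** (D h + \<Theta>' ** k y)" by simp
  then have \<Theta>: "\<Theta> = matrix_inv (k y) ** D h + matrix_inv (k y) ** \<Theta>' ** k y"
    by (simp add: matrix_mul_assoc iy bounded_bilinear.add_right[OF bounded_bilinear_matrix_mult])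
  obtain \<epsilon> where \<epsilon>: "\<epsilon> > 0" "\<And>t. \<bar>t\<bar> < \<epsilon> \<Longrightarrow> snd c y + t *\<^sub>R h \<in> W"
    using openin_subspace_line[of UNIV W "snd c y" h] W by auto
  have "Ck_on 0 UNIV W (\<lambda>z. k (chart_inv c z))" using ksm unfolding smooth_on_def by blast
  then have cont: "continuous_on W (\<lambda>z. k (chart_inv c z))" by simp
  \<comment> \<open>The fixed left factor makes the curve of transition matrices start at the
    identity without leaving \<open>G\<close>; its velocity is the first summand of
    \<open>\<Theta>\<close>.\<close>
  define \<gamma> where "\<gamma> t = matrix_inv (k y) ** k (chart_inv c (snd c y + t *\<^sub>R h))" for t
  note bl = bounded_bilinear.bounded_linear_right[OF bounded_bilinear_matrix_mult]
  have "((\<lambda>t. k (chart_inv c (snd c y + t *\<^sub>R h))) has_vector_derivative D h) (at 0)"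
    using D by (intro has_vector_derivative_along_line) simp
  then have "(\<gamma> has_vector_derivative matrix_inv (k y) ** D h) (at 0)"
    unfolding \<gamma>_def by (rule bounded_linear.has_vector_derivative[OF bl])
  moreover have "continuous_on {-\<epsilon><..<\<epsilon>} \<gamma>"
    unfolding \<gamma>_def using \<epsilon>
    by (intro bounded_linear.continuous_on[OF bl] continuous_on_compose2[OF cont] continuous_intros)
       (auto simp: abs_less_iff)
  moreover have "\<gamma> t \<in> G" if "\<bar>t\<bar> < \<epsilon>" for t
    unfolding \<gamma>_def using k(1) U'(2) WU[OF \<epsilon>(2)[OF that]] by (intro lie_mult[OF lie] lie_inv[OF lie])
  ultimately have "curve_in G \<epsilon> \<gamma> (matrix_inv (k y) ** D h)"
    using \<epsilon>(1) by (simp add: curve_in_def)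
  then have D1: "matrix_inv (k y) ** D h \<in> lie_algebra V B"
    by (rule curve_in_lie_algebra[OF lie]) (use c iy in \<open>simp add: \<gamma>_def\<close>)
  \<comment> \<open>\<open>lie_algebra_at\<close> conjugates by a frame of its own choice.
    Ad-invariance of the Lie algebra absorbs its difference from \<open>s y\<close>.\<close>
  define q where "q = (SOME p. p \<in> P y)"
  have q: "q \<in> P y" unfolding q_def by (rule someI[of "\<lambda>p. p \<in> P y", OF sP(1)[OF U'(2)]])
  note ty = top[OF U'(2)] and sy = sP(1)[OF U'(2)] and s'y = sP(2)[OF U'(2)]
  have J: "J\<^sub>0 u = coset (lie_algebra V B) (lam u)" using lam by (simp add: lifting_def)
  have "Ad (s y) ` J\<^sub>0 u = inner_torsion T A nabla (lie_algebra V B) P y (s y u)"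
    using ct ty sy unfolding characteristic_tensors_def by blast
  also have "\<dots> = coset (Ad q ` lie_algebra V B) (Ad (s' y) \<Theta>')"
    using F'.connection_difference_conn_form[OF U'(2) F.frame_tangent[OF U'(2)], of u]
      F'.frame_inv[OF U'(2)] k(2)[OF U'(2), of u]
    by (simp add: inner_torsion_def Let_def lie_algebra_at_def flip: q_def s'_def \<Theta>'_def)
  finally have "Ad (s y) ` J\<^sub>0 u = coset (Ad q ` lie_algebra V B) (Ad (s' y) \<Theta>')" .
  moreover have "lam u \<in> J\<^sub>0 u"
    using subspace_0[OF subspace_lie_algebra[OF lie]] by (force simp: J coset_def)
  ultimately obtain L where L: "L \<in> lie_algebra V B" and eq: "Ad (s y) (lam u) = Ad (s' y) \<Theta>' + Ad q L"
    unfolding coset_def by blast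
  obtain g where g: "g \<in> G" "\<forall>u. q u = s y (g *v u)"
    using G_structure_orbit[OF ty sy q] by blast
  have s'eq: "s' y w = s y (matrix_inv (k y) *v w)" for w
    using k(2)[OF U'(2)] matrix_inv_right[OF lie_invertible[OF lie k(1)[OF U'(2)]]]
    by (simp add: matrix_vector_mul_assoc)
  \<comment> \<open>All three endomorphisms are rewritten in the frame \<open>s y\<close>: coming
    from \<open>s' y\<close> conjugates by \<open>k y\<close>, coming from \<open>q\<close>
    conjugates by \<open>g\<close>.\<close>
  have "s y (lam u *v w) = s y ((matrix_inv (k y) ** \<Theta>' ** k y + g ** L ** matrix_inv g) *v w)" for w
  proof -
    have "Ad (s' y) \<Theta>' (s y w) = s' y (\<Theta>' *v (k y *v w))"
      unfolding k(2)[OF U'(2), of w] by (rule Ad_frame[OF ty s'y])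
    also have "\<dots> = s y ((matrix_inv (k y) ** \<Theta>' ** k y) *v w)"
      by (simp add: s'eq matrix_vector_mul_assoc matrix_mul_assoc)
    finally have "Ad (s' y) \<Theta>' (s y w) = s y ((matrix_inv (k y) ** \<Theta>' ** k y) *v w)" .
    then show ?thesis
      using fun_cong[OF eq, of "s y w"] Ad_frame[OF ty sy] Ad_right_translate[OF ty sy g(1) q g(2)]
      unfolding matrix_vector_mult_add_rdistrib linear_add[OF F.linear_frame[OF U'(2)]] plus_fun_apply by simp
  qed
  then have "lam u = matrix_inv (k y) ** \<Theta>' ** k y + g ** L ** matrix_inv g"
    unfolding F.frame_eq_iff[OF U'(2)] by (simp add: matrix_eq)
  then have "\<Theta> - lam u = matrix_inv (k y) ** D h - g ** L ** matrix_inv g"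
    using \<Theta> by simp
  then show ?thesis
    unfolding \<Theta>_def using subspace_diff[OF subspace_lie_algebra[OF lie] D1 lie_algebra_Ad[OF lie L g(1)]] by simp
qed

end

section \<open>The curvature modulo the Lie algebra\<close>

theorem theorem4p4:
  fixes T :: "'m topology"
    and A :: "('m, real^'n) chart set"
    and nabla :: "('m \<Rightarrow> ('m, 'n) tvec) \<Rightarrow> ('m \<Rightarrow> ('m, 'n) tvec) \<Rightarrow> 'm \<Rightarrow> ('m, 'n) tvec"
    and V G \<gg> :: "(real^'n^'n) set"
    and \<tau> :: "(real^'n^'n) topology"
    and B :: "(real^'n^'n, real^'n^'n) chart set"
    and P :: "'m \<Rightarrow> (real^'n \<Rightarrow> ('m, 'n) tvec) set"
    and R\<^sub>0 :: "real^'n \<Rightarrow> real^'n \<Rightarrow> real^'n \<Rightarrow> real^'n"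
    and T\<^sub>0 :: "real^'n \<Rightarrow> real^'n \<Rightarrow> real^'n"
    and J\<^sub>0 :: "real^'n \<Rightarrow> (real^'n^'n) set"
    and lam :: "real^'n \<Rightarrow> real^'n^'n"
    and u v :: "real^'n"
  assumes "smooth_manifold UNIV T A" and "topspace T \<noteq> {}"
    and "lie_subgroup V \<tau> B G" and "\<gg> = lie_algebra V B"
    and "symmetric_connection T A nabla"
    and "G_structure T A G P"
    and "characteristic_tensors T A nabla \<gg> P R\<^sub>0 T\<^sub>0 J\<^sub>0"
    and "lifting \<gg> J\<^sub>0 lam"
  shows "matrix (R\<^sub>0 u v) - commutator (lam u) (lam v) + lam (lam u *v v - lam v *v u) \<in> \<gg>"
proof -
  note M = assms(1) and lie = assms(3) and \<gg> = assms(4) and struct = assms(6)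
    and ct = assms(7)[unfolded \<gg>] and lam = assms(8)[unfolded \<gg>]
  have nabla: "linear_connection T A nabla" using assms(5) by (simp add: symmetric_connection_def)
  obtain x where x: "x \<in> topspace T" using assms(2) by blast
  obtain s U where U: "openin T U" "x \<in> U" and s: "frame_section_on A U s" "\<forall>y\<in>U. s y \<in> P y"
    using struct x unfolding G_structure_def local_section_def by blast
  interpret F: framed_symmetric_connection T A U s nabla
    by unfold_locales (use M U s(1) nabla assms(5) in \<open>auto simp: symmetric_connection_def\<close>)
  obtain c where c: "c \<in> A" "x \<in> fst c" using F.chart_at[OF x] by blast
  note sub = subspace_lie_algebra[OF lie]
  have linlam: "linear lam" using lam by (simp add: lifting_def)
  have sx: "s x \<in> P x" using U s by blast
  define \<theta> where "\<theta> = F.conn_form x"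
  have lin\<theta>: "linear \<theta>" unfolding \<theta>_def by (rule F.linear_conn_form)
  define K where "K u = \<theta> u - lam u" for u
  have K: "K u \<in> \<gg>" for u
    unfolding K_def \<theta>_def \<gg> by (rule conn_form_minus_lifting[OF lie struct M nabla ct lam U(1) s U(2)])
  have D: "F.conn_form_deriv c x (s x u c) v \<in> \<gg>" for u v
  proof -
    define W where "W = snd c ` (fst c \<inter> U)"
    have W: "open W" "snd c x \<in> W" using F.open_chart_image[OF c(1) U(1)] c U(2) by (auto simp: W_def)
    have WU: "chart_inv c z \<in> U" if "z \<in> W" for z
    proof -
      obtain x where "x \<in> fst c" "x \<in> U" "z = snd c x" using \<open>z \<in> W\<close> unfolding W_def by blast
      then show ?thesis using c by simp
    qed
    obtain \<epsilon> where \<epsilon>: "\<epsilon> > 0" "\<And>t. \<bar>t\<bar> < \<epsilon> \<Longrightarrow> snd c x + t *\<^sub>R s x u c \<in> W"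
      using openin_subspace_line[of UNIV W "snd c x" "s x u c"] W by auto
    have der: "((\<lambda>t. F.conn_form (chart_inv c (snd c x + t *\<^sub>R s x u c)) v - lam v) has_vector_derivative
        F.conn_form_deriv c x (s x u c) v - 0) (at 0)"
      by (intro has_vector_derivative_diff has_vector_derivative_const F.conn_form_line_derivative U c)
    show ?thesis
      unfolding \<gg>
    proof (rule vector_derivative_in_subspace[OF sub \<epsilon>(1) _ der[unfolded diff_0_right]])
      fix t :: real assume "\<bar>t\<bar> < \<epsilon>"
      then show "F.conn_form (chart_inv c (snd c x + t *\<^sub>R s x u c)) v - lam v \<in> lie_algebra V B"
        using conn_form_minus_lifting[OF lie struct M nabla ct lam U(1) s WU[OF \<epsilon>(2)]] by blast
    qed
  qed
  have E: "lam (L *v u) - commutator L (lam u) \<in> \<gg>" if "L \<in> \<gg>" for L u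
    using lie_algebra_infinitesimal_equivariance[OF lie linlam
        inner_torsion_equivariant_lifting[OF lie struct ct lam x sx]] that
    unfolding \<gg> by blast
  define Q where "Q = F.conn_form_deriv c x (s x u c) v - F.conn_form_deriv c x (s x v c) u
      + commutator (\<theta> u) (\<theta> v) - \<theta> (\<theta> u *v v - \<theta> v *v u)"
  have "s x (R\<^sub>0 u v w) = s x (Q *v w)" for w
  proof -
    have "curvature_at T A nabla x (s x u) (s x v) (s x w) = s x (R\<^sub>0 u v w)"
      using ct x sx unfolding characteristic_tensors_def by blast
    then show ?thesis
      unfolding F.curvature_at_frame[OF U(2) c] Q_def \<theta>_def by (rule sym)
  qed
  then have "R\<^sub>0 u v = (\<lambda>w. Q *v w)"
    unfolding F.frame_eq_iff[OF U(2)] by (rule ext)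
  then have R: "matrix (R\<^sub>0 u v) = Q"
    by (simp add: matrix_of_matrix_vector_mul)
  have \<theta>: "\<theta> w = lam w + K w" for w by (simp add: K_def)
  \<comment> \<open>After substituting \<open>\<theta> = lam + K\<close> the terms in
    \<open>lam\<close> alone cancel. The terms mixing \<open>lam\<close> with \<open>K u\<close> or
    \<open>K v\<close> are grouped as in \<open>E\<close>, once for \<open>L = K v\<close> and once
    for \<open>L = K u\<close>, so that every summand on the right lies in
    \<open>\<gg>\<close>.\<close>
  have "Q - commutator (lam u) (lam v) + lam (lam u *v v - lam v *v u) =
      F.conn_form_deriv c x (s x u c) v - F.conn_form_deriv c x (s x v c) u + commutator (K u) (K v)
      - K (\<theta> u *v v - \<theta> v *v u) + (lam (K v *v u) - commutator (K v) (lam u))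
      - (lam (K u *v v) - commutator (K u) (lam v))"
  proof -
    have "\<theta> u *v v - \<theta> v *v u = lam u *v v - lam v *v u + (K u *v v - K v *v u)"
      unfolding \<theta> matrix_vector_mult_add_rdistrib by simp
    then have 1: "\<theta> (\<theta> u *v v - \<theta> v *v u) = lam (lam u *v v - lam v *v u) + (lam (K u *v v) - lam (K v *v u))
        + K (\<theta> u *v v - \<theta> v *v u)"
      using \<theta>[of "\<theta> u *v v - \<theta> v *v u"] by (simp add: linear_add[OF linlam] linear_diff[OF linlam])
    have 2: "commutator (\<theta> u) (\<theta> v) = commutator (lam u) (lam v) - commutator (K v) (lam u)
        + commutator (K u) (lam v) + commutator (K u) (K v)"
      unfolding \<theta>[of u] \<theta>[of v] commutator_def
      by (simp add: bounded_bilinear.add_left[OF bounded_bilinear_matrix_mult]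
          bounded_bilinear.add_right[OF bounded_bilinear_matrix_mult])
    show ?thesis unfolding Q_def 1 2 by simp
  qed
  moreover have "commutator (K u) (K v) \<in> \<gg>"
    unfolding \<gg> using K lie_algebra_commutator[OF lie] by (simp add: \<gg>)
  ultimately show ?thesis
    unfolding R using D E K sub by (simp add: subspace_add subspace_diff flip: \<gg>)
qed

end
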